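(* Let $G$ be a compact (Hausdorff) group and let $\mathfrak E$ be a $G$-spectrum such that the coabelian classification datum $\mathfrak K=(\mathfrak E,\mathrm R,\mathbb Z)$, with $\mathrm R(H)=\mathrm{Com}^{\mathrm t}(H)$ the closed commutator subgroup of $H$ for all $H\in\mathfrak E^\flat_{\mathrm b}$, is coherent. Let $C:\mathfrak M\to\mathsf{Ab}$ be a cohomological Mackey functor on an arithmetic Mackey cover $\mathfrak M$ of $\mathfrak E$. Suppose that $C$ satisfies the class field axiom for all $(H,U)\in\mathfrak E_{\mathrm b}$ with $H/U$ cyclic of prime order $\ell$, for every prime number $\ell$. Then every $\mathfrak K$-prime morphism $\rho:\pi_{\mathfrak K}\to\widehat{\mathrm H}^0_{\mathfrak E}(C)$ is already a $\mathfrak K$-class field theory.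
   Context: $\mathsf{TAb}$ is the category of topological abelian groups; objects of $\mathsf{Ab}$ are regarded as discrete. ${}^gH=gHg^{-1}$, $H^g=g^{-1}Hg$. RIC-functors. A RIC-domain $\mathfrak D$ consists of a non-empty set $\mathfrak D_{\mathrm b}$ with a left action $(g,x)\mapsto{}^gx$ of a group $G$ and, for each $x\in\mathfrak D_{\mathrm b}$, subsets $\mathfrak D_{\mathrm r}(x),\mathfrak D_{\mathrm i}(x)\subseteq\mathfrak D_{\mathrm b}$ such that for $\star\in\{\mathrm r,\mathrm i\}$: $x\in\mathfrak D_\star(x)$; $y\in\mathfrak D_\star(x)$ implies $\mathfrak D_\star(y)\subseteq\mathfrak D_\star(x)$; ${}^g\mathfrak D_\star(x)=\mathfrak D_\star({}^gx)$. A RIC-functor $\Phi:\mathfrak D\to\mathcal C$ into a category $\mathcal C$ consists of objects $\Phi(x)$ and morphisms $\mathrm{res}_{y,x}:\Phi(x)\to\Phi(y)$ ($y\in\mathfrak D_{\mathrm r}(x)$), $\mathrm{ind}_{x,y}:\Phi(y)\to\Phi(x)$ ($y\in\mathfrak D_{\mathrm i}(x)$), $\mathrm{con}_{g,x}:\Phi(x)\to\Phi({}^gx)$ ($g\in G$) such that $\mathrm{res}_{x,x}=\mathrm{ind}_{x,x}=\mathrm{con}_{1,x}=\mathrm{id}$; $\mathrm{res}_{z,y}\mathrm{res}_{y,x}=\mathrm{res}_{z,x}$, $\mathrm{ind}_{x,y}\mathrm{ind}_{y,z}=\mathrm{ind}_{x,z}$, $\mathrm{con}_{g',{}^gx}\mathrm{con}_{g,x}=\mathrm{con}_{g'g,x}$;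 $\mathrm{con}_{g,y}\mathrm{res}_{y,x}=\mathrm{res}_{{}^gy,{}^gx}\mathrm{con}_{g,x}$ and $\mathrm{con}_{g,x}\mathrm{ind}_{x,y}=\mathrm{ind}_{{}^gx,{}^gy}\mathrm{con}_{g,y}$. Morphisms are families $(\varphi_x)$ commuting with res, ind, con; the category is $\mathsf{Fct}(\mathfrak D,\mathcal C)$. Subgroup systems and Mackey functors. A $G$-subgroup system is a RIC-domain $\mathfrak S$ where $\mathfrak S_{\mathrm b}$ is a set of subgroups of $G$ with the conjugation action and $I\le H$ for $I\in\mathfrak S_\star(H)$; $\mathfrak S'\le\mathfrak S$ means $\mathfrak S'_{\mathrm b}\subseteq\mathfrak S_{\mathrm b}$ and $\mathfrak S'_\star(H)\subseteq\mathfrak S_\star(H)$. It is arithmetic if for each $H\in\mathfrak S_{\mathrm b}$ both $\mathfrak S_{\mathrm r}(H)$ and $\mathfrak S_{\mathrm i}(H)$ contain all open subgroups of $H$. It is a $G$-Mackey system if for $I\in\mathfrak S_{\mathrm r}(H)$, $J\in\mathfrak S_{\mathrm i}(H)$ the set $I\backslash H/J$ is finite, $I\cap J\in\mathfrak S_{\mathrm r}(J)$ and $I\cap J\in\mathfrak S_{\mathrm i}(I)$. A RIC-functor on $\mathfrak S$ is stable if $\mathrm{con}_{h,H}=\mathrm{id}$ for $h\in H$. A Mackey functor is a stable RIC-functor on a Mackey system with values in a preadditive category such that $\mathrm{res}_{I,H}\mathrm{ind}_{H,J}=\sum_{h}\mathrm{ind}_{I,I\cap{}^hJ}\,\mathrm{con}_{h,I^h\cap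 J}\,\mathrm{res}_{I^h\cap J,J}$ ($h$ over representatives of $I\backslash H/J$); it is cohomological if $\mathrm{ind}_{H,I}\mathrm{res}_{I,H}=[H:I]\cdot\mathrm{id}$ for $I\in\mathfrak S_{\mathrm r}(H)\cap\mathfrak S_{\mathrm i}(H)$. Groups $C(H)$ are written multiplicatively. $G$-spectra. Let $\mathrm{Grp}^2(G)$ be the set of pairs $(H,U)$, $H$ closed subgroup of $G$, $U$ closed normal subgroup of $H$, ordered componentwise, with componentwise conjugation. A two-dimensional $G$-subgroup system is a RIC-domain $\mathfrak E$ with $\mathfrak E_{\mathrm b}\subseteq\mathrm{Grp}^2(G)$ and $(I,V)\le(H,U)$ for $(I,V)\in\mathfrak E_\star(H,U)$. Put $\mathfrak E^\flat_{\mathrm b}=\{H:(H,U)\in\mathfrak E_{\mathrm b}\text{ for some }U\}$, $\mathrm{Ext}(\mathfrak E,H)=\{U:(H,U)\in\mathfrak E_{\mathrm b}\}$, and $\mathfrak E^\flat_\star(H)$ = set of first components of $\bigcup_{U}\mathfrak E_\star(H,U)$. A $G$-spectrum is such an $\mathfrak E$ for which $\mathfrak E^\flat$ is a $G$-subgroup system, $(I,V)\in\mathfrak E_{\mathrm r}(H,U)$ implies $V=U$, and $[H:I]<\infty$ for $I\in\mathfrak E^\flat_{\mathrm r}(H)$. A Mackey cover of $\mathfrak E$ is a $G$-Mackey system $\mathfrak M$ with $\mathfrak E^\flat\le\mathfrak M$, $\mathrm{Ext}(\mathfrak E,H)\subseteq\mathfrak M_{\mathrm i}(H)$ for all $H\in\mathfrak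 E^\flat_{\mathrm b}$, and $V\in\mathfrak M_{\mathrm i}(U)$ whenever $(I,V)\in\mathfrak E_{\mathrm i}(H,U)$. Coherence (for the constant dualizing functor $\mathbb Z$). $\mathfrak K$ is coherent if $[H:U]<\infty$ for all $(H,U)\in\mathfrak E_{\mathrm b}$ and for every $H\in\mathfrak E^\flat_{\mathrm b}$: $\mathrm{Ext}(\mathfrak E,H)\subseteq\mathfrak E^\flat_{\mathrm i}(H)$; if $U\in\mathrm{Ext}(\mathfrak E,H)$ and $U_1$ is a closed normal subgroup of $H$ with $U\le U_1$, then $U_1\in\mathrm{Ext}(\mathfrak E,H)$, $U\in\mathrm{Ext}(\mathfrak E,U_1)$, $(U_1,U)\in\mathfrak E_{\mathrm i}(H,U)$ and $(H,U)\in\mathfrak E_{\mathrm i}(H,U_1)$; if $U\in\mathrm{Ext}(\mathfrak E,H)$ and $I$ is an open subgroup of $H$ with $U\le I$, then $(I,U)\in\mathfrak E_{\mathrm i}(H,U)$. (The remaining conditions in the general definition hold automatically for the dualizing functor $\mathbb Z$.) The functor $\pi_{\mathfrak K}\in\mathsf{Fct}(\mathfrak E,\mathsf{TAb})$: $\pi_{\mathfrak K}(H,U)=(H/U)^{\mathrm{ab}}$, the quotient of $H/U$ by its closed commutator subgroup; con is induced by conjugation, $\mathrm{ind}_{(H,U),(I,V)}$ by the inclusion $I\to H$, and $\mathrm{res}_{(I,U),(H,U)}:(H/U)^{\mathrm{ab}}\to(I/U)^{\mathrm{ab}}$ is the group-theoretic transfer. Cohomology. $\widehat{\mathrm H}^0_{\mathfrak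 E}(C)\in\mathsf{Fct}(\mathfrak E,\mathsf{Ab})$ is $(H,U)\mapsto C(H)/\mathrm{ind}^C_{H,U}C(U)$ with structure maps induced by those of $C$ on first components (well defined). For $U\in\mathfrak M_{\mathrm i}(H)$ normal in $H$, $\widehat{\mathrm H}^0(C)(H,U)=C(H)/\mathrm{ind}^C_{H,U}C(U)$ and $\widehat{\mathrm H}^{-1}(C)(H,U)=\ker(\mathrm{ind}^C_{H,U})/I_{(H,U)}$, where $I_{(H,U)}\le C(U)$ is generated by all $\mathrm{con}^C_{h,U}(x)x^{-1}$, $h\in H$, $x\in C(U)$. $C$ satisfies the class field axiom for $(H,U)$ if $|\widehat{\mathrm H}^0(C)(H,U)|=[H:U]$ and $\widehat{\mathrm H}^{-1}(C)(H,U)=1$. A $\mathfrak K$-prime morphism is a morphism $\rho$ in $\mathsf{Fct}(\mathfrak E,\mathsf{TAb})$ such that $\rho_{(H,U)}$ is an isomorphism for all $(H,U)\in\mathfrak E_{\mathrm b}$ with $H/U$ cyclic of prime order. A morphism $\rho:\pi_{\mathfrak K}\to\widehat{\mathrm H}^0_{\mathfrak E}(C)$ is a $\mathfrak K$-class field theory if it is an isomorphism in $\mathsf{Fct}(\mathfrak E,\mathsf{TAb})$ and, for every $H\in\mathfrak E^\flat_{\mathrm b}$ and every set $\mathcal L(H)\subseteq\{U\in\mathrm{Ext}(\mathfrak E,H):U\ge\mathrm{Com}^{\mathrm t}(H)\}$ closed under products and intersections (given as part of such a family over all $H$), the map $U\mapsto\mathrm{ind}^C_{H,U}C(U)$ from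 $\mathcal L(H)$ to the lattice of subgroups of $C(H)$ is an injective morphism of lattices. *)

theory Defs
  imports
    "HOL-Algebra.Group_Action"
    "HOL-Algebra.Elementary_Groups"
    "HOL-Algebra.Generated_Groups"
    "HOL-Algebra.FiniteProduct"
    "HOL-Analysis.Product_Topology"
    "HOL-Analysis.T1_Spaces"
    "HOL-Computational_Algebra.Primes"
begin

section \<open>Topological groups\<close>

record 'a top_monoid = "'a monoid" +
  topo :: "'a topology"

definition topological_group :: "('a, 'm) top_monoid_scheme \<Rightarrow> bool" where
  "topological_group A \<longleftrightarrow>
     group A \<and> topspace (topo A) = carrier A \<and>
     continuous_map (prod_topology (topo A) (topo A)) (topo A) (\<lambda>(x, y). x \<otimes>\<^bsub>A\<^esub> y) \<and>
     continuous_map (topo A) (topo A) (\<lambda>x. inv\<^bsub>A\<^esub> x)"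

text \<open>Objects and morphisms of the category \<open>TAb\<close>. Abelian groups are the discrete objects.
  Two morphisms are identified if they agree on the carrier of the source.\<close>

definition tab_object :: "('a, 'm) top_monoid_scheme \<Rightarrow> bool" where
  "tab_object A \<longleftrightarrow> topological_group A \<and> comm_group A"

definition ab_object :: "('a, 'm) top_monoid_scheme \<Rightarrow> bool" where
  "ab_object A \<longleftrightarrow> comm_group A \<and> topo A = discrete_topology (carrier A)"

definition tab_hom ::
  "('a, 'm) top_monoid_scheme \<Rightarrow> ('b, 'n) top_monoid_scheme \<Rightarrow> ('a \<Rightarrow> 'b) set" where
  "tab_hom A B = {f \<in> hom A B. continuous_map (topo A) (topo B) f}"

definition tab_iso ::
  "('a, 'm) top_monoid_scheme \<Rightarrow> ('b, 'n) top_monoid_scheme \<Rightarrow> ('a \<Rightarrow> 'b) \<Rightarrow> bool" where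
  "tab_iso A B f \<longleftrightarrow>
     (\<exists>g. group_isomorphisms A B f g \<and> homeomorphic_maps (topo A) (topo B) f g)"

definition top_subgroup :: "'a top_monoid \<Rightarrow> 'a set \<Rightarrow> 'a top_monoid" where
  "top_subgroup A H = A\<lparr>carrier := H, topo := subtopology (topo A) H\<rparr>"

text \<open>\<open>A Mod N\<close> with the quotient topology; see \<open>quotient_map_top_quot\<close> below.\<close>

definition top_quot :: "'a top_monoid \<Rightarrow> 'a set \<Rightarrow> 'a set top_monoid" where
  "top_quot A N =
     \<lparr>carrier = carrier (A Mod N), monoid.mult = monoid.mult (A Mod N), one = one (A Mod N),
      topo = topology (\<lambda>W. W \<subseteq> carrier (A Mod N) \<and>
                            openin (topo A) {x \<in> carrier A. N #>\<^bsub>A\<^esub> x \<in> W})\<rparr>"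

definition com_t :: "'a top_monoid \<Rightarrow> 'a set" where
  "com_t A = topo A closure_of derived A (carrier A)"

definition abelianization :: "'a top_monoid \<Rightarrow> 'a set top_monoid" where
  "abelianization A = top_quot A (com_t A)"

definition ab_class :: "'a top_monoid \<Rightarrow> 'a \<Rightarrow> 'a set" where
  "ab_class A x = com_t A #>\<^bsub>A\<^esub> x"

text \<open>The transfer from the abelianization of \<open>A\<close> to that of a subgroup \<open>B\<close> of finite index:
  if \<open>t\<close> picks an element of every right coset \<open>R\<close> of \<open>B\<close>, the class of \<open>x\<close> is sent to the
  product over all \<open>R\<close> of the classes of \<open>t(R) x t(R x)\<inverse> \<in> B\<close>.\<close>

definition transfer_map :: "'a top_monoid \<Rightarrow> 'a top_monoid \<Rightarrow> 'a set \<Rightarrow> 'a set" where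
  "transfer_map A B X = the_elem
     ((\<lambda>x. finprod (abelianization B)
              (\<lambda>R. ab_class B ((SOME y. y \<in> R) \<otimes>\<^bsub>A\<^esub> x \<otimes>\<^bsub>A\<^esub> inv\<^bsub>A\<^esub> (SOME y. y \<in> R #>\<^bsub>A\<^esub> x)))
              (rcosets\<^bsub>A\<^esub> (carrier B))) ` X)"

definition index :: "('a, 'm) monoid_scheme \<Rightarrow> 'a set \<Rightarrow> 'a set \<Rightarrow> nat" where
  "index G H I = card (rcosets\<^bsub>G\<lparr>carrier := H\<rparr>\<^esub> I)"

definition finite_index :: "('a, 'm) monoid_scheme \<Rightarrow> 'a set \<Rightarrow> 'a set \<Rightarrow> bool" where
  "finite_index G H I \<longleftrightarrow> finite (rcosets\<^bsub>G\<lparr>carrier := H\<rparr>\<^esub> I)"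

definition conj_set :: "('a, 'm) monoid_scheme \<Rightarrow> 'a \<Rightarrow> 'a set \<Rightarrow> 'a set" where
  "conj_set G g H = (\<lambda>h. g \<otimes>\<^bsub>G\<^esub> h \<otimes>\<^bsub>G\<^esub> inv\<^bsub>G\<^esub> g) ` H"

definition conj_pair ::
  "('a, 'm) monoid_scheme \<Rightarrow> 'a \<Rightarrow> 'a set \<times> 'a set \<Rightarrow> 'a set \<times> 'a set" where
  "conj_pair G g = (\<lambda>(H, U). (conj_set G g H, conj_set G g U))"

definition double_coset :: "('a, 'm) monoid_scheme \<Rightarrow> 'a set \<Rightarrow> 'a set \<Rightarrow> 'a \<Rightarrow> 'a set" where
  "double_coset G I J h = (I #>\<^bsub>G\<^esub> h) <#>\<^bsub>G\<^esub> J"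

definition double_cosets ::
  "('a, 'm) monoid_scheme \<Rightarrow> 'a set \<Rightarrow> 'a set \<Rightarrow> 'a set \<Rightarrow> 'a set set" where
  "double_cosets G I H J = double_coset G I J ` H"

definition double_coset_reps ::
  "('a, 'm) monoid_scheme \<Rightarrow> 'a set \<Rightarrow> 'a set \<Rightarrow> 'a set \<Rightarrow> 'a set \<Rightarrow> bool" where
  "double_coset_reps G I H J R \<longleftrightarrow>
     R \<subseteq> H \<and> bij_betw (double_coset G I J) R (double_cosets G I H J)"


section \<open>RIC-domains and RIC-functors\<close>

text \<open>The action of the group is not part of the record: it is passed separately, since
  it is always conjugation for the subgroup systems below.\<close>

record 'x ric_domain =
  base :: "'x set"
  r_set :: "'x \<Rightarrow> 'x set"
  i_set :: "'x \<Rightarrow> 'x set"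

definition closed_system :: "('g, 'm) monoid_scheme \<Rightarrow> ('g \<Rightarrow> 'x \<Rightarrow> 'x) \<Rightarrow> 'x set \<Rightarrow>
    ('x \<Rightarrow> 'x set) \<Rightarrow> bool" where
  "closed_system G act B S \<longleftrightarrow>
     (\<forall>x\<in>B. S x \<subseteq> B \<and> x \<in> S x \<and> (\<forall>y\<in>S x. S y \<subseteq> S x) \<and>
            (\<forall>g\<in>carrier G. act g ` S x = S (act g x)))"

definition is_ric_domain ::
  "('g, 'm) monoid_scheme \<Rightarrow> ('g \<Rightarrow> 'x \<Rightarrow> 'x) \<Rightarrow> ('x, 'd) ric_domain_scheme \<Rightarrow> bool" where
  "is_ric_domain G act D \<longleftrightarrow>
     base D \<noteq> {} \<and> group_action G (base D) (\<lambda>g. restrict (act g) (base D)) \<and>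
     closed_system G act (base D) (r_set D) \<and> closed_system G act (base D) (i_set D)"

text \<open>For \<open>y \<in> r_set D x\<close>, \<open>res F y x\<close> is the map from \<open>ob F x\<close> to \<open>ob F y\<close>; for
  \<open>y \<in> i_set D x\<close>, \<open>ind F x y\<close> is the map from \<open>ob F y\<close> to \<open>ob F x\<close>. That all objects have the
  same element type is no restriction, since they can be embedded into their disjoint union.\<close>

record ('g, 'x, 'a) ric_functor =
  ob :: "'x \<Rightarrow> 'a top_monoid"
  res :: "'x \<Rightarrow> 'x \<Rightarrow> 'a \<Rightarrow> 'a"
  ind :: "'x \<Rightarrow> 'x \<Rightarrow> 'a \<Rightarrow> 'a"
  con :: "'g \<Rightarrow> 'x \<Rightarrow> 'a \<Rightarrow> 'a"

definition is_ric_functor :: "('g, 'm) monoid_scheme \<Rightarrow> ('g \<Rightarrow> 'x \<Rightarrow> 'x) \<Rightarrow>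
    ('x, 'd) ric_domain_scheme \<Rightarrow> ('g, 'x, 'a) ric_functor \<Rightarrow> bool" where
  "is_ric_functor G act D F \<longleftrightarrow>
     (\<forall>x\<in>base D. tab_object (ob F x)) \<and>
     (\<forall>x\<in>base D. \<forall>y\<in>r_set D x. res F y x \<in> tab_hom (ob F x) (ob F y)) \<and>
     (\<forall>x\<in>base D. \<forall>y\<in>i_set D x. ind F x y \<in> tab_hom (ob F y) (ob F x)) \<and>
     (\<forall>x\<in>base D. \<forall>g\<in>carrier G. con F g x \<in> tab_hom (ob F x) (ob F (act g x))) \<and>
     (\<forall>x\<in>base D. \<forall>a\<in>carrier (ob F x).
        res F x x a = a \<and> ind F x x a = a \<and> con F \<one>\<^bsub>G\<^esub> x a = a) \<and>
     (\<forall>x\<in>base D. \<forall>y\<in>r_set D x. \<forall>z\<in>r_set D y. \<forall>a\<in>carrier (ob F x).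
        res F z y (res F y x a) = res F z x a) \<and>
     (\<forall>x\<in>base D. \<forall>y\<in>i_set D x. \<forall>z\<in>i_set D y. \<forall>a\<in>carrier (ob F z).
        ind F x y (ind F y z a) = ind F x z a) \<and>
     (\<forall>x\<in>base D. \<forall>g\<in>carrier G. \<forall>g'\<in>carrier G. \<forall>a\<in>carrier (ob F x).
        con F g' (act g x) (con F g x a) = con F (g' \<otimes>\<^bsub>G\<^esub> g) x a) \<and>
     (\<forall>x\<in>base D. \<forall>y\<in>r_set D x. \<forall>g\<in>carrier G. \<forall>a\<in>carrier (ob F x).
        con F g y (res F y x a) = res F (act g y) (act g x) (con F g x a)) \<and>
     (\<forall>x\<in>base D. \<forall>y\<in>i_set D x. \<forall>g\<in>carrier G. \<forall>a\<in>carrier (ob F y).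
        con F g x (ind F x y a) = ind F (act g x) (act g y) (con F g y a))"

definition ric_morphism :: "('g, 'm) monoid_scheme \<Rightarrow> ('g \<Rightarrow> 'x \<Rightarrow> 'x) \<Rightarrow>
    ('x, 'd) ric_domain_scheme \<Rightarrow> ('g, 'x, 'a) ric_functor \<Rightarrow> ('g, 'x, 'b) ric_functor \<Rightarrow>
    ('x \<Rightarrow> 'a \<Rightarrow> 'b) \<Rightarrow> bool" where
  "ric_morphism G act D F F' \<phi> \<longleftrightarrow>
     (\<forall>x\<in>base D. \<phi> x \<in> tab_hom (ob F x) (ob F' x)) \<and>
     (\<forall>x\<in>base D. \<forall>y\<in>r_set D x. \<forall>a\<in>carrier (ob F x).
        \<phi> y (res F y x a) = res F' y x (\<phi> x a)) \<and>
     (\<forall>x\<in>base D. \<forall>y\<in>i_set D x. \<forall>a\<in>carrier (ob F y).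
        \<phi> x (ind F x y a) = ind F' x y (\<phi> y a)) \<and>
     (\<forall>x\<in>base D. \<forall>g\<in>carrier G. \<forall>a\<in>carrier (ob F x).
        \<phi> (act g x) (con F g x a) = con F' g x (\<phi> x a))"

definition ric_isomorphism :: "('g, 'm) monoid_scheme \<Rightarrow> ('g \<Rightarrow> 'x \<Rightarrow> 'x) \<Rightarrow>
    ('x, 'd) ric_domain_scheme \<Rightarrow> ('g, 'x, 'a) ric_functor \<Rightarrow> ('g, 'x, 'b) ric_functor \<Rightarrow>
    ('x \<Rightarrow> 'a \<Rightarrow> 'b) \<Rightarrow> bool" where
  "ric_isomorphism G act D F F' \<phi> \<longleftrightarrow>
     ric_morphism G act D F F' \<phi> \<and>
     (\<exists>\<psi>. ric_morphism G act D F' F \<psi> \<and>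
          (\<forall>x\<in>base D. (\<forall>a\<in>carrier (ob F x). \<psi> x (\<phi> x a) = a) \<and>
                      (\<forall>b\<in>carrier (ob F' x). \<phi> x (\<psi> x b) = b)))"


section \<open>Subgroup systems and Mackey functors\<close>

definition subgroup_system :: "'a top_monoid \<Rightarrow> 'a set ric_domain \<Rightarrow> bool" where
  "subgroup_system G S \<longleftrightarrow>
     is_ric_domain G (conj_set G) S \<and>
     (\<forall>H\<in>base S. subgroup H G \<and> (\<forall>I\<in>r_set S H \<union> i_set S H. I \<subseteq> H))"

definition subsystem :: "'a set ric_domain \<Rightarrow> 'a set ric_domain \<Rightarrow> bool" where
  "subsystem S' S \<longleftrightarrow>
     base S' \<subseteq> base S \<and>
     (\<forall>H\<in>base S'. r_set S' H \<subseteq> r_set S H \<and> i_set S' H \<subseteq> i_set S H)"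

definition arithmetic_system :: "'a top_monoid \<Rightarrow> 'a set ric_domain \<Rightarrow> bool" where
  "arithmetic_system G S \<longleftrightarrow>
     (\<forall>H\<in>base S. \<forall>I. subgroup I (top_subgroup G H) \<and> openin (topo (top_subgroup G H)) I \<longrightarrow>
        I \<in> r_set S H \<and> I \<in> i_set S H)"

definition mackey_system :: "'a top_monoid \<Rightarrow> 'a set ric_domain \<Rightarrow> bool" where
  "mackey_system G M \<longleftrightarrow>
     subgroup_system G M \<and>
     (\<forall>H\<in>base M. \<forall>I\<in>r_set M H. \<forall>J\<in>i_set M H.
        finite (double_cosets G I H J) \<and> I \<inter> J \<in> r_set M J \<and> I \<inter> J \<in> i_set M I)"

definition stable :: "'a set ric_domain \<Rightarrow> ('a, 'a set, 'c) ric_functor \<Rightarrow> bool" where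
  "stable S F \<longleftrightarrow> (\<forall>H\<in>base S. \<forall>h\<in>H. \<forall>x\<in>carrier (ob F H). con F h H x = x)"

text \<open>Mackey functors with values in \<open>Ab\<close>.\<close>

definition mackey_functor ::
  "'a top_monoid \<Rightarrow> 'a set ric_domain \<Rightarrow> ('a, 'a set, 'c) ric_functor \<Rightarrow> bool" where
  "mackey_functor G M C \<longleftrightarrow>
     mackey_system G M \<and> is_ric_functor G (conj_set G) M C \<and>
     (\<forall>H\<in>base M. ab_object (ob C H)) \<and> stable M C \<and>
     (\<forall>H\<in>base M. \<forall>I\<in>r_set M H. \<forall>J\<in>i_set M H. \<forall>R. double_coset_reps G I H J R \<longrightarrow>
        (\<forall>x\<in>carrier (ob C J).
           res C I H (ind C H J x) =
           finprod (ob C I)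
             (\<lambda>h. ind C I (I \<inter> conj_set G h J)
                    (con C h (conj_set G (inv\<^bsub>G\<^esub> h) I \<inter> J)
                       (res C (conj_set G (inv\<^bsub>G\<^esub> h) I \<inter> J) J x))) R))"

text \<open>A Mackey system may contain pairs with finite double coset space but infinite index; the
  multiple \<open>[H:I] \<cdot> id\<close> only makes sense, and is only required, for finite \<open>[H:I]\<close>.\<close>

definition cohomological_mackey_functor ::
  "'a top_monoid \<Rightarrow> 'a set ric_domain \<Rightarrow> ('a, 'a set, 'c) ric_functor \<Rightarrow> bool" where
  "cohomological_mackey_functor G M C \<longleftrightarrow>
     mackey_functor G M C \<and>
     (\<forall>H\<in>base M. \<forall>I\<in>r_set M H \<inter> i_set M H. finite_index G H I \<longrightarrow>
        (\<forall>x\<in>carrier (ob C H). ind C H I (res C I H x) = x [^]\<^bsub>ob C H\<^esub> index G H I))"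


section \<open>Spectra\<close>

definition grp2 :: "'a top_monoid \<Rightarrow> ('a set \<times> 'a set) set" where
  "grp2 G = {(H, U). subgroup H G \<and> closedin (topo G) H \<and>
                     U \<lhd> top_subgroup G H \<and> closedin (topo G) U}"

definition subgroup_system2 :: "'a top_monoid \<Rightarrow> ('a set \<times> 'a set) ric_domain \<Rightarrow> bool" where
  "subgroup_system2 G E \<longleftrightarrow>
     is_ric_domain G (conj_pair G) E \<and> base E \<subseteq> grp2 G \<and>
     (\<forall>(H, U)\<in>base E. \<forall>(I, V)\<in>r_set E (H, U) \<union> i_set E (H, U). I \<subseteq> H \<and> V \<subseteq> U)"

definition Ext :: "('a set \<times> 'a set) ric_domain \<Rightarrow> 'a set \<Rightarrow> 'a set set" where
  "Ext E H = {U. (H, U) \<in> base E}"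

definition flat :: "('a set \<times> 'a set) ric_domain \<Rightarrow> 'a set ric_domain" where
  "flat E = \<lparr>base = fst ` base E,
             r_set = (\<lambda>H. fst ` (\<Union>U\<in>Ext E H. r_set E (H, U))),
             i_set = (\<lambda>H. fst ` (\<Union>U\<in>Ext E H. i_set E (H, U)))\<rparr>"

definition spectrum :: "'a top_monoid \<Rightarrow> ('a set \<times> 'a set) ric_domain \<Rightarrow> bool" where
  "spectrum G E \<longleftrightarrow>
     subgroup_system2 G E \<and> subgroup_system G (flat E) \<and>
     (\<forall>(H, U)\<in>base E. \<forall>(I, V)\<in>r_set E (H, U). V = U) \<and>
     (\<forall>H\<in>base (flat E). \<forall>I\<in>r_set (flat E) H. finite_index G H I)"

definition mackey_cover ::
  "'a top_monoid \<Rightarrow> ('a set \<times> 'a set) ric_domain \<Rightarrow> 'a set ric_domain \<Rightarrow> bool" where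
  "mackey_cover G E M \<longleftrightarrow>
     mackey_system G M \<and> subsystem (flat E) M \<and>
     (\<forall>H\<in>base (flat E). Ext E H \<subseteq> i_set M H) \<and>
     (\<forall>(H, U)\<in>base E. \<forall>(I, V)\<in>i_set E (H, U). V \<in> i_set M U)"

text \<open>Coherence for the dualizing functor \<open>\<int>\<close> (and \<open>R(H)\<close> the closed commutator subgroup
  of \<open>H\<close>).\<close>

definition coherent :: "'a top_monoid \<Rightarrow> ('a set \<times> 'a set) ric_domain \<Rightarrow> bool" where
  "coherent G E \<longleftrightarrow>
     (\<forall>(H, U)\<in>base E. finite_index G H U) \<and>
     (\<forall>H\<in>base (flat E).
        Ext E H \<subseteq> i_set (flat E) H \<and>
        (\<forall>U\<in>Ext E H. \<forall>U1. U1 \<lhd> top_subgroup G H \<and> closedin (topo G) U1 \<and> U \<subseteq> U1 \<longrightarrow>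
           U1 \<in> Ext E H \<and> U \<in> Ext E U1 \<and>
           (U1, U) \<in> i_set E (H, U) \<and> (H, U) \<in> i_set E (H, U1)) \<and>
        (\<forall>U\<in>Ext E H. \<forall>I. subgroup I (top_subgroup G H) \<and>
             openin (topo (top_subgroup G H)) I \<and> U \<subseteq> I \<longrightarrow>
           (I, U) \<in> i_set E (H, U)))"


section \<open>The functors \<open>\<pi>\<close> and \<open>\<^bold>H\<^sup>0\<close>\<close>

definition ext_quot :: "'a top_monoid \<Rightarrow> 'a set \<times> 'a set \<Rightarrow> 'a set top_monoid" where
  "ext_quot G = (\<lambda>(H, U). top_quot (top_subgroup G H) U)"

text \<open>Elements of quotients are cosets, and a map on a quotient that is induced by a map \<open>f\<close> on
  representatives sends a coset \<open>X\<close> to the unique element of \<open>f ` X\<close>. For \<open>ind\<close>, note that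
  \<open>V h \<mapsto> U (V h) = U h\<close> is the map from \<open>I/V\<close> to \<open>H/U\<close> induced by the inclusion.\<close>

definition pi_functor :: "'a top_monoid \<Rightarrow> ('a, 'a set \<times> 'a set, 'a set set) ric_functor" where
  "pi_functor G =
     \<lparr>ob = (\<lambda>x. abelianization (ext_quot G x)),
      res = (\<lambda>y x. transfer_map (ext_quot G x) (ext_quot G y)),
      ind = (\<lambda>x y X. the_elem ((\<lambda>Y. ab_class (ext_quot G x) (snd x <#>\<^bsub>G\<^esub> Y)) ` X)),
      con = (\<lambda>g x X. the_elem
                ((\<lambda>Y. ab_class (ext_quot G (conj_pair G g x)) (conj_set G g Y)) ` X))\<rparr>"

definition H0_obj :: "('a, 'a set, 'c) ric_functor \<Rightarrow> 'a set \<times> 'a set \<Rightarrow> 'c set top_monoid" where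
  "H0_obj C = (\<lambda>(H, U). top_quot (ob C H) (ind C H U ` carrier (ob C U)))"

definition H0_class :: "('a, 'a set, 'c) ric_functor \<Rightarrow> 'a set \<times> 'a set \<Rightarrow> 'c \<Rightarrow> 'c set" where
  "H0_class C = (\<lambda>(H, U) c. (ind C H U ` carrier (ob C U)) #>\<^bsub>ob C H\<^esub> c)"

definition H0_functor :: "'a top_monoid \<Rightarrow> ('a, 'a set, 'c) ric_functor \<Rightarrow>
    ('a, 'a set \<times> 'a set, 'c set) ric_functor" where
  "H0_functor G C =
     \<lparr>ob = H0_obj C,
      res = (\<lambda>y x X. the_elem ((\<lambda>c. H0_class C y (res C (fst y) (fst x) c)) ` X)),
      ind = (\<lambda>x y X. the_elem ((\<lambda>c. H0_class C x (ind C (fst x) (fst y) c)) ` X)),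
      con = (\<lambda>g x X. the_elem
                ((\<lambda>c. H0_class C (conj_pair G g x) (con C g (fst x) c)) ` X))\<rparr>"

definition augmentation_subgroup ::
  "('a, 'a set, 'c) ric_functor \<Rightarrow> 'a set \<Rightarrow> 'a set \<Rightarrow> 'c set" where
  "augmentation_subgroup C H U =
     generate (ob C U)
       {con C h U x \<otimes>\<^bsub>ob C U\<^esub> inv\<^bsub>ob C U\<^esub> x | h x. h \<in> H \<and> x \<in> carrier (ob C U)}"

definition H_minus_1 ::
  "('a, 'a set, 'c) ric_functor \<Rightarrow> 'a set \<Rightarrow> 'a set \<Rightarrow> 'c set top_monoid" where
  "H_minus_1 C H U =
     top_quot (top_subgroup (ob C U) (kernel (ob C U) (ob C H) (ind C H U)))
       (augmentation_subgroup C H U)"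

definition class_field_axiom ::
  "'a top_monoid \<Rightarrow> ('a, 'a set, 'c) ric_functor \<Rightarrow> 'a set \<Rightarrow> 'a set \<Rightarrow> bool" where
  "class_field_axiom G C H U \<longleftrightarrow>
     order (H0_obj C (H, U)) = index G H U \<and> trivial_group (H_minus_1 C H U)"

definition cyclic_prime_quot :: "'a top_monoid \<Rightarrow> 'a set \<Rightarrow> 'a set \<Rightarrow> nat \<Rightarrow> bool" where
  "cyclic_prime_quot G H U l \<longleftrightarrow>
     prime l \<and> cyclic_group (ext_quot G (H, U)) \<and> order (ext_quot G (H, U)) = l"


section \<open>Class field theories\<close>

definition prime_morphism :: "'a top_monoid \<Rightarrow> ('a set \<times> 'a set) ric_domain \<Rightarrow>
    ('a, 'a set \<times> 'a set, 'b) ric_functor \<Rightarrow> ('a, 'a set \<times> 'a set, 'c) ric_functor \<Rightarrow>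
    ('a set \<times> 'a set \<Rightarrow> 'b \<Rightarrow> 'c) \<Rightarrow> bool" where
  "prime_morphism G E F F' \<rho> \<longleftrightarrow>
     ric_morphism G (conj_pair G) E F F' \<rho> \<and>
     (\<forall>(H, U)\<in>base E. (\<exists>l. cyclic_prime_quot G H U l) \<longrightarrow>
        tab_iso (ob F (H, U)) (ob F' (H, U)) (\<rho> (H, U)))"

text \<open>An admissible family is a choice of a set of coabelian extensions \<open>U\<close> of each \<open>H\<close> that is
  closed under products and intersections.\<close>

definition admissible_family ::
  "'a top_monoid \<Rightarrow> ('a set \<times> 'a set) ric_domain \<Rightarrow> ('a set \<Rightarrow> 'a set set) \<Rightarrow> bool" where
  "admissible_family G E L \<longleftrightarrow>
     (\<forall>H\<in>base (flat E).
        L H \<subseteq> {U \<in> Ext E H. com_t (top_subgroup G H) \<subseteq> U} \<and>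
        (\<forall>U\<in>L H. \<forall>V\<in>L H. U <#>\<^bsub>G\<^esub> V \<in> L H \<and> U \<inter> V \<in> L H))"

text \<open>The join of two subgroups of \<open>A\<close> is the subgroup generated by their union; in \<open>L\<close> it is
  the product.\<close>

definition injective_lattice_morphism :: "('a, 'm) monoid_scheme \<Rightarrow> 'a set set \<Rightarrow>
    ('c, 'n) monoid_scheme \<Rightarrow> ('a set \<Rightarrow> 'c set) \<Rightarrow> bool" where
  "injective_lattice_morphism G L A f \<longleftrightarrow>
     (\<forall>U\<in>L. subgroup (f U) A) \<and> inj_on f L \<and>
     (\<forall>U\<in>L. \<forall>V\<in>L. f (U <#>\<^bsub>G\<^esub> V) = generate A (f U \<union> f V) \<and> f (U \<inter> V) = f U \<inter> f V)"

definition class_field_theory :: "'a top_monoid \<Rightarrow> ('a set \<times> 'a set) ric_domain \<Rightarrow>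
    ('a, 'a set, 'c) ric_functor \<Rightarrow> ('a set \<times> 'a set \<Rightarrow> 'a set set \<Rightarrow> 'c set) \<Rightarrow> bool" where
  "class_field_theory G E C \<rho> \<longleftrightarrow>
     ric_isomorphism G (conj_pair G) E (pi_functor G) (H0_functor G C) \<rho> \<and>
     (\<forall>L. admissible_family G E L \<longrightarrow>
        (\<forall>H\<in>base (flat E).
           injective_lattice_morphism G (L H) (ob C H) (\<lambda>U. ind C H U ` carrier (ob C U))))"


section \<open>The quotient topology\<close>

lemma openin_top_quot:
  "openin (topo (top_quot A N)) W \<longleftrightarrow>
     W \<subseteq> carrier (A Mod N) \<and> openin (topo A) {x \<in> carrier A. N #>\<^bsub>A\<^esub> x \<in> W}"
proof -
  let ?Q = "\<lambda>W. W \<subseteq> carrier (A Mod N) \<and> openin (topo A) {x \<in> carrier A. N #>\<^bsub>A\<^esub> x \<in> W}"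
  have "istopology ?Q"
    unfolding istopology_def
  proof (intro conjI allI impI)
    fix S T assume "?Q S" "?Q T"
    moreover have "{x \<in> carrier A. N #>\<^bsub>A\<^esub> x \<in> S \<inter> T} =
        {x \<in> carrier A. N #>\<^bsub>A\<^esub> x \<in> S} \<inter> {x \<in> carrier A. N #>\<^bsub>A\<^esub> x \<in> T}" by auto
    ultimately show "S \<inter> T \<subseteq> carrier (A Mod N)"
      "openin (topo A) {x \<in> carrier A. N #>\<^bsub>A\<^esub> x \<in> S \<inter> T}" by auto
  next
    fix K assume K: "\<forall>S\<in>K. ?Q S"
    have "{x \<in> carrier A. N #>\<^bsub>A\<^esub> x \<in> \<Union>K} = (\<Union>S\<in>K. {x \<in> carrier A. N #>\<^bsub>A\<^esub> x \<in> S})" by auto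
    then show "\<Union>K \<subseteq> carrier (A Mod N)" "openin (topo A) {x \<in> carrier A. N #>\<^bsub>A\<^esub> x \<in> \<Union>K}"
      using K by (auto intro!: openin_Union)
  qed
  then show ?thesis
    by (simp add: top_quot_def topology_inverse')
qed

lemma quotient_map_top_quot:
  assumes "topspace (topo A) = carrier A"
  shows "quotient_map (topo A) (topo (top_quot A N)) (\<lambda>x. N #>\<^bsub>A\<^esub> x)"
proof -
  have "openin (topo (top_quot A N)) (carrier (A Mod N))"
    using assms openin_topspace[of "topo A"]
    by (simp add: openin_top_quot carrier_FactGroup cong: conj_cong)
  then have "topspace (topo (top_quot A N)) = carrier (A Mod N)"
    by (metis openin_subset openin_top_quot openin_topspace subset_antisym)
  then show ?thesis
    by (auto simp: quotient_map_def openin_top_quot assms carrier_FactGroup)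
qed

lemma topo_top_quot_discrete:
  assumes "topo A = discrete_topology (carrier A)"
  shows "topo (top_quot A N) = discrete_topology (carrier (top_quot A N))"
  by (auto simp: topology_eq openin_top_quot assms) (auto simp: top_quot_def)

end

theory Submission
  imports Defs "HOL-Algebra.Sylow" "HOL-Algebra.Multiplicative_Group"
begin

text \<open>
  All \<open>H/U\<close> are finite, so the topology plays no role and one has to show that every
  \<open>\<rho>\<close> at \<open>(H, U)\<close> is bijective.

  Surjectivity is proved by induction on \<open>[H:U]\<close>. If there is a normal subgroup \<open>V\<close> of \<open>H\<close> of
  prime index containing \<open>U\<close>, it follows from the right exact sequence
  \<open>C(V)/ind C(U) \<rightarrow> C(H)/ind C(U) \<rightarrow> C(H)/ind C(V) \<rightarrow> 1\<close>. Otherwise \<open>H/U\<close> is not a \<open>p\<close>-group,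
  and \<open>ind res = [H:I]\<close> for the preimages \<open>I\<close> of the Sylow subgroups shows that the cokernel is
  trivial.

  Injectivity for abelian \<open>H/U\<close> is again an induction along some \<open>V\<close> of prime index: since the
  cohomology in degree \<open>-1\<close> of \<open>(H, V)\<close> vanishes and conjugation by \<open>H\<close> acts trivially on
  \<open>C(V)/ind C(U)\<close>, which is a quotient of \<open>V/U\<close>, the map \<open>C(V)/ind C(U) \<rightarrow> C(H)/ind C(U)\<close> is
  injective. The general case follows by passing to the abelianization of \<open>H/U\<close>.

  Finally, if \<open>W \<subseteq> U\<close> and \<open>c\<close> represents the image of \<open>h\<close> under \<open>\<rho>\<close> at \<open>(H, W)\<close>, then
  \<open>c \<in> ind C(U)\<close> if and only if \<open>h \<in> U\<close>, which gives the statement on lattices.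
\<close>

section \<open>Finite groups and subgroups of prime index\<close>

lemma (in group) prime_order_imp_cyclic:
  assumes "prime (order G)"
  shows "cyclic_group G"
proof -
  have fin: "finite (carrier G)"
    using assms by (metis not_prime_0 order_gt_0_iff_finite gr0I)
  have "order G \<noteq> 1"
    using assms by auto
  then obtain x where x: "x \<in> carrier G" "x \<noteq> \<one>"
    using order_one_triv_iff by blast
  have sub: "subgroup (generate G {x}) G"
    using x generate_is_subgroup by simp
  have "card (generate G {x}) dvd order G"
    using lagrange[OF sub] by (metis dvd_triv_right)
  moreover have "card (generate G {x}) \<noteq> 1"
  proof
    assume "card (generate G {x}) = 1"
    then show False
      using x generate.incl[of x "{x}" G] generate.one[of G "{x}"]
      by (metis card_1_singletonE singletonD singletonI)
  qed
  ultimately have "card (generate G {x}) = order G"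
    using assms prime_nat_iff by blast
  then have "generate G {x} = carrier G"
    using fin subgroup.subset[OF sub] by (simp add: card_subset_eq order_def)
  then show ?thesis
    unfolding cyclic_group_def subgroup_generated_def using x by (intro bexI[of _ x]) auto
qed

text \<open>Two elements of \<open>N\<close> in the same coset of \<open>N'\<close> differ by an
  element of \<open>N \<inter> N'\<close>, so each fibre of \<open>n \<mapsto> N' #> n\<close> on
  \<open>N\<close> has at most \<open>card (N \<inter> N')\<close> elements; summing over the fibres
  gives the bound.\<close>

lemma (in group) card_le_card_rcosets_mult_Int:
  assumes N: "subgroup N G" and N': "subgroup N' G" and fin: "finite (carrier G)"
  shows "card N \<le> card ((\<lambda>n. N' #> n) ` N) * card (N \<inter> N')"
proof -
  let ?f = "\<lambda>n. N' #> n"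
  have finN: "finite N" "finite (N \<inter> N')"
    using fin N finite_subset subgroup.subset by blast+
  have fiber: "card {n \<in> N. ?f n = R} \<le> card (N \<inter> N')" if R: "R \<in> ?f ` N" for R
  proof -
    obtain m where m: "m \<in> N" "R = ?f m" using R by auto
    have mG: "m \<in> carrier G" using m N subgroup.mem_carrier by fastforce
    have "n \<otimes> inv m \<in> N \<inter> N'" if n: "n \<in> N" "?f n = R" for n
    proof -
      have nG: "n \<in> carrier G" using n N subgroup.mem_carrier by fastforce
      have "n \<in> N' #> m" using n m rcos_self[OF nG N'] by auto
      then show ?thesis
        using subgroup.rcos_module_imp[OF N' is_group mG] n m N
        by (simp add: subgroupE)
    qed
    then have "(\<lambda>n. n \<otimes> inv m) ` {n \<in> N. ?f n = R} \<subseteq> N \<inter> N'" by blast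
    moreover have "inj_on (\<lambda>n. n \<otimes> inv m) {n \<in> N. ?f n = R}"
    proof (rule inj_onI)
      fix a b assume ab: "a \<in> {n \<in> N. ?f n = R}" "b \<in> {n \<in> N. ?f n = R}"
        "a \<otimes> inv m = b \<otimes> inv m"
      then have "a \<in> carrier G" "b \<in> carrier G" using subgroup.mem_carrier[OF N] by auto
      then show "a = b" using mG ab(3) by simp
    qed
    ultimately show ?thesis
      using card_inj_on_le finN by blast
  qed
  have "card N = card (\<Union>R\<in>?f ` N. {n \<in> N. ?f n = R})"
    by (rule arg_cong[of _ _ card]) auto
  also have "\<dots> \<le> (\<Sum>R\<in>?f ` N. card {n \<in> N. ?f n = R})"
    using finN by (intro card_UN_le) auto
  also have "\<dots> \<le> card (?f ` N) * card (N \<inter> N')"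
    using sum_bounded_above[of "?f ` N", OF fiber] by simp
  finally show ?thesis .
qed

text \<open>Let \<open>N\<close> have order \<open>p ^ k\<close>. If some conjugate
  \<open>N'\<close> of \<open>N\<close> by \<open>x\<close> were different from \<open>N\<close>,
  the intersection would have order at most \<open>p ^ (k - 1)\<close>, so \<open>N\<close> would
  meet all \<open>p\<close> cosets of \<open>N'\<close>, including that of \<open>x\<close>. Solving
  the resulting equation for \<open>x\<close> puts \<open>x\<close> into \<open>N\<close>, a
  contradiction.\<close>

lemma (in group) prime_power_order_imp_normal_of_prime_index:
  assumes p: "prime p" and ord: "order G = p ^ Suc k"
  shows "\<exists>N. N \<lhd> G \<and> card (rcosets N) = p"
proof -
  have p0: "p > 0" using p prime_gt_0_nat by blast
  have fin: "finite (carrier G)"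
    using ord p0 order_gt_0_iff_finite by simp
  \<comment> \<open>\<open>sylow_thm\<close> does not ask for the maximal exponent: here the order
    is split as \<open>p ^ k * p\<close>.\<close>
  obtain N where N: "subgroup N G" "card N = p ^ k"
    using sylow_thm[OF p is_group, of k p] ord fin by (auto simp: mult.commute)
  have idx: "card (rcosets N') = p" if "subgroup N' G" "card N' = p ^ k" for N'
    using lagrange[OF that(1)] that(2) ord p0 by simp
  have "x \<otimes> h \<otimes> inv x \<in> N" if x: "x \<in> carrier G" and h: "h \<in> N" for x h
  proof (rule ccontr)
    assume nin: "x \<otimes> h \<otimes> inv x \<notin> N"
    let ?N' = "(\<lambda>h. x \<otimes> h \<otimes> inv x) ` N"
    have NG: "N \<subseteq> carrier G" using N subgroup.subset by blast
    have N': "subgroup ?N' G"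
    proof (rule subgroupI)
      show "?N' \<subseteq> carrier G" "?N' \<noteq> {}"
        using x NG h by auto
      show "inv a \<in> ?N'" if "a \<in> ?N'" for a
      proof -
        obtain n where n: "n \<in> N" "a = x \<otimes> n \<otimes> inv x" using \<open>a \<in> ?N'\<close> by auto
        then have "inv a = x \<otimes> inv n \<otimes> inv x"
          using x NG by (auto simp: inv_mult_group m_assoc)
        then show ?thesis using n N subgroupE(3) by blast
      qed
      show "a \<otimes> b \<in> ?N'" if ab: "a \<in> ?N'" "b \<in> ?N'" for a b
      proof -
        obtain n m where nm: "n \<in> N" "a = x \<otimes> n \<otimes> inv x" "m \<in> N" "b = x \<otimes> m \<otimes> inv x"
          using ab by auto
        then have "n \<in> carrier G" "m \<in> carrier G" using NG by auto
        then have "a \<otimes> b = x \<otimes> (n \<otimes> m) \<otimes> inv x"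
          using nm(2,4) x by (simp add: m_assoc inv_solve_left')
        then show ?thesis using nm N subgroupE(4) by blast
      qed
    qed
    have "inj_on (\<lambda>h. x \<otimes> h \<otimes> inv x) N"
    proof (rule inj_onI)
      fix a b assume ab: "a \<in> N" "b \<in> N" "x \<otimes> a \<otimes> inv x = x \<otimes> b \<otimes> inv x"
      have "a \<in> carrier G" "b \<in> carrier G" using ab NG by auto
      then show "a = b" using x ab(3) by simp
    qed
    then have card': "card ?N' = p ^ k"
      using N(2) by (simp add: card_image)
    let ?D = "N \<inter> ?N'"
    have D: "subgroup ?D G" using N N' subgroups_Inter_pair by blast
    interpret GN: group "G\<lparr>carrier := N\<rparr>" using N subgroup_imp_group by blast
    have "subgroup ?D (G\<lparr>carrier := N\<rparr>)"
      using D N by (simp add: subgroup_incl)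
    from GN.lagrange[OF this]
    have "card (rcosets\<^bsub>G\<lparr>carrier := N\<rparr>\<^esub> ?D) * card ?D = p ^ k"
      using N(2) by (simp add: order_def)
    then have "card ?D dvd p ^ k"
      by (rule dvdI[OF sym, OF trans[OF mult.commute]])
    then obtain j where j: "j \<le> k" "card ?D = p ^ j"
      using divides_primepow_nat[OF p] by auto
    \<comment> \<open>Equality would give \<open>?N' \<subseteq> N\<close>, but
      \<open>x \<otimes> h \<otimes> inv x\<close> lies in \<open>?N'\<close> and not in
      \<open>N\<close>.\<close>
    have "j \<noteq> k"
    proof
      assume "j = k"
      have "finite ?N'" using fin NG by (simp add: finite_subset)
      then have "?D = ?N'" using j card' \<open>j = k\<close> by (intro card_subset_eq) auto
      then show False using nin h by blast
    qed
    then have "p ^ j * p \<le> p ^ k"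
      using j p0 power_increasing[of "Suc j" k p] by (simp add: mult.commute)
    moreover have "p ^ k \<le> card ((\<lambda>n. ?N' #> n) ` N) * p ^ j"
      using card_le_card_rcosets_mult_Int[OF N(1) N' fin] N(2) j(2) by simp
    ultimately have "p ^ j * p \<le> p ^ j * card ((\<lambda>n. ?N' #> n) ` N)"
      by (metis le_trans mult.commute)
    then have ge: "p \<le> card ((\<lambda>n. ?N' #> n) ` N)"
      using p0 by simp
    have sub: "(\<lambda>n. ?N' #> n) ` N \<subseteq> rcosets ?N'"
      using NG rcosetsI[OF subgroup.subset[OF N']] by blast
    have "finite (rcosets ?N')"
      using fin by (simp add: RCOSETS_def)
    moreover have "card (rcosets ?N') \<le> card ((\<lambda>n. ?N' #> n) ` N)"
      using ge idx[OF N' card'] by simp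
    \<comment> \<open>There are only \<open>p\<close> cosets of \<open>?N'\<close>, and
      \<open>N\<close> meets at least \<open>p\<close> of them, so the coset of \<open>x\<close>
      contains some \<open>n\<close> in \<open>N\<close>.\<close>
    ultimately have "(\<lambda>n. ?N' #> n) ` N = rcosets ?N'"
      using sub card_seteq by blast
    moreover have "?N' #> x \<in> rcosets ?N'"
      by (rule rcosetsI[OF subgroup.subset[OF N'] x])
    ultimately obtain n where n: "n \<in> N" "?N' #> x = ?N' #> n" by auto
    then have "x \<in> ?N' #> n" using rcos_self[OF x N'] by simp
    then obtain a where a: "a \<in> N" "x = x \<otimes> a \<otimes> inv x \<otimes> n"
      unfolding r_coset_def by auto
    have nG: "n \<in> carrier G" "a \<in> carrier G" using a n NG by auto
    have "x \<otimes> (a \<otimes> (inv x \<otimes> n)) = x \<otimes> \<one>"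
      using a(2) x nG by (simp add: m_assoc)
    then have "a \<otimes> (inv x \<otimes> n) = \<one>"
      using x nG by (metis inv_closed l_cancel_one m_closed r_one)
    then have "inv (inv x \<otimes> n) = a"
      using x nG by (simp add: inv_equality)
    then have "inv n \<otimes> x = a"
      using x nG by (simp add: inv_mult_group)
    then have "x = n \<otimes> a" using x nG by (metis inv_solve_left)
    then have "x \<in> N" using a n N subgroupE(4) by blast
    then show False using nin h N by (simp add: subgroupE)
  qed
  then have "N \<lhd> G" using N normal_inv_iff by blast
  then show ?thesis using idx N by blast
qed

text \<open>Take a maximal proper subgroup \<open>N\<close>. A subgroup of prime order in the
  quotient by \<open>N\<close> has a preimage strictly larger than \<open>N\<close>, hence the whole
  group, so this quotient itself has prime order.\<close>

lemma (in comm_group) ex_subgroup_of_prime_index: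
  assumes fin: "finite (carrier G)" and ne: "order G \<noteq> 1"
  shows "\<exists>N. subgroup N G \<and> prime (card (rcosets N))"
proof -
  let ?S = "{N. subgroup N G \<and> N \<noteq> carrier G}"
  have "finite ?S"
    using fin subgroup.subset by (intro finite_subset[of ?S "Pow (carrier G)"]) auto
  moreover have "{\<one>} \<in> ?S"
    using ne triv_subgroup order_one_triv_iff by auto
  ultimately obtain N where "N \<in> ?S" and max: "\<And>K. K \<in> ?S \<Longrightarrow> N \<subseteq> K \<Longrightarrow> K = N"
    using finite_has_maximal[of ?S] by blast
  then have N: "subgroup N G" "N \<noteq> carrier G" by auto
  interpret N: normal N G using N normal_iff_subgroup by blast
  interpret Q: group "G Mod N" by (rule N.factorgroup_is_group)
  have finQ: "finite (carrier (G Mod N))"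
    using fin by (simp add: carrier_FactGroup)
  have "order (G Mod N) \<noteq> 1"
    using N.fact_group_trivial_iff[OF fin] Q.order_one_triv_iff N by simp
  then obtain p where p: "prime p" "p dvd order (G Mod N)"
    using prime_factor_nat by blast
  \<comment> \<open>With exponent 1, and with no condition on \<open>m\<close>,
    \<open>sylow_thm\<close> becomes the theorem of Cauchy.\<close>
  then obtain m where "order (G Mod N) = p ^ 1 * m" by auto
  then obtain P where P: "subgroup P (G Mod N)" "card P = p"
    using sylow_thm[OF p(1) Q.is_group _ finQ, of 1 m] by auto
  have sub: "subgroup (\<Union>P) G" using N.factgroup_subgroup_union_subgroup P by blast
  have "N \<in> P" using subgroup.one_closed[OF P(1)] by simp
  then have "N \<subseteq> \<Union>P" by blast
  have "\<Union>P \<noteq> N"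
  proof
    assume "\<Union>P = N"
    have "P = {N}"
    proof -
      have "R = N" if R: "R \<in> P" for R
      proof -
        obtain x where x: "x \<in> carrier G" "R = N #> x"
          using subsetD[OF subgroup.subset[OF P(1)] R] unfolding carrier_FactGroup by auto
        then have "x \<in> N"
          using UnionI[OF R, of x] \<open>\<Union>P = N\<close> rcos_self[OF x(1) N(1)] by simp
        then show ?thesis using x coset_join2[OF _ N(1)] by simp
      qed
      then show ?thesis using \<open>N \<in> P\<close> by blast
    qed
    then show False using P p by auto
  qed
  then have "\<Union>P = carrier G" using max[of "\<Union>P"] sub \<open>N \<subseteq> \<Union>P\<close> by blast
  then have "P = carrier (G Mod N)"
    using N.factgroup_subgroup_union_factor[OF P(1)] by (simp add: FactGroup_def)
  then have "card (rcosets N) = p" using P by (simp add: FactGroup_def)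
  then show ?thesis using N p by blast
qed

text \<open>\<open>\<Union>Q\<close> is the preimage of \<open>Q\<close> under the projection, and
  taking images under the projection matches the cosets of \<open>\<Union>Q\<close> with those of
  \<open>Q\<close>; injectivity holds because \<open>H\<close> is contained in
  \<open>\<Union>Q\<close>.\<close>

lemma (in normal) card_rcosets_Union:
  assumes Q: "subgroup Q (G Mod H)"
  shows "card (rcosets (\<Union>Q)) = card (rcosets\<^bsub>G Mod H\<^esub> Q)"
proof -
  define I where "I = \<Union>Q"
  have I: "subgroup I G" unfolding I_def using Q by (rule factgroup_subgroup_union_subgroup)
  have Ichar: "I = {x \<in> carrier G. H #> x \<in> Q}" unfolding I_def using Q by (rule factgroup_subgroup_union_char)
  have H: "subgroup H G" by (rule is_subgroup)
  have HI: "H \<subseteq> I" unfolding I_def using subgroup.one_closed[OF Q] by auto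
  have Qim: "(\<lambda>x. H #> x) ` I = Q"
    using subgroup.subset[OF Q] unfolding Ichar carrier_FactGroup by auto
  have img: "(\<lambda>x. H #> x) ` (I #> x) = Q #>\<^bsub>G Mod H\<^esub> (H #> x)" if x: "x \<in> carrier G" for x
  proof -
    have "I #> x = (\<lambda>q. q \<otimes> x) ` I" by (auto simp: r_coset_def)
    then have "(\<lambda>x. H #> x) ` (I #> x) = (\<lambda>q. H #> (q \<otimes> x)) ` I"
      by (simp add: image_image)
    also have "\<dots> = (\<lambda>q. (H #> q) <#> (H #> x)) ` I"
      using x by (intro image_cong refl) (simp add: Ichar rcos_sum)
    also have "\<dots> = (\<lambda>R. R <#> (H #> x)) ` Q"
      unfolding Qim[symmetric] image_image by simp
    also have "\<dots> = Q #>\<^bsub>G Mod H\<^esub> (H #> x)"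
      by (auto simp: r_coset_def[of "G Mod H"])
    finally show ?thesis .
  qed
  have "bij_betw (\<lambda>R. (\<lambda>x. H #> x) ` R) (rcosets I) (rcosets\<^bsub>G Mod H\<^esub> Q)"
    unfolding bij_betw_def
  proof
    show "inj_on (\<lambda>R. (\<lambda>x. H #> x) ` R) (rcosets I)"
    proof (rule inj_onI)
      fix R S assume RS: "R \<in> rcosets I" "S \<in> rcosets I"
        "(\<lambda>x. H #> x) ` R = (\<lambda>x. H #> x) ` S"
      obtain x y where x: "x \<in> carrier G" "R = I #> x" and y: "y \<in> carrier G" "S = I #> y"
        using RS unfolding RCOSETS_def by auto
      have "H #> x \<in> (\<lambda>x. H #> x) ` S"
        unfolding RS(3)[symmetric] x(2) using rcos_self[OF x(1) I] by (rule imageI)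
      then obtain i where i: "i \<in> I" "H #> x = H #> (i \<otimes> y)"
        unfolding y(2) r_coset_def[of _ "I"] by auto
      have iG: "i \<in> carrier G" using subgroup.mem_carrier[OF I i(1)] .
      have "x \<in> H #> (i \<otimes> y)" using i(2) rcos_self[OF x(1) H] by simp
      then obtain h where h: "h \<in> H" "x = h \<otimes> (i \<otimes> y)" unfolding r_coset_def by auto
      then have "x = (h \<otimes> i) \<otimes> y" using iG y by (simp add: m_assoc)
      moreover have "h \<otimes> i \<in> I" using h(1) HI i(1) subgroup.m_closed[OF I] by blast
      ultimately have "x \<in> I #> y" using y I by (simp add: rcosI subgroup.subset)
      then show "R = S" using repr_independence[OF _ y(1) I] x y by simp
    qed
    show "(\<lambda>R. (\<lambda>x. H #> x) ` R) ` (rcosets I) = rcosets\<^bsub>G Mod H\<^esub> Q"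
      unfolding RCOSETS_def carrier_FactGroup using img by auto
  qed
  then show ?thesis unfolding I_def by (rule bij_betw_same_card)
qed

text \<open>Since \<open>card Q\<close> is the index of \<open>H\<close> in
  \<open>\<Union>Q\<close>, this is the multiplicativity of indices along \<open>H\<close>,
  \<open>\<Union>Q\<close>, \<open>G\<close>.\<close>

lemma (in normal) card_rcosets_mult_card_subgroup:
  assumes Q: "subgroup Q (G Mod H)"
  shows "card (rcosets (\<Union>Q)) * card Q = card (rcosets H)"
  using group.lagrange[OF factorgroup_is_group Q] card_rcosets_Union[OF Q]
  by (simp add: order_def FactGroup_def)

lemma (in normal) subset_Union_subgroup:
  assumes "subgroup Q (G Mod H)"
  shows "H \<subseteq> \<Union>Q"
  using subgroup.one_closed[OF assms] by auto

text \<open>\<open>V\<close> is the preimage of a subgroup of prime index in the abelian quotient.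
  The last inequality makes an induction on the index possible.\<close>

lemma (in normal) ex_normal_of_prime_index:
  assumes fin: "finite (rcosets H)" and ne: "card (rcosets H) \<noteq> 1"
    and comm: "comm_group (G Mod H)"
  shows "\<exists>V. V \<lhd> G \<and> H \<subseteq> V \<and> prime (card (rcosets V)) \<and>
     card (rcosets\<^bsub>G\<lparr>carrier := V\<rparr>\<^esub> H) < card (rcosets H)"
proof -
  interpret Q: comm_group "G Mod H" by (rule comm)
  obtain N where N: "subgroup N (G Mod H)" "prime (card (rcosets\<^bsub>G Mod H\<^esub> N))"
    using Q.ex_subgroup_of_prime_index fin ne by (auto simp: order_def FactGroup_def)
  have pr: "prime (card (rcosets (\<Union>N)))" using N card_rcosets_Union by simp
  have "card (rcosets\<^bsub>G\<lparr>carrier := \<Union>N\<rparr>\<^esub> H) = card N"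
    using factgroup_subgroup_union_factor[OF N(1)] by simp
  moreover have "card N > 0"
    using card_rcosets_mult_card_subgroup[OF N(1)] fin rcosets_part_G[OF is_subgroup]
    by (metis card_gt_0_iff mult_0_right subgroup_in_rcosets[OF is_group] empty_iff gr0I)
  ultimately have "card (rcosets\<^bsub>G\<lparr>carrier := \<Union>N\<rparr>\<^esub> H) < card (rcosets H)"
    using card_rcosets_mult_card_subgroup[OF N(1)] prime_gt_1_nat[OF pr]
    by (metis mult_less_cancel2 nat_mult_1)
  then show ?thesis
    using factgroup_subgroup_union_normal[of N] Q.subgroup_imp_normal[OF N(1)]
      subset_Union_subgroup[OF N(1)] pr by blast
qed

text \<open>Write the index as \<open>p ^ k * m\<close> with \<open>m\<close> prime to
  \<open>p\<close>. If \<open>m = 1\<close>, the quotient is a nontrivial \<open>p\<close>-group and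
  has a normal subgroup of index \<open>p\<close>. Otherwise \<open>I\<close> is the preimage of a
  Sylow subgroup; its index is \<open>m > 1\<close>, so the index of \<open>H\<close> drops on
  passing to \<open>I\<close>.\<close>

lemma (in normal) ex_normal_of_prime_index_or_coprime_index:
  assumes fin: "finite (rcosets H)" and ne: "card (rcosets H) \<noteq> 1" and p: "prime p"
  shows "(\<exists>V. V \<lhd> G \<and> H \<subseteq> V \<and> prime (card (rcosets V)) \<and>
       card (rcosets\<^bsub>G\<lparr>carrier := V\<rparr>\<^esub> H) < card (rcosets H)) \<or>
     (\<exists>I. subgroup I G \<and> H \<subseteq> I \<and> \<not> p dvd card (rcosets I) \<and>
       card (rcosets\<^bsub>G\<lparr>carrier := I\<rparr>\<^esub> H) < card (rcosets H))"
proof -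
  interpret Q: group "G Mod H" by (rule factorgroup_is_group)
  have ord: "order (G Mod H) = card (rcosets H)" by (simp add: order_def FactGroup_def)
  have finQ: "finite (carrier (G Mod H))" using fin by (simp add: FactGroup_def)
  have pos: "card (rcosets H) > 0"
    using fin subgroup_in_rcosets[OF is_group] card_gt_0_iff by blast
  define k where "k = multiplicity p (card (rcosets H))"
  obtain m where m: "card (rcosets H) = p ^ k * m" "\<not> p dvd m"
    using multiplicity_decompose'[of "card (rcosets H)" p] pos p not_prime_1 unfolding k_def
    by (metis nat_neq_iff not_prime_unit)
  show ?thesis
  proof (cases "m = 1")
    case True
    then obtain j where j: "k = Suc j" using m ne by (cases k) auto
    obtain N where N: "N \<lhd> G Mod H" "card (rcosets\<^bsub>G Mod H\<^esub> N) = p"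
      using Q.prime_power_order_imp_normal_of_prime_index[OF p] m True j ord by auto
    have sub: "subgroup N (G Mod H)" using N(1) by (rule normal_imp_subgroup)
    have pr: "prime (card (rcosets (\<Union>N)))" using N p card_rcosets_Union[OF sub] by simp
    have "card (rcosets (\<Union>N)) * card (rcosets\<^bsub>G\<lparr>carrier := \<Union>N\<rparr>\<^esub> H) = card (rcosets H)"
      using card_rcosets_mult_card_subgroup[OF sub] factgroup_subgroup_union_factor[OF sub] by simp
    then have "card (rcosets\<^bsub>G\<lparr>carrier := \<Union>N\<rparr>\<^esub> H) < card (rcosets H)"
      using prime_gt_1_nat[OF pr] pos by (metis mult_less_cancel2 nat_mult_1 mult_0_right gr0I)
    then show ?thesis
      using factgroup_subgroup_union_normal[OF N(1)] subset_Union_subgroup[OF sub] pr by blast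
  next
    case False
    obtain P where P: "subgroup P (G Mod H)" "card P = p ^ k"
      using sylow_thm[OF p Q.is_group _ finQ] m(1) ord by metis
    have *: "card (rcosets (\<Union>P)) * card (rcosets\<^bsub>G\<lparr>carrier := \<Union>P\<rparr>\<^esub> H) = card (rcosets H)"
      using card_rcosets_mult_card_subgroup[OF P(1)] factgroup_subgroup_union_factor[OF P(1)] by simp
    have "card (rcosets (\<Union>P)) * p ^ k = m * p ^ k"
      using card_rcosets_mult_card_subgroup[OF P(1)] P(2) m(1) by (simp add: mult.commute)
    then have "card (rcosets (\<Union>P)) = m" using p by (simp add: prime_gt_0_nat)
    moreover have "m > 1" using False m pos by (metis less_one mult_0_right nat_neq_iff)
    then have "card (rcosets\<^bsub>G\<lparr>carrier := \<Union>P\<rparr>\<^esub> H) < card (rcosets H)"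
      using * calculation pos by (metis mult_less_cancel2 nat_mult_1 mult_0_right gr0I)
    ultimately show ?thesis
      using factgroup_subgroup_union_subgroup[OF P(1)] subset_Union_subgroup[OF P(1)] m(2) by blast
  qed
qed

section \<open>Abelianizations and the transfer\<close>

text \<open>These notions depend only on carrier, product and unit. The lemma carries library facts
  about \<open>Mod\<close> and about records with a changed carrier over to \<open>top_quot\<close>
  and \<open>top_subgroup\<close>, which carry a topology as well.\<close>

lemma group_struct_cong:
  fixes A :: "('a, 'm) monoid_scheme" and B :: "('a, 'n) monoid_scheme"
  assumes "carrier A = carrier B" "monoid.mult A = monoid.mult B" "one A = one B"
  shows "m_inv A = m_inv B" "Group.group A \<longleftrightarrow> Group.group B" "comm_group A \<longleftrightarrow> comm_group B"
    "subgroup S A \<longleftrightarrow> subgroup S B" "S \<lhd> A \<longleftrightarrow> S \<lhd> B"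
proof -
  show i: "m_inv A = m_inv B"
    by (rule ext) (simp add: m_inv_def assms)
  have m: "monoid A \<longleftrightarrow> monoid B"
    unfolding Group.monoid_def assms ..
  show g: "Group.group A \<longleftrightarrow> Group.group B"
    unfolding Group.group_def group_axioms_def Units_def m assms ..
  show "comm_group A \<longleftrightarrow> comm_group B"
    unfolding comm_group_def Group.comm_monoid_def comm_monoid_axioms_def g m assms ..
  show s: "subgroup S A \<longleftrightarrow> subgroup S B"
    unfolding subgroup_def i assms ..
  show "S \<lhd> A \<longleftrightarrow> S \<lhd> B"
    unfolding normal_def normal_axioms_def r_coset_def l_coset_def s g assms ..
qed

lemma top_subgroup_simps [simp]:
  "carrier (top_subgroup A H) = H"
  "monoid.mult (top_subgroup A H) = monoid.mult A"
  "one (top_subgroup A H) = one A"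
  "topo (top_subgroup A H) = subtopology (topo A) H"
  "N #>\<^bsub>top_subgroup A H\<^esub> x = N #>\<^bsub>A\<^esub> x"
  "S <#>\<^bsub>top_subgroup A H\<^esub> T = S <#>\<^bsub>A\<^esub> T"
  by (simp_all add: top_subgroup_def r_coset_def set_mult_def)

lemma top_quot_simps [simp]:
  "carrier (top_quot A N) = (\<lambda>x. N #>\<^bsub>A\<^esub> x) ` carrier A"
  "monoid.mult (top_quot A N) = set_mult A"
  "one (top_quot A N) = N"
  by (simp_all add: top_quot_def carrier_FactGroup)

lemma group_top_quot:
  assumes "N \<lhd> A"
  shows "Group.group (top_quot A N)"
  using normal.factorgroup_is_group[OF assms] group_struct_cong(2)[of "top_quot A N" "A Mod N"]
  by (simp add: carrier_FactGroup)

lemma (in group) group_top_subgroup_iff: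
  "Group.group (top_subgroup A H) \<longleftrightarrow> Group.group (A\<lparr>carrier := H\<rparr>)"
  "m_inv (top_subgroup A H) = m_inv (A\<lparr>carrier := H\<rparr>)"
  "subgroup S (top_subgroup A H) \<longleftrightarrow> subgroup S (A\<lparr>carrier := H\<rparr>)"
  "S \<lhd> top_subgroup A H \<longleftrightarrow> S \<lhd> A\<lparr>carrier := H\<rparr>"
  using group_struct_cong[of "top_subgroup A H" "A\<lparr>carrier := H\<rparr>"] by simp_all

lemma r_coset_hom_top_quot:
  assumes "N \<lhd> A"
  shows "(\<lambda>x. N #>\<^bsub>A\<^esub> x) \<in> hom A (top_quot A N)"
  using normal.r_coset_hom_Mod[OF assms] by (simp add: hom_def carrier_FactGroup)

lemma top_quot_r_coset_eq_one_iff: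
  assumes "N \<lhd> A" "x \<in> carrier A"
  shows "N #>\<^bsub>A\<^esub> x = N \<longleftrightarrow> x \<in> N"
proof -
  interpret normal N A by fact
  show ?thesis
    using coset_join2[OF assms(2) is_subgroup] rcos_self[OF assms(2) is_subgroup] by blast
qed

lemma hom_comm_group_derived:
  assumes A: "Group.group A" and B: "comm_group B" and f: "f \<in> hom A B"
    and x: "x \<in> derived A (carrier A)"
  shows "f x = \<one>\<^bsub>B\<^esub>"
proof -
  interpret A: group A by fact
  interpret B: comm_group B by fact
  interpret group_hom A B f using f by unfold_locales
  have im: "f ` carrier A \<subseteq> carrier B" using f by (auto simp: hom_def)
  have "f x \<in> derived B (f ` carrier A)"
    using derived_img[of "carrier A"] x by blast
  also have "\<dots> \<subseteq> derived B (carrier B)" using B.mono_derived[OF im] .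
  also have "\<dots> = {\<one>\<^bsub>B\<^esub>}" using B.derived_eq_singleton[OF order_refl] .
  finally show ?thesis by simp
qed

text \<open>Maps on quotients are defined by \<open>the_elem\<close> of the image of a coset. A
  homomorphism that kills \<open>N\<close> is constant on its cosets, so this image is a singleton
  and \<open>the_elem\<close> can be evaluated.\<close>

lemma hom_image_r_coset:
  assumes A: "Group.group A" and B: "Group.group B" and f: "f \<in> hom A B"
    and N: "subgroup N A" and ker: "\<And>n. n \<in> N \<Longrightarrow> f n = \<one>\<^bsub>B\<^esub>" and x: "x \<in> carrier A"
  shows "f ` (N #>\<^bsub>A\<^esub> x) = {f x}"
proof -
  interpret A: group A by fact
  interpret B: group B by fact
  interpret group_hom A B f using f by unfold_locales
  have "f (n \<otimes>\<^bsub>A\<^esub> x) = f x" if n: "n \<in> N" for n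
    using subgroup.mem_carrier[OF N n] ker[OF n] x by simp
  moreover have "N #>\<^bsub>A\<^esub> x = (\<lambda>n. n \<otimes>\<^bsub>A\<^esub> x) ` N"
    by (auto simp: r_coset_def)
  ultimately have "f ` (N #>\<^bsub>A\<^esub> x) = (\<lambda>n. f x) ` N"
    by (simp add: image_image)
  also have "\<dots> = {f x}" by (rule image_constant[OF subgroup.one_closed[OF N]])
  finally show ?thesis .
qed

lemma hom_comm_group_image_ab_class:
  assumes A: "Group.group A" and B: "comm_group B" and f: "f \<in> hom A B"
    and com: "com_t A = derived A (carrier A)" and x: "x \<in> carrier A"
  shows "f ` ab_class A x = {f x}"
  unfolding ab_class_def com
  using hom_image_r_coset[OF A comm_group.axioms(2)[OF B] f
      group.derived_is_subgroup[OF A order_refl] hom_comm_group_derived[OF A B f] x] .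

text \<open>Every subset of a discrete space is closed. For the quotients \<open>H/U\<close>, which
  turn out to be discrete, this reduces \<open>com_t\<close> to the algebraic commutator
  subgroup.\<close>

lemma com_t_discrete:
  assumes "Group.group A" "topo A = discrete_topology (carrier A)"
  shows "com_t A = derived A (carrier A)"
  using group.derived_in_carrier[OF assms(1) order_refl]
  unfolding com_t_def assms(2) by (simp add: discrete_topology_closure_of Int_absorb1)

lemma comm_group_abelianization:
  assumes A: "Group.group A" and com: "com_t A = derived A (carrier A)"
  shows "comm_group (abelianization A)"
  unfolding abelianization_def com
  using group.derived_quot_is_comm_group[OF A]
    group_struct_cong(3)[of "top_quot A (derived A (carrier A))" "A Mod (derived A (carrier A))"]
  by (simp add: carrier_FactGroup)

lemma ab_class_hom:
  assumes A: "Group.group A" and com: "com_t A = derived A (carrier A)"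
  shows "ab_class A \<in> hom A (abelianization A)"
  unfolding ab_class_def[abs_def] abelianization_def com
  using r_coset_hom_top_quot[OF group.derived_self_is_normal[OF A]] .

lemma ab_class_eq_one_iff:
  assumes A: "Group.group A" and com: "com_t A = derived A (carrier A)" and x: "x \<in> carrier A"
  shows "ab_class A x = \<one>\<^bsub>abelianization A\<^esub> \<longleftrightarrow> x \<in> com_t A"
  unfolding ab_class_def abelianization_def
  using top_quot_r_coset_eq_one_iff[of "com_t A" A x] group.derived_self_is_normal[OF A] x com by simp

lemma carrier_abelianization: "carrier (abelianization A) = ab_class A ` carrier A"
  by (simp add: abelianization_def ab_class_def[abs_def])

lemma rcosets_r_coset_bij:
  assumes A: "Group.group A" and S: "subgroup S A" and x: "x \<in> carrier A"
  shows "bij_betw (\<lambda>R. R #>\<^bsub>A\<^esub> x) (rcosets\<^bsub>A\<^esub> S) (rcosets\<^bsub>A\<^esub> S)"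
proof -
  interpret A: group A by fact
  have SA: "S \<subseteq> carrier A" using S by (rule subgroup.subset)
  have cl: "R #>\<^bsub>A\<^esub> y \<in> rcosets\<^bsub>A\<^esub> S" if "R \<in> rcosets\<^bsub>A\<^esub> S" "y \<in> carrier A" for R y
  proof -
    obtain a where "a \<in> carrier A" "R = S #>\<^bsub>A\<^esub> a" using \<open>R \<in> _\<close> by (auto simp: RCOSETS_def)
    then show ?thesis using that(2) SA A.rcosetsI[OF SA] by (simp add: A.coset_mult_assoc)
  qed
  have inv: "(R #>\<^bsub>A\<^esub> y) #>\<^bsub>A\<^esub> z = R" if "R \<in> rcosets\<^bsub>A\<^esub> S" "y \<in> carrier A" "z \<in> carrier A" "y \<otimes>\<^bsub>A\<^esub> z = \<one>\<^bsub>A\<^esub>" for R y z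
  proof -
    have "R \<subseteq> carrier A" using subgroup.rcosets_carrier[OF S A that(1)] .
    then show ?thesis using that by (simp add: A.coset_mult_assoc)
  qed
  show ?thesis
  proof (rule bij_betw_byWitness[where f' = "\<lambda>R. R #>\<^bsub>A\<^esub> inv\<^bsub>A\<^esub> x"])
    show "\<forall>R\<in>rcosets\<^bsub>A\<^esub> S. R #>\<^bsub>A\<^esub> x #>\<^bsub>A\<^esub> inv\<^bsub>A\<^esub> x = R"
      using inv[of _ x "inv\<^bsub>A\<^esub> x"] x by simp
    show "\<forall>R\<in>rcosets\<^bsub>A\<^esub> S. R #>\<^bsub>A\<^esub> inv\<^bsub>A\<^esub> x #>\<^bsub>A\<^esub> x = R"
      using inv[of _ "inv\<^bsub>A\<^esub> x" x] x by simp
    show "(\<lambda>R. R #>\<^bsub>A\<^esub> x) ` (rcosets\<^bsub>A\<^esub> S) \<subseteq> rcosets\<^bsub>A\<^esub> S"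
      by (rule image_subsetI) (rule cl[OF _ x])
    show "(\<lambda>R. R #>\<^bsub>A\<^esub> inv\<^bsub>A\<^esub> x) ` (rcosets\<^bsub>A\<^esub> S) \<subseteq> rcosets\<^bsub>A\<^esub> S"
      by (rule image_subsetI) (rule cl[OF _ A.inv_closed[OF x]])
  qed
qed

text \<open>The transfer is a homomorphism: in the product defining the value at \<open>x y\<close>, the factor
  \<open>t(R) x y t(R x y)\<inverse>\<close> splits as \<open>(t(R) x t(R x)\<inverse>) (t(R x) y t(R x y)\<inverse>)\<close>, and \<open>R \<mapsto> R x\<close>
  permutes the cosets.\<close>

lemma transfer_hom:
  assumes A: "Group.group A" and S: "subgroup S A"
    and f: "f \<in> hom (A\<lparr>carrier := S\<rparr>) K" and K: "comm_group K"
    and t: "\<And>R. R \<in> rcosets\<^bsub>A\<^esub> S \<Longrightarrow> t R \<in> R"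
  shows "(\<lambda>x. finprod K (\<lambda>R. f (t R \<otimes>\<^bsub>A\<^esub> x \<otimes>\<^bsub>A\<^esub> inv\<^bsub>A\<^esub> (t (R #>\<^bsub>A\<^esub> x)))) (rcosets\<^bsub>A\<^esub> S)) \<in> hom A K"
proof -
  interpret A: group A by fact
  interpret K: comm_group K by fact
  let ?C = "rcosets\<^bsub>A\<^esub> S"
  have SA: "S \<subseteq> carrier A" using S by (rule subgroup.subset)
  have f1: "f s \<in> carrier K" if "s \<in> S" for s
    using hom_in_carrier[OF f, of s] that by simp
  have f2: "f (s \<otimes>\<^bsub>A\<^esub> s') = f s \<otimes>\<^bsub>K\<^esub> f s'" if "s \<in> S" "s' \<in> S" for s s'
    using hom_mult[OF f, of s s'] that by simp
  have sh: "R #>\<^bsub>A\<^esub> x \<in> ?C" if "R \<in> ?C" "x \<in> carrier A" for R x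
    by (rule bij_betw_apply[OF rcosets_r_coset_bij[OF A S that(2)] that(1)])
  have tC: "t R \<in> carrier A" if "R \<in> ?C" for R
    using subgroup.rcosets_carrier[OF S A that] t[OF that] by blast
  have mem: "t R \<otimes>\<^bsub>A\<^esub> x \<otimes>\<^bsub>A\<^esub> inv\<^bsub>A\<^esub> (t (R #>\<^bsub>A\<^esub> x)) \<in> S" if R: "R \<in> ?C" and x: "x \<in> carrier A" for R x
  proof -
    obtain a where a: "a \<in> carrier A" "R = S #>\<^bsub>A\<^esub> a" using R by (auto simp: RCOSETS_def)
    have "t R \<otimes>\<^bsub>A\<^esub> x \<in> R #>\<^bsub>A\<^esub> x" using t[OF R] unfolding r_coset_def by blast
    then have 1: "t R \<otimes>\<^bsub>A\<^esub> x \<in> S #>\<^bsub>A\<^esub> (a \<otimes>\<^bsub>A\<^esub> x)"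
      using a x SA by (simp add: A.coset_mult_assoc)
    have 2: "t (R #>\<^bsub>A\<^esub> x) \<in> S #>\<^bsub>A\<^esub> (a \<otimes>\<^bsub>A\<^esub> x)"
      using t[OF sh[OF R x]] a x SA by (simp add: A.coset_mult_assoc)
    have "S #>\<^bsub>A\<^esub> (a \<otimes>\<^bsub>A\<^esub> x) = S #>\<^bsub>A\<^esub> (t (R #>\<^bsub>A\<^esub> x))"
      using A.repr_independence[OF 2 _ S] a x by simp
    with 1 show ?thesis
      using subgroup.rcos_module_imp[OF S A tC[OF sh[OF R x]]] by simp
  qed
  show ?thesis
  proof (rule homI)
    fix x assume x: "x \<in> carrier A"
    show "finprod K (\<lambda>R. f (t R \<otimes>\<^bsub>A\<^esub> x \<otimes>\<^bsub>A\<^esub> inv\<^bsub>A\<^esub> (t (R #>\<^bsub>A\<^esub> x)))) ?C \<in> carrier K"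
      by (intro K.finprod_closed Pi_I f1 mem x)
  next
    fix x y assume x: "x \<in> carrier A" and y: "y \<in> carrier A"
    define F where "F z R = f (t R \<otimes>\<^bsub>A\<^esub> z \<otimes>\<^bsub>A\<^esub> inv\<^bsub>A\<^esub> (t (R #>\<^bsub>A\<^esub> z)))" for z R
    have F: "F z \<in> ?C \<rightarrow> carrier K" if "z \<in> carrier A" for z
      unfolding F_def by (intro Pi_I f1 mem that)
    have split: "F (x \<otimes>\<^bsub>A\<^esub> y) R = F x R \<otimes>\<^bsub>K\<^esub> F y (R #>\<^bsub>A\<^esub> x)" if R: "R \<in> ?C" for R
    proof -
      have Rc: "R \<subseteq> carrier A" using subgroup.rcosets_carrier[OF S A R] .
      let ?a = "t R" and ?b = "t (R #>\<^bsub>A\<^esub> x)" and ?c = "t (R #>\<^bsub>A\<^esub> x #>\<^bsub>A\<^esub> y)"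
      have cs: "?a \<in> carrier A" "?b \<in> carrier A" "?c \<in> carrier A"
        using tC sh R x y by auto
      have e: "?a \<otimes>\<^bsub>A\<^esub> (x \<otimes>\<^bsub>A\<^esub> y) \<otimes>\<^bsub>A\<^esub> inv\<^bsub>A\<^esub> ?c
        = (?a \<otimes>\<^bsub>A\<^esub> x \<otimes>\<^bsub>A\<^esub> inv\<^bsub>A\<^esub> ?b) \<otimes>\<^bsub>A\<^esub> (?b \<otimes>\<^bsub>A\<^esub> y \<otimes>\<^bsub>A\<^esub> inv\<^bsub>A\<^esub> ?c)"
      proof -
        have "inv\<^bsub>A\<^esub> ?b \<otimes>\<^bsub>A\<^esub> (?b \<otimes>\<^bsub>A\<^esub> (y \<otimes>\<^bsub>A\<^esub> inv\<^bsub>A\<^esub> ?c)) = y \<otimes>\<^bsub>A\<^esub> inv\<^bsub>A\<^esub> ?c"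
          using cs x y by (simp flip: A.m_assoc)
        then show ?thesis using cs x y by (simp add: A.m_assoc)
      qed
      show ?thesis
        unfolding F_def A.coset_mult_assoc[OF Rc x y, symmetric] e
        by (rule f2[OF mem[OF R x] mem[OF sh[OF R x] y]])
    qed
    have "finprod K (F (x \<otimes>\<^bsub>A\<^esub> y)) ?C = finprod K (\<lambda>R. F x R \<otimes>\<^bsub>K\<^esub> F y (R #>\<^bsub>A\<^esub> x)) ?C"
    proof (rule K.finprod_cong'[OF refl])
      show "(\<lambda>R. F x R \<otimes>\<^bsub>K\<^esub> F y (R #>\<^bsub>A\<^esub> x)) \<in> ?C \<rightarrow> carrier K"
        by (intro Pi_I K.m_closed funcset_mem[OF F[OF x]] funcset_mem[OF F[OF y]] sh[OF _ x])
    qed (rule split)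
    also have "\<dots> = finprod K (F x) ?C \<otimes>\<^bsub>K\<^esub> finprod K (\<lambda>R. F y (R #>\<^bsub>A\<^esub> x)) ?C"
      by (rule K.finprod_multf[OF F[OF x]]) (intro Pi_I funcset_mem[OF F[OF y]] sh[OF _ x])
    also have "finprod K (\<lambda>R. F y (R #>\<^bsub>A\<^esub> x)) ?C = finprod K (F y) ((\<lambda>R. R #>\<^bsub>A\<^esub> x) ` ?C)"
      using bij_betw_imp_inj_on[OF rcosets_r_coset_bij[OF A S x]]
        bij_betw_imp_surj_on[OF rcosets_r_coset_bij[OF A S x]] F[OF y]
      by (intro K.finprod_reindex[symmetric]) simp_all
    also have "(\<lambda>R. R #>\<^bsub>A\<^esub> x) ` ?C = ?C"
      by (rule bij_betw_imp_surj_on[OF rcosets_r_coset_bij[OF A S x]])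
    finally show "finprod K (\<lambda>R. f (t R \<otimes>\<^bsub>A\<^esub> (x \<otimes>\<^bsub>A\<^esub> y) \<otimes>\<^bsub>A\<^esub> inv\<^bsub>A\<^esub> (t (R #>\<^bsub>A\<^esub> (x \<otimes>\<^bsub>A\<^esub> y))))) ?C =
      finprod K (\<lambda>R. f (t R \<otimes>\<^bsub>A\<^esub> x \<otimes>\<^bsub>A\<^esub> inv\<^bsub>A\<^esub> (t (R #>\<^bsub>A\<^esub> x)))) ?C \<otimes>\<^bsub>K\<^esub>
      finprod K (\<lambda>R. f (t R \<otimes>\<^bsub>A\<^esub> y \<otimes>\<^bsub>A\<^esub> inv\<^bsub>A\<^esub> (t (R #>\<^bsub>A\<^esub> y)))) ?C"
      unfolding F_def .
  qed
qed

text \<open>By \<open>transfer_hom\<close> the product defining the transfer is a homomorphism into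
  an abelian group, hence constant on commutator classes, and \<open>the_elem\<close> returns its
  value at any representative.\<close>

lemma transfer_map_closed:
  assumes A: "Group.group A" and B: "Group.group B" and S: "subgroup (carrier B) A"
    and mult: "monoid.mult B = monoid.mult A"
    and comA: "com_t A = derived A (carrier A)" and comB: "com_t B = derived B (carrier B)"
    and X: "X \<in> carrier (abelianization A)"
  shows "transfer_map A B X \<in> carrier (abelianization B)"
proof -
  interpret A: group A by fact
  interpret K: comm_group "abelianization B" by (rule comm_group_abelianization[OF B comB])
  let ?t = "\<lambda>R. SOME y. y \<in> R"
  define f where "f = (\<lambda>x. finprod (abelianization B)
              (\<lambda>R. ab_class B (?t R \<otimes>\<^bsub>A\<^esub> x \<otimes>\<^bsub>A\<^esub> inv\<^bsub>A\<^esub> (?t (R #>\<^bsub>A\<^esub> x))))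
              (rcosets\<^bsub>A\<^esub> (carrier B)))"
  have "ab_class B \<in> hom (A\<lparr>carrier := carrier B\<rparr>) (abelianization B)"
    using ab_class_hom[OF B comB] by (simp add: hom_def mult)
  moreover have "?t R \<in> R" if "R \<in> rcosets\<^bsub>A\<^esub> (carrier B)" for R
    using subgroup.rcosets_non_empty[OF S that] by (simp add: some_in_eq)
  ultimately have f: "f \<in> hom A (abelianization B)"
    unfolding f_def using transfer_hom[OF A S _ K.comm_group_axioms, of "ab_class B" ?t] by blast
  obtain x where x: "x \<in> carrier A" "X = ab_class A x"
    using X by (auto simp: carrier_abelianization)
  have "transfer_map A B X = the_elem (f ` X)" unfolding transfer_map_def f_def ..
  also have "\<dots> = f x"
    using hom_comm_group_image_ab_class[OF A K.comm_group_axioms f comA x(1)] x(2) by simp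
  finally show ?thesis using f x(1) by (auto simp: hom_def)
qed

section \<open>Spectra and prime morphisms\<close>

text \<open>The coset is the preimage of \<open>U\<close> under the continuous map
  \<open>x \<mapsto> x \<otimes> inv h\<close>.\<close>

lemma (in group) closedin_r_coset:
  fixes T :: "'a topology"
  assumes T: "topspace T = carrier G"
    and cont: "continuous_map (prod_topology T T) T (\<lambda>(x, y). x \<otimes> y)"
    and U: "closedin T U" and h: "h \<in> carrier G"
  shows "closedin T (U #> h)"
proof -
  have "continuous_map T T (\<lambda>x. (\<lambda>(x, y). x \<otimes> y) (x, inv h))"
    using h T
    by (intro continuous_map_compose[OF _ cont, unfolded o_def] continuous_map_pairedI) auto
  then have c: "continuous_map T T (\<lambda>x. x \<otimes> inv h)" by simp
  have "U \<subseteq> carrier G" using U T closedin_subset by blast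
  then have "U #> h = {x \<in> topspace T. x \<otimes> inv h \<in> U}"
    using h T by (auto simp: r_coset_def m_assoc)
  then show ?thesis using closedin_continuous_map_preimage[OF c U] by simp
qed

locale class_field_data =
  fixes G :: "'a top_monoid"
    and E :: "('a set \<times> 'a set) ric_domain"
    and M :: "'a set ric_domain"
    and C :: "('a, 'a set, 'c) ric_functor"
    and \<rho> :: "'a set \<times> 'a set \<Rightarrow> 'a set set \<Rightarrow> 'c set"
  assumes G_top: "topological_group G"
    and spectrum: "spectrum G E"
    and coherent: "coherent G E"
    and cover: "mackey_cover G E M"
    and arithmetic: "arithmetic_system G M"
    and C_cohomological: "cohomological_mackey_functor G M C"
    and class_field_axiom_prime:
      "\<And>l H U. \<lbrakk>(H, U) \<in> base E; cyclic_prime_quot G H U l\<rbrakk> \<Longrightarrow> class_field_axiom G C H U"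
    and rho_prime: "prime_morphism G E (pi_functor G) (H0_functor G C) \<rho>"
begin

sublocale group G
  using G_top by (simp add: topological_group_def)

lemma G_topspace: "topspace (topo G) = carrier G"
  using G_top by (simp add: topological_group_def)

lemma G_mult_continuous: "continuous_map (prod_topology (topo G) (topo G)) (topo G) (\<lambda>(x, y). x \<otimes>\<^bsub>G\<^esub> y)"
  using G_top by (simp add: topological_group_def)

subsection \<open>The spectrum\<close>

lemma E_domain: "is_ric_domain G (conj_pair G) E"
  and E_grp2: "base E \<subseteq> grp2 G"
  and E_le: "\<And>H U I V. \<lbrakk>(H, U) \<in> base E; (I, V) \<in> r_set E (H, U) \<union> i_set E (H, U)\<rbrakk> \<Longrightarrow> I \<subseteq> H \<and> V \<subseteq> U"
  using spectrum by (fastforce simp: spectrum_def subgroup_system2_def)+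

lemma E_closed: "closed_system G (conj_pair G) (base E) (r_set E)" "closed_system G (conj_pair G) (base E) (i_set E)"
  using E_domain by (simp_all add: is_ric_domain_def)

lemma baseD:
  assumes "(H, U) \<in> base E"
  shows "subgroup H G" "closedin (topo G) H" "U \<lhd> G\<lparr>carrier := H\<rparr>" "closedin (topo G) U"
  using assms E_grp2 by (auto simp: grp2_def group_top_subgroup_iff)

lemma base_act:
  assumes "x \<in> base E" "g \<in> carrier G"
  shows "conj_pair G g x \<in> base E"
  using E_domain assms group_action.element_image[of G "base E" "\<lambda>g. restrict (conj_pair G g) (base E)" g x "conj_pair G g x"]
  by (simp add: is_ric_domain_def)

lemma r_set_base:
  assumes "x \<in> base E" "y \<in> r_set E x"
  shows "y \<in> base E"
  using E_closed(1) assms unfolding closed_system_def by blast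

lemma i_set_base:
  assumes "x \<in> base E" "y \<in> i_set E x"
  shows "y \<in> base E"
  using E_closed(2) assms unfolding closed_system_def by blast

lemma r_set_snd:
  assumes "(H, U) \<in> base E" "(I, V) \<in> r_set E (H, U)"
  shows "V = U"
  using spectrum assms unfolding spectrum_def by fastforce

lemma base_flat: "(H, U) \<in> base E \<Longrightarrow> H \<in> base (flat E)"
  by (force simp: flat_def)

lemma base_Ext: "U \<in> Ext E H \<longleftrightarrow> (H, U) \<in> base E"
  by (simp add: Ext_def)

lemma base_subgroup:
  assumes "(H, U) \<in> base E"
  shows "subgroup U G" "U \<subseteq> H" "H \<subseteq> carrier G"
proof -
  show "U \<subseteq> H" using normal_imp_subgroup[OF baseD(3)[OF assms]] subgroup.subset by fastforce
  show "H \<subseteq> carrier G" using baseD(1)[OF assms] by (rule subgroup.subset)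
  show "subgroup U G"
    using incl_subgroup[OF baseD(1)[OF assms]] normal_imp_subgroup[OF baseD(3)[OF assms]] by blast
qed

lemma finite_rcosets:
  assumes "(H, U) \<in> base E"
  shows "finite (rcosets\<^bsub>G\<lparr>carrier := H\<rparr>\<^esub> U)"
  using coherent assms by (fastforce simp: coherent_def finite_index_def)

text \<open>By coherence \<open>U\<close> has finite index in \<open>H\<close>, so \<open>S\<close>
  is a finite union of cosets of \<open>U\<close>, each of which is closed.\<close>

lemma saturated_closedin:
  assumes HU: "(H, U) \<in> base E" and S: "S \<subseteq> H" and sat: "\<And>s. s \<in> S \<Longrightarrow> U #>\<^bsub>G\<^esub> s \<subseteq> S"
  shows "closedin (topo G) S"
proof -
  have mem: "s \<in> carrier G" if "s \<in> S" for s
    using that S base_subgroup(3)[OF HU] by blast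
  have "S = \<Union>((\<lambda>s. U #>\<^bsub>G\<^esub> s) ` S)"
    using UN_least[of S "\<lambda>s. U #>\<^bsub>G\<^esub> s" S, OF sat] rcos_self[OF mem base_subgroup(1)[OF HU]]
    by auto
  moreover have "closedin (topo G) (\<Union>((\<lambda>s. U #>\<^bsub>G\<^esub> s) ` S))"
  proof (rule closedin_Union)
    have "(\<lambda>s. U #>\<^bsub>G\<^esub> s) ` S \<subseteq> rcosets\<^bsub>G\<lparr>carrier := H\<rparr>\<^esub> U"
      using S by (auto simp: RCOSETS_def)
    then show "finite ((\<lambda>s. U #>\<^bsub>G\<^esub> s) ` S)"
      using finite_rcosets[OF HU] by (rule finite_subset)
    show "closedin (topo G) R" if "R \<in> (\<lambda>s. U #>\<^bsub>G\<^esub> s) ` S" for R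
      using closedin_r_coset[OF G_topspace G_mult_continuous baseD(4)[OF HU]] mem that by blast
  qed
  ultimately show ?thesis by simp
qed

text \<open>The complement of \<open>S\<close> in \<open>H\<close> is saturated as well, hence
  closed.\<close>

lemma saturated_openin:
  assumes HU: "(H, U) \<in> base E" and S: "S \<subseteq> H" and sat: "\<And>s. s \<in> S \<Longrightarrow> U #>\<^bsub>G\<^esub> s \<subseteq> S"
  shows "openin (subtopology (topo G) H) S"
proof -
  note sub = base_subgroup[OF HU] baseD(1)[OF HU]
  have "U #>\<^bsub>G\<^esub> s \<subseteq> H - S" if s: "s \<in> H - S" for s
  proof
    fix x assume x: "x \<in> U #>\<^bsub>G\<^esub> s"
    have sG: "s \<in> carrier G" using s sub by blast
    have xH: "x \<in> H" using x s sub(2) subgroup.m_closed[OF sub(4)] by (auto simp: r_coset_def)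
    have "U #>\<^bsub>G\<^esub> s = U #>\<^bsub>G\<^esub> x" using repr_independence[OF x sG sub(1)] .
    then have "s \<in> U #>\<^bsub>G\<^esub> x" using rcos_self[OF sG sub(1)] by simp
    then show "x \<in> H - S" using sat[of x] s xH by blast
  qed
  then have "closedin (topo G) (H - S)"
    using saturated_closedin[OF HU, of "H - S"] by blast
  then have "closedin (subtopology (topo G) H) (H - S)"
    by (rule closedin_subset_topspace) blast
  moreover have "topspace (subtopology (topo G) H) = H"
    using sub G_topspace by auto
  ultimately show ?thesis
    using S by (simp add: openin_closedin_eq)
qed

lemma subgroup_saturated:
  assumes I: "subgroup I (G\<lparr>carrier := H\<rparr>)" and "U \<subseteq> I" and "s \<in> I"
  shows "U #>\<^bsub>G\<^esub> s \<subseteq> I"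
  using subgroup.m_closed[OF I] assms(2,3) by (auto simp: r_coset_def)

lemmas coherent_flat = bspec[OF conjunct2[OF coherent[unfolded coherent_def]] base_flat]

text \<open>Coherence speaks of closed normal subgroups; \<open>V\<close> is closed because it is a
  union of cosets of \<open>U\<close>.\<close>

lemma coherent_normal:
  assumes HU: "(H, U) \<in> base E" and V: "V \<lhd> G\<lparr>carrier := H\<rparr>" "U \<subseteq> V"
  shows "(H, V) \<in> base E" "(V, U) \<in> base E" "(V, U) \<in> i_set E (H, U)" "(H, U) \<in> i_set E (H, V)"
proof -
  have V': "subgroup V (G\<lparr>carrier := H\<rparr>)" using V(1) by (rule normal_imp_subgroup)
  have "closedin (topo G) V"
    using saturated_closedin[OF HU _ subgroup_saturated[OF V' V(2)]] subgroup.subset[OF V'] by simp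
  then have "V \<in> Ext E H \<and> U \<in> Ext E V \<and> (V, U) \<in> i_set E (H, U) \<and> (H, U) \<in> i_set E (H, V)"
    using bspec[OF conjunct1[OF conjunct2[OF coherent_flat[OF HU]]], of U] HU V
    by (simp add: base_Ext group_top_subgroup_iff)
  then show "(H, V) \<in> base E" "(V, U) \<in> base E" "(V, U) \<in> i_set E (H, U)" "(H, U) \<in> i_set E (H, V)"
    by (simp_all add: base_Ext)
qed

text \<open>Here saturation under \<open>U\<close> supplies the openness of \<open>I\<close> in
  \<open>H\<close> that coherence asks for.\<close>

lemma coherent_subgroup:
  assumes HU: "(H, U) \<in> base E" and I: "subgroup I (G\<lparr>carrier := H\<rparr>)" "U \<subseteq> I"
  shows "(I, U) \<in> base E" "(I, U) \<in> i_set E (H, U)" "openin (subtopology (topo G) H) I"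
proof -
  show op: "openin (subtopology (topo G) H) I"
    using saturated_openin[OF HU _ subgroup_saturated[OF I]] subgroup.subset[OF I(1)] by simp
  show "(I, U) \<in> i_set E (H, U)"
    using bspec[OF conjunct2[OF conjunct2[OF coherent_flat[OF HU]]], of U] HU I op
    by (simp add: base_Ext group_top_subgroup_iff)
  then show "(I, U) \<in> base E" by (rule i_set_base[OF HU])
qed

subsection \<open>Quotients of the spectrum\<close>

lemma ext_quot_simps:
  "carrier (ext_quot G (H, U)) = (\<lambda>h. U #>\<^bsub>G\<^esub> h) ` H"
  "monoid.mult (ext_quot G (H, U)) = set_mult G"
  "one (ext_quot G (H, U)) = U"
  by (simp_all add: ext_quot_def set_mult_def fun_eq_iff)

lemma ext_quot_group:
  assumes "(H, U) \<in> base E"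
  shows "Group.group (ext_quot G (H, U))"
  unfolding ext_quot_def prod.case
  using baseD(3)[OF assms] by (intro group_top_quot) (simp add: group_top_subgroup_iff)

lemma r_coset_mult:
  assumes "(H, U) \<in> base E" "a \<in> H" "b \<in> H"
  shows "(U #>\<^bsub>G\<^esub> a) <#>\<^bsub>G\<^esub> (U #>\<^bsub>G\<^esub> b) = U #>\<^bsub>G\<^esub> (a \<otimes>\<^bsub>G\<^esub> b)"
  using normal.rcos_sum[OF baseD(3)[OF assms(1)]] assms(2,3) by simp

text \<open>The preimage in \<open>H\<close> of any set of cosets is saturated under
  \<open>U\<close>, hence open in \<open>H\<close>.\<close>

lemma ext_quot_discrete:
  assumes HU: "(H, U) \<in> base E"
  shows "topo (ext_quot G (H, U)) = discrete_topology (carrier (ext_quot G (H, U)))"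
proof -
  note sub = base_subgroup[OF HU] baseD(1)[OF HU]
  let ?A = "top_subgroup G H"
  have "openin (subtopology (topo G) H) {x \<in> H. U #>\<^bsub>G\<^esub> x \<in> W}" for W
  proof (rule saturated_openin[OF HU])
    fix s assume s: "s \<in> {x \<in> H. U #>\<^bsub>G\<^esub> x \<in> W}"
    show "U #>\<^bsub>G\<^esub> s \<subseteq> {x \<in> H. U #>\<^bsub>G\<^esub> x \<in> W}"
    proof
      fix x assume x: "x \<in> U #>\<^bsub>G\<^esub> s"
      have "x \<in> H" using x s sub(2) subgroup.m_closed[OF sub(4)] by (auto simp: r_coset_def)
      moreover have "U #>\<^bsub>G\<^esub> s = U #>\<^bsub>G\<^esub> x" using repr_independence[OF x _ sub(1)] s sub by blast
      ultimately show "x \<in> {x \<in> H. U #>\<^bsub>G\<^esub> x \<in> W}" using s by simp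
    qed
  qed blast
  then show ?thesis
    unfolding topology_eq openin_discrete_topology ext_quot_def prod.case openin_top_quot
    by (simp add: carrier_FactGroup)
qed

lemma com_t_ext_quot:
  assumes "(H, U) \<in> base E"
  shows "com_t (ext_quot G (H, U)) = derived (ext_quot G (H, U)) (carrier (ext_quot G (H, U)))"
  by (rule com_t_discrete[OF ext_quot_group[OF assms] ext_quot_discrete[OF assms]])

lemma comm_group_pi:
  assumes "(H, U) \<in> base E"
  shows "comm_group (abelianization (ext_quot G (H, U)))"
  by (rule comm_group_abelianization[OF ext_quot_group[OF assms] com_t_ext_quot[OF assms]])

text \<open>An element of the abelianization of \<open>H/U\<close> is a set of cosets; this function
  names it by a representative in \<open>H\<close>, so that the structure maps of
  \<open>pi_functor\<close> can be described by formulas in \<open>G\<close>.\<close>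

definition pi_class :: "'a set \<Rightarrow> 'a set \<Rightarrow> 'a \<Rightarrow> 'a set set" where
  "pi_class H U h = ab_class (ext_quot G (H, U)) (U #>\<^bsub>G\<^esub> h)"

lemma pi_carrier: "carrier (abelianization (ext_quot G (H, U))) = pi_class H U ` H"
  unfolding pi_class_def[abs_def] carrier_abelianization ext_quot_simps by (simp add: image_image)

lemma pi_class_mult:
  assumes HU: "(H, U) \<in> base E" and "a \<in> H" "b \<in> H"
  shows "pi_class H U (a \<otimes>\<^bsub>G\<^esub> b) = pi_class H U a \<otimes>\<^bsub>abelianization (ext_quot G (H, U))\<^esub> pi_class H U b"
  using hom_mult[OF ab_class_hom[OF ext_quot_group[OF HU] com_t_ext_quot[OF HU]],
      of "U #>\<^bsub>G\<^esub> a" "U #>\<^bsub>G\<^esub> b"] assms(2,3)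
  by (simp add: ext_quot_simps pi_class_def r_coset_mult[OF assms])

lemma pi_class_closed: "h \<in> H \<Longrightarrow> pi_class H U h \<in> carrier (abelianization (ext_quot G (H, U)))"
  by (simp add: pi_carrier)

text \<open>\<open>f\<close> is a map on \<open>H/U\<close> and \<open>k\<close> its description on
  representatives. Multiplicativity of \<open>k\<close> makes \<open>f\<close> a homomorphism into
  an abelian group, hence constant on the set of cosets \<open>pi_class H U h\<close>.\<close>

lemma pi_map:
  assumes HU: "(H, U) \<in> base E" and K: "comm_group K"
    and f: "\<And>h. h \<in> H \<Longrightarrow> f (U #>\<^bsub>G\<^esub> h) = k h"
    and kc: "\<And>h. h \<in> H \<Longrightarrow> k h \<in> carrier K"
    and km: "\<And>a b. \<lbrakk>a \<in> H; b \<in> H\<rbrakk> \<Longrightarrow> k (a \<otimes>\<^bsub>G\<^esub> b) = k a \<otimes>\<^bsub>K\<^esub> k b"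
    and h: "h \<in> H"
  shows "the_elem (f ` pi_class H U h) = k h"
proof -
  have mc: "a \<otimes>\<^bsub>G\<^esub> b \<in> H" if "a \<in> H" "b \<in> H" for a b
    using subgroup.m_closed[OF baseD(1)[OF HU]] that .
  have "f \<in> hom (ext_quot G (H, U)) K"
  proof (rule homI)
    fix X assume "X \<in> carrier (ext_quot G (H, U))"
    then show "f X \<in> carrier K" using f kc by (auto simp: ext_quot_simps)
  next
    fix X Y assume "X \<in> carrier (ext_quot G (H, U))" "Y \<in> carrier (ext_quot G (H, U))"
    then obtain a b where "a \<in> H" "X = U #>\<^bsub>G\<^esub> a" "b \<in> H" "Y = U #>\<^bsub>G\<^esub> b"
      by (auto simp: ext_quot_simps)
    then show "f (X \<otimes>\<^bsub>ext_quot G (H, U)\<^esub> Y) = f X \<otimes>\<^bsub>K\<^esub> f Y"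
      using f km mc r_coset_mult[OF HU] by (simp add: ext_quot_simps)
  qed
  from hom_comm_group_image_ab_class[OF ext_quot_group[OF HU] K this com_t_ext_quot[OF HU]]
  show ?thesis using h f by (simp add: pi_class_def ext_quot_simps)
qed

lemma pi_ind:
  assumes HU: "(H, U) \<in> base E" and IV: "(I, V) \<in> i_set E (H, U)" and h: "h \<in> I"
  shows "ind (pi_functor G) (H, U) (I, V) (pi_class I V h) = pi_class H U h"
proof -
  have IV': "(I, V) \<in> base E" using i_set_base[OF HU IV] .
  have le: "I \<subseteq> H" "V \<subseteq> U" using E_le[OF HU] IV by auto
  \<comment> \<open>Needed because \<open>ind\<close> sends a coset of \<open>V\<close> to its
    product with \<open>U\<close>, which has to be the coset of \<open>U\<close> with the same
    representative.\<close>
  have UV: "U <#>\<^bsub>G\<^esub> V = U"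
  proof
    show "U <#>\<^bsub>G\<^esub> V \<subseteq> U"
      using le subgroup.m_closed[OF base_subgroup(1)[OF HU]] by (auto simp: set_mult_def)
    show "U \<subseteq> U <#>\<^bsub>G\<^esub> V"
      using subgroup.one_closed[OF base_subgroup(1)[OF IV']] subgroup.mem_carrier[OF base_subgroup(1)[OF HU]]
      by (force simp: set_mult_def)
  qed
  have f: "U <#>\<^bsub>G\<^esub> (V #>\<^bsub>G\<^esub> a) = U #>\<^bsub>G\<^esub> a" if "a \<in> I" for a
  proof -
    have "U \<subseteq> carrier G" "V \<subseteq> carrier G" "a \<in> carrier G"
      using that base_subgroup[OF IV'] base_subgroup[OF HU] by blast+
    then show ?thesis
      using setmult_rcos_assoc[of U V a] UV by simp
  qed
  show ?thesis
    unfolding pi_functor_def ric_functor.simps snd_conv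
  proof (rule pi_map[OF IV' comm_group_pi[OF HU]])
    fix a assume a: "a \<in> I"
    show "ab_class (ext_quot G (H, U)) (U <#>\<^bsub>G\<^esub> (V #>\<^bsub>G\<^esub> a)) = pi_class H U a"
      unfolding f[OF a] pi_class_def ..
    show "pi_class H U a \<in> carrier (abelianization (ext_quot G (H, U)))"
      using a le by (intro pi_class_closed) blast
  next
    fix a b assume "a \<in> I" "b \<in> I"
    then show "pi_class H U (a \<otimes>\<^bsub>G\<^esub> b) = pi_class H U a \<otimes>\<^bsub>abelianization (ext_quot G (H, U))\<^esub> pi_class H U b"
      using le by (intro pi_class_mult[OF HU]) blast+
  qed (rule h)
qed

lemma conj_r_coset:
  assumes "g \<in> carrier G" "h \<in> carrier G" "U \<subseteq> carrier G"
  shows "conj_set G g (U #>\<^bsub>G\<^esub> h) = conj_set G g U #>\<^bsub>G\<^esub> (g \<otimes>\<^bsub>G\<^esub> h \<otimes>\<^bsub>G\<^esub> inv\<^bsub>G\<^esub> g)"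
proof -
  have "g \<otimes>\<^bsub>G\<^esub> (u \<otimes>\<^bsub>G\<^esub> h) \<otimes>\<^bsub>G\<^esub> inv\<^bsub>G\<^esub> g
      = (g \<otimes>\<^bsub>G\<^esub> u \<otimes>\<^bsub>G\<^esub> inv\<^bsub>G\<^esub> g) \<otimes>\<^bsub>G\<^esub> (g \<otimes>\<^bsub>G\<^esub> h \<otimes>\<^bsub>G\<^esub> inv\<^bsub>G\<^esub> g)" if "u \<in> carrier G" for u
  proof -
    have "inv\<^bsub>G\<^esub> g \<otimes>\<^bsub>G\<^esub> (g \<otimes>\<^bsub>G\<^esub> (h \<otimes>\<^bsub>G\<^esub> inv\<^bsub>G\<^esub> g)) = h \<otimes>\<^bsub>G\<^esub> inv\<^bsub>G\<^esub> g"
      using assms by (simp flip: m_assoc)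
    then show ?thesis using assms that by (simp add: m_assoc)
  qed
  moreover have "U #>\<^bsub>G\<^esub> h = (\<lambda>u. u \<otimes>\<^bsub>G\<^esub> h) ` U"
    "conj_set G g U #>\<^bsub>G\<^esub> k = (\<lambda>u. u \<otimes>\<^bsub>G\<^esub> k) ` conj_set G g U" for k
    by (auto simp: r_coset_def)
  ultimately show ?thesis
    using assms(3) unfolding conj_set_def by (simp add: image_image subset_iff cong: image_cong_simp)
qed

lemma pi_con:
  assumes HU: "(H, U) \<in> base E" and g: "g \<in> carrier G" and h: "h \<in> H"
  shows "con (pi_functor G) g (H, U) (pi_class H U h) =
    pi_class (conj_set G g H) (conj_set G g U) (g \<otimes>\<^bsub>G\<^esub> h \<otimes>\<^bsub>G\<^esub> inv\<^bsub>G\<^esub> g)"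
proof -
  let ?H = "conj_set G g H" and ?U = "conj_set G g U"
  have HU': "(?H, ?U) \<in> base E" using base_act[OF HU g] by (simp add: conj_pair_def)
  have HG: "a \<in> carrier G" if "a \<in> H" for a using that base_subgroup(3)[OF HU] by blast
  have UG: "U \<subseteq> carrier G" using base_subgroup[OF HU] by blast
  have mem: "g \<otimes>\<^bsub>G\<^esub> a \<otimes>\<^bsub>G\<^esub> inv\<^bsub>G\<^esub> g \<in> ?H" if "a \<in> H" for a
    using that by (auto simp: conj_set_def)
  have mult: "g \<otimes>\<^bsub>G\<^esub> (a \<otimes>\<^bsub>G\<^esub> b) \<otimes>\<^bsub>G\<^esub> inv\<^bsub>G\<^esub> g =
      (g \<otimes>\<^bsub>G\<^esub> a \<otimes>\<^bsub>G\<^esub> inv\<^bsub>G\<^esub> g) \<otimes>\<^bsub>G\<^esub> (g \<otimes>\<^bsub>G\<^esub> b \<otimes>\<^bsub>G\<^esub> inv\<^bsub>G\<^esub> g)" if "a \<in> H" "b \<in> H" for a b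
  proof -
    have "inv\<^bsub>G\<^esub> g \<otimes>\<^bsub>G\<^esub> (g \<otimes>\<^bsub>G\<^esub> (b \<otimes>\<^bsub>G\<^esub> inv\<^bsub>G\<^esub> g)) = b \<otimes>\<^bsub>G\<^esub> inv\<^bsub>G\<^esub> g"
      using g HG[OF that(2)] by (simp flip: m_assoc)
    then show ?thesis using g HG[OF that(1)] HG[OF that(2)] by (simp add: m_assoc)
  qed
  have "con (pi_functor G) g (H, U) (pi_class H U h) =
      the_elem ((\<lambda>Y. ab_class (ext_quot G (?H, ?U)) (conj_set G g Y)) ` pi_class H U h)"
    by (simp add: pi_functor_def conj_pair_def)
  also have "\<dots> = pi_class ?H ?U (g \<otimes>\<^bsub>G\<^esub> h \<otimes>\<^bsub>G\<^esub> inv\<^bsub>G\<^esub> g)"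
  proof (rule pi_map[OF HU comm_group_pi[OF HU']])
    fix a assume a: "a \<in> H"
    show "ab_class (ext_quot G (?H, ?U)) (conj_set G g (U #>\<^bsub>G\<^esub> a)) = pi_class ?H ?U (g \<otimes>\<^bsub>G\<^esub> a \<otimes>\<^bsub>G\<^esub> inv\<^bsub>G\<^esub> g)"
      by (simp add: pi_class_def conj_r_coset[OF g HG[OF a] UG])
    show "pi_class ?H ?U (g \<otimes>\<^bsub>G\<^esub> a \<otimes>\<^bsub>G\<^esub> inv\<^bsub>G\<^esub> g) \<in> carrier (abelianization (ext_quot G (?H, ?U)))"
      by (rule pi_class_closed[OF mem[OF a]])
  next
    fix a b assume ab: "a \<in> H" "b \<in> H"
    show "pi_class ?H ?U (g \<otimes>\<^bsub>G\<^esub> (a \<otimes>\<^bsub>G\<^esub> b) \<otimes>\<^bsub>G\<^esub> inv\<^bsub>G\<^esub> g) =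
        pi_class ?H ?U (g \<otimes>\<^bsub>G\<^esub> a \<otimes>\<^bsub>G\<^esub> inv\<^bsub>G\<^esub> g) \<otimes>\<^bsub>abelianization (ext_quot G (?H, ?U))\<^esub>
        pi_class ?H ?U (g \<otimes>\<^bsub>G\<^esub> b \<otimes>\<^bsub>G\<^esub> inv\<^bsub>G\<^esub> g)"
      unfolding mult[OF ab] by (rule pi_class_mult[OF HU' mem[OF ab(1)] mem[OF ab(2)]])
  qed (rule h)
  finally show ?thesis .
qed

text \<open>Restriction keeps the second component, so the cosets forming \<open>I/U\<close> are
  literally elements of \<open>H/U\<close>. Thus \<open>I/U\<close> is a subgroup of
  \<open>H/U\<close> and the transfer between them is covered by
  \<open>transfer_map_closed\<close>.\<close>

lemma pi_res_closed:
  assumes HU: "(H, U) \<in> base E" and IU: "(I, V) \<in> r_set E (H, U)"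
    and X: "X \<in> carrier (abelianization (ext_quot G (H, U)))"
  shows "res (pi_functor G) (I, V) (H, U) X \<in> carrier (abelianization (ext_quot G (I, V)))"
proof -
  have IV': "(I, V) \<in> base E" using r_set_base[OF HU IU] .
  have [simp]: "V = U" using r_set_snd[OF HU IU] .
  have IH: "I \<subseteq> H" using E_le[OF HU] IU by auto
  interpret A: group "ext_quot G (H, U)" by (rule ext_quot_group[OF HU])
  interpret B: group "ext_quot G (I, U)" using ext_quot_group[OF IV'] by simp
  have sub: "carrier (ext_quot G (I, U)) \<subseteq> carrier (ext_quot G (H, U))"
    using IH by (auto simp: ext_quot_simps)
  have "subgroup (carrier (ext_quot G (I, U))) (ext_quot G (H, U))"
  proof (rule A.subgroupI[OF sub])
    show "carrier (ext_quot G (I, U)) \<noteq> {}" using B.one_closed by blast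
    show m: "x \<otimes>\<^bsub>ext_quot G (H, U)\<^esub> y \<in> carrier (ext_quot G (I, U))"
      if "x \<in> carrier (ext_quot G (I, U))" "y \<in> carrier (ext_quot G (I, U))" for x y
      using B.m_closed[OF that] by (simp add: ext_quot_simps(2))
    fix x assume x: "x \<in> carrier (ext_quot G (I, U))"
    have "inv\<^bsub>ext_quot G (I, U)\<^esub> x \<otimes>\<^bsub>ext_quot G (H, U)\<^esub> x = \<one>\<^bsub>ext_quot G (H, U)\<^esub>"
      using B.l_inv[OF x] by (simp add: ext_quot_simps(2,3))
    then have "inv\<^bsub>ext_quot G (H, U)\<^esub> x = inv\<^bsub>ext_quot G (I, U)\<^esub> x"
      using A.inv_equality x sub B.inv_closed by blast
    then show "inv\<^bsub>ext_quot G (H, U)\<^esub> x \<in> carrier (ext_quot G (I, U))" using x by simp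
  qed
  then show ?thesis
    unfolding pi_functor_def ric_functor.simps
    using transfer_map_closed[OF A.is_group B.is_group _ _ com_t_ext_quot[OF HU] _ X]
      com_t_ext_quot[OF IV'] by (simp add: ext_quot_simps(2))
qed

subsection \<open>The Mackey functor\<close>

lemma M_closed: "closed_system G (conj_set G) (base M) (r_set M)" "closed_system G (conj_set G) (base M) (i_set M)"
  using cover by (simp_all add: mackey_cover_def mackey_system_def subgroup_system_def is_ric_domain_def)

lemma i_set_M_base:
  assumes "H \<in> base M" "I \<in> i_set M H"
  shows "I \<in> base M"
  using M_closed(2) assms unfolding closed_system_def by blast

lemma base_M:
  assumes "(H, U) \<in> base E"
  shows "H \<in> base M" "U \<in> i_set M H" "U \<in> base M"
proof -
  show H: "H \<in> base M"
    using cover base_flat[OF assms] unfolding mackey_cover_def subsystem_def by blast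
  show "U \<in> i_set M H"
    using cover base_flat[OF assms] assms unfolding mackey_cover_def base_Ext[symmetric] by blast
  then show "U \<in> base M" by (rule i_set_M_base[OF H])
qed

lemma i_set_M:
  assumes HU: "(H, U) \<in> base E" and IV: "(I, V) \<in> i_set E (H, U)"
  shows "I \<in> i_set M H" "V \<in> i_set M U"
proof -
  have "I \<in> i_set (flat E) H"
    using HU IV by (force simp: flat_def base_Ext)
  then show "I \<in> i_set M H"
    using cover base_flat[OF HU] unfolding mackey_cover_def subsystem_def by blast
  show "V \<in> i_set M U"
    using cover HU IV unfolding mackey_cover_def by fastforce
qed

lemma C_mackey: "mackey_functor G M C"
  using C_cohomological by (simp add: cohomological_mackey_functor_def)

lemma C_ric: "is_ric_functor G (conj_set G) M C"
  using C_mackey by (simp add: mackey_functor_def)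

lemma C_ab:
  assumes "H \<in> base M"
  shows "comm_group (ob C H)" "topo (ob C H) = discrete_topology (carrier (ob C H))"
  using C_mackey assms by (simp_all add: mackey_functor_def ab_object_def)

lemma C_hom:
  assumes "H \<in> base M"
  shows "I \<in> r_set M H \<Longrightarrow> res C I H \<in> hom (ob C H) (ob C I)"
    and "I \<in> i_set M H \<Longrightarrow> ind C H I \<in> hom (ob C I) (ob C H)"
    and "g \<in> carrier G \<Longrightarrow> con C g H \<in> hom (ob C H) (ob C (conj_set G g H))"
  using C_ric assms by (simp_all add: is_ric_functor_def tab_hom_def)

lemma C_ind_id: "\<lbrakk>H \<in> base M; a \<in> carrier (ob C H)\<rbrakk> \<Longrightarrow> ind C H H a = a"
  using C_ric by (simp add: is_ric_functor_def)

lemma C_ind_ind: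
  "\<lbrakk>H \<in> base M; I \<in> i_set M H; J \<in> i_set M I; a \<in> carrier (ob C J)\<rbrakk>
    \<Longrightarrow> ind C H I (ind C I J a) = ind C H J a"
  using C_ric by (simp add: is_ric_functor_def)

lemma C_con_ind:
  "\<lbrakk>H \<in> base M; I \<in> i_set M H; g \<in> carrier G; a \<in> carrier (ob C I)\<rbrakk>
    \<Longrightarrow> con C g H (ind C H I a) = ind C (conj_set G g H) (conj_set G g I) (con C g I a)"
  using C_ric by (simp add: is_ric_functor_def)

text \<open>In the classical case of multiplicative groups of fields this is the norm group of the
  extension belonging to \<open>U\<close>.\<close>

abbreviation norms :: "'a set \<Rightarrow> 'a set \<Rightarrow> 'c set" where
  "norms H U \<equiv> ind C H U ` carrier (ob C U)"

lemma norms_subgroup: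
  assumes "(H, U) \<in> base E"
  shows "subgroup (norms H U) (ob C H)" "norms H U \<lhd> ob C H"
proof -
  interpret A: comm_group "ob C H" using C_ab base_M[OF assms] by blast
  interpret B: comm_group "ob C U" using C_ab base_M[OF assms] by blast
  interpret group_hom "ob C U" "ob C H" "ind C H U"
    using C_hom(2) base_M[OF assms] by unfold_locales blast
  show "subgroup (norms H U) (ob C H)" by (rule img_is_subgroup)
  then show "norms H U \<lhd> ob C H" by (rule A.subgroup_imp_normal)
qed

lemma H0_obj_simps:
  "carrier (H0_obj C (H, U)) = H0_class C (H, U) ` carrier (ob C H)"
  "one (H0_obj C (H, U)) = norms H U"
  by (simp_all add: H0_obj_def H0_class_def)

lemma H0_group:
  assumes "(H, U) \<in> base E"
  shows "Group.group (H0_obj C (H, U))"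
  unfolding H0_obj_def prod.case by (rule group_top_quot[OF norms_subgroup(2)[OF assms]])

lemma H0_class_hom:
  assumes "(H, U) \<in> base E"
  shows "H0_class C (H, U) \<in> hom (ob C H) (H0_obj C (H, U))"
  unfolding H0_obj_def H0_class_def prod.case by (rule r_coset_hom_top_quot[OF norms_subgroup(2)[OF assms]])

lemma H0_class_eq_one_iff:
  assumes "(H, U) \<in> base E" "c \<in> carrier (ob C H)"
  shows "H0_class C (H, U) c = one (H0_obj C (H, U)) \<longleftrightarrow> c \<in> norms H U"
  unfolding H0_obj_simps H0_class_def prod.case
  by (rule top_quot_r_coset_eq_one_iff[OF norms_subgroup(2)[OF assms(1)] assms(2)])

text \<open>The counterpart of \<open>pi_map\<close>: a homomorphism on \<open>C(H)\<close> that
  kills the norms is constant on their cosets.\<close>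

lemma H0_map:
  assumes HU: "(H, U) \<in> base E" and K: "Group.group K" and f: "f \<in> hom (ob C H) K"
    and ker: "\<And>u. u \<in> carrier (ob C U) \<Longrightarrow> f (ind C H U u) = \<one>\<^bsub>K\<^esub>"
    and c: "c \<in> carrier (ob C H)"
  shows "the_elem (f ` H0_class C (H, U) c) = f c"
proof -
  have "Group.group (ob C H)" using C_ab(1) base_M(1)[OF HU] by (simp add: comm_group_def)
  from hom_image_r_coset[OF this K f norms_subgroup(1)[OF HU] _ c]
  have "f ` (norms H U #>\<^bsub>ob C H\<^esub> c) = {f c}" using ker by blast
  then show ?thesis by (simp add: H0_class_def)
qed

lemma H0_ind:
  assumes HU: "(H, U) \<in> base E" and IV: "(I, V) \<in> i_set E (H, U)" and c: "c \<in> carrier (ob C I)"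
  shows "ind (H0_functor G C) (H, U) (I, V) (H0_class C (I, V) c) = H0_class C (H, U) (ind C H I c)"
proof -
  have IV': "(I, V) \<in> base E" using i_set_base[OF HU IV] .
  have hom: "(\<lambda>c. H0_class C (H, U) (ind C H I c)) \<in> hom (ob C I) (H0_obj C (H, U))"
    using Group.hom_compose[OF C_hom(2)[OF base_M(1)[OF HU] i_set_M(1)[OF HU IV]] H0_class_hom[OF HU]]
    by (simp add: o_def)
  have ker: "H0_class C (H, U) (ind C H I (ind C I V v)) = one (H0_obj C (H, U))"
    if v: "v \<in> carrier (ob C V)" for v
  proof -
    have Uv: "ind C U V v \<in> carrier (ob C U)"
      using hom_in_carrier[OF C_hom(2)[OF base_M(3)[OF HU] i_set_M(2)[OF HU IV]] v] .
    \<comment> \<open>The induction from \<open>V\<close> to \<open>H\<close> is factored through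
      \<open>I\<close> and then through \<open>U\<close>. The second factorization rests on the
      condition \<open>V \<in> i_set M U\<close> of a Mackey cover.\<close>
    have "ind C H I (ind C I V v) = ind C H V v"
      using C_ind_ind base_M[OF HU] base_M[OF IV'] i_set_M[OF HU IV] v by blast
    also have "\<dots> = ind C H U (ind C U V v)"
      using C_ind_ind base_M[OF HU] base_M[OF IV'] i_set_M[OF HU IV] v by metis
    finally have "ind C H I (ind C I V v) \<in> norms H U" using Uv by simp
    moreover have "norms H U \<subseteq> carrier (ob C H)"
      using subgroup.subset[OF norms_subgroup(1)[OF HU]] .
    ultimately show ?thesis using H0_class_eq_one_iff[OF HU] by blast
  qed
  show ?thesis
    unfolding H0_functor_def ric_functor.simps fst_conv
    by (rule H0_map[OF IV' H0_group[OF HU] hom ker c])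
qed

lemma H0_con:
  assumes HU: "(H, U) \<in> base E" and g: "g \<in> carrier G" and c: "c \<in> carrier (ob C H)"
  shows "con (H0_functor G C) g (H, U) (H0_class C (H, U) c) =
    H0_class C (conj_set G g H, conj_set G g U) (con C g H c)"
proof -
  let ?H = "conj_set G g H" and ?U = "conj_set G g U"
  have HU': "(?H, ?U) \<in> base E" using base_act[OF HU g] by (simp add: conj_pair_def)
  have hom: "(\<lambda>c. H0_class C (?H, ?U) (con C g H c)) \<in> hom (ob C H) (H0_obj C (?H, ?U))"
    using Group.hom_compose[OF C_hom(3)[OF base_M(1)[OF HU] g] H0_class_hom[OF HU']] by (simp add: o_def)
  have ker: "H0_class C (?H, ?U) (con C g H (ind C H U u)) = one (H0_obj C (?H, ?U))"
    if u: "u \<in> carrier (ob C U)" for u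
  proof -
    have "con C g H (ind C H U u) = ind C ?H ?U (con C g U u)"
      using C_con_ind[OF base_M(1,2)[OF HU] g u] .
    moreover have "con C g U u \<in> carrier (ob C ?U)"
      using hom_in_carrier[OF C_hom(3)[OF base_M(3)[OF HU] g] u] .
    ultimately have "con C g H (ind C H U u) \<in> norms ?H ?U" by simp
    moreover have "norms ?H ?U \<subseteq> carrier (ob C ?H)"
      using subgroup.subset[OF norms_subgroup(1)[OF HU']] .
    ultimately show ?thesis using H0_class_eq_one_iff[OF HU'] by blast
  qed
  show ?thesis
    unfolding H0_functor_def ric_functor.simps fst_conv conj_pair_def prod.case
    by (rule H0_map[OF HU H0_group[OF HU'] hom ker c])
qed

subsection \<open>The graph of a prime morphism\<close>

lemma rho_morphism: "ric_morphism G (conj_pair G) E (pi_functor G) (H0_functor G C) \<rho>"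
  using rho_prime by (simp add: prime_morphism_def)

lemma pi_ob [simp]: "ob (pi_functor G) x = abelianization (ext_quot G x)"
  by (simp add: pi_functor_def)

lemma H0_ob [simp]: "ob (H0_functor G C) x = H0_obj C x"
  by (simp add: H0_functor_def)

lemma rho_hom:
  assumes "(H, U) \<in> base E"
  shows "\<rho> (H, U) \<in> hom (abelianization (ext_quot G (H, U))) (H0_obj C (H, U))"
  using rho_morphism assms by (simp add: ric_morphism_def tab_hom_def)

text \<open>The graph of \<open>\<rho>\<close>, lifted to representatives in \<open>H\<close> and \<open>C(H)\<close>.\<close>

definition rho_rel :: "'a set \<Rightarrow> 'a set \<Rightarrow> 'a \<Rightarrow> 'c \<Rightarrow> bool" where
  "rho_rel H U h c \<longleftrightarrow> h \<in> H \<and> c \<in> carrier (ob C H) \<and> \<rho> (H, U) (pi_class H U h) = H0_class C (H, U) c"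

lemma rho_rel_total:
  assumes HU: "(H, U) \<in> base E" and h: "h \<in> H"
  obtains c where "rho_rel H U h c"
proof -
  have "\<rho> (H, U) (pi_class H U h) \<in> H0_class C (H, U) ` carrier (ob C H)"
    using hom_in_carrier[OF rho_hom[OF HU] pi_class_closed[OF h]] unfolding H0_obj_simps .
  then show ?thesis using that h unfolding rho_rel_def by blast
qed

lemma rho_rel_mult:
  assumes HU: "(H, U) \<in> base E" and "rho_rel H U h c" "rho_rel H U h' c'"
  shows "rho_rel H U (h \<otimes>\<^bsub>G\<^esub> h') (c \<otimes>\<^bsub>ob C H\<^esub> c')"
proof -
  interpret A: comm_group "ob C H" by (rule C_ab(1)[OF base_M(1)[OF HU]])
  show ?thesis
    using assms(2,3) subgroup.m_closed[OF baseD(1)[OF HU]] pi_class_mult[OF HU, of h h']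
      hom_mult[OF rho_hom[OF HU] pi_class_closed pi_class_closed, of h h'] hom_mult[OF H0_class_hom[OF HU], of c c']
    unfolding rho_rel_def by simp
qed

lemma pi_class_one_iff:
  assumes HU: "(H, U) \<in> base E" and h: "h \<in> H"
  shows "pi_class H U h = one (abelianization (ext_quot G (H, U))) \<longleftrightarrow> U #>\<^bsub>G\<^esub> h \<in> com_t (ext_quot G (H, U))"
  unfolding pi_class_def using h
  by (intro ab_class_eq_one_iff[OF ext_quot_group[OF HU] com_t_ext_quot[OF HU]]) (simp add: ext_quot_simps)

text \<open>An element of \<open>U\<close> has trivial class in the abelianization of
  \<open>H/U\<close>, so the relation says that the class of \<open>c\<close> is trivial. This
  translates membership in a norm subgroup into a statement about the graph of
  \<open>\<rho>\<close>.\<close>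

lemma rho_rel_one_iff:
  assumes HU: "(H, U) \<in> base E" and u: "u \<in> U"
  shows "rho_rel H U u c \<longleftrightarrow> c \<in> norms H U"
proof -
  have uH: "u \<in> H" using u base_subgroup(2)[OF HU] by blast
  have uG: "u \<in> carrier G" using uH base_subgroup(3)[OF HU] by blast
  interpret Q: group "ext_quot G (H, U)" by (rule ext_quot_group[OF HU])
  interpret P: comm_group "abelianization (ext_quot G (H, U))" by (rule comm_group_pi[OF HU])
  interpret H0: group "H0_obj C (H, U)" by (rule H0_group[OF HU])
  have "one (ext_quot G (H, U)) \<in> com_t (ext_quot G (H, U))"
    unfolding com_t_ext_quot[OF HU] using subgroup.one_closed[OF Q.derived_is_subgroup[OF order_refl]] .
  then have "pi_class H U u = one (abelianization (ext_quot G (H, U)))"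
    using pi_class_one_iff[OF HU uH] coset_join2[OF uG base_subgroup(1)[OF HU] u] by (simp add: ext_quot_simps)
  then have "\<rho> (H, U) (pi_class H U u) = one (H0_obj C (H, U))"
    using hom_one[OF rho_hom[OF HU] P.is_group H0.is_group] by simp
  then show ?thesis
    unfolding rho_rel_def
    using uH H0_class_eq_one_iff[OF HU, of c] subsetD[OF subgroup.subset[OF norms_subgroup(1)[OF HU]], of c]
    by fastforce
qed

lemma rho_rel_carrier:
  assumes "rho_rel H U h c"
  shows "h \<in> H" "c \<in> carrier (ob C H)"
  using assms by (simp_all add: rho_rel_def)

text \<open>If \<open>inv h\<close> is related to \<open>d\<close>, then \<open>c\<close> times
  \<open>d\<close> is a norm, since it is related to \<open>\<one>\<close>. Hence \<open>d\<close>
  may be changed by a norm to the inverse of \<open>c\<close>.\<close>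

lemma rho_rel_inv:
  assumes HU: "(H, U) \<in> base E" and r: "rho_rel H U h c"
  shows "rho_rel H U (inv\<^bsub>G\<^esub> h) (inv\<^bsub>ob C H\<^esub> c)"
proof -
  interpret A: comm_group "ob C H" by (rule C_ab(1)[OF base_M(1)[OF HU]])
  have h: "h \<in> H" "h \<in> carrier G" "inv\<^bsub>G\<^esub> h \<in> H"
    using rho_rel_carrier[OF r] base_subgroup(3)[OF HU] subgroup.m_inv_closed[OF baseD(1)[OF HU]] by blast+
  have one: "\<one>\<^bsub>G\<^esub> \<in> U" by (rule subgroup.one_closed[OF base_subgroup(1)[OF HU]])
  obtain d where d: "rho_rel H U (inv\<^bsub>G\<^esub> h) d" using rho_rel_total[OF HU h(3)] .
  have dA: "d \<in> carrier (ob C H)" "c \<in> carrier (ob C H)" using rho_rel_carrier d r by blast+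
  have "rho_rel H U \<one>\<^bsub>G\<^esub> (c \<otimes>\<^bsub>ob C H\<^esub> d)" using rho_rel_mult[OF HU r d] h by simp
  then have "c \<otimes>\<^bsub>ob C H\<^esub> d \<in> norms H U" using rho_rel_one_iff[OF HU one] by blast
  then have "inv\<^bsub>ob C H\<^esub> (c \<otimes>\<^bsub>ob C H\<^esub> d) \<in> norms H U"
    by (rule subgroup.m_inv_closed[OF norms_subgroup(1)[OF HU]])
  then have "rho_rel H U \<one>\<^bsub>G\<^esub> (inv\<^bsub>ob C H\<^esub> (c \<otimes>\<^bsub>ob C H\<^esub> d))" using rho_rel_one_iff[OF HU one] by blast
  from rho_rel_mult[OF HU d this]
  have "rho_rel H U (inv\<^bsub>G\<^esub> h) (d \<otimes>\<^bsub>ob C H\<^esub> (inv\<^bsub>ob C H\<^esub> (c \<otimes>\<^bsub>ob C H\<^esub> d)))" using h by simp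
  moreover have "d \<otimes>\<^bsub>ob C H\<^esub> (inv\<^bsub>ob C H\<^esub> (c \<otimes>\<^bsub>ob C H\<^esub> d)) = inv\<^bsub>ob C H\<^esub> c"
    using dA A.m_lcomm[of d "inv\<^bsub>ob C H\<^esub> c" "inv\<^bsub>ob C H\<^esub> d"] by (simp add: A.inv_mult)
  ultimately show ?thesis by simp
qed

text \<open>For \<open>I = H\<close> the map \<open>ind C H I\<close> is the identity, and the lemma
  passes from \<open>(H, V)\<close> to \<open>(H, U)\<close> with unchanged \<open>h\<close> and
  \<open>c\<close>; most applications below are of this kind or have \<open>V = U\<close>.\<close>

lemma rho_rel_ind:
  assumes HU: "(H, U) \<in> base E" and IV: "(I, V) \<in> i_set E (H, U)" and r: "rho_rel I V h c"
  shows "rho_rel H U h (ind C H I c)"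
proof -
  have IV': "(I, V) \<in> base E" using i_set_base[OF HU IV] .
  have "\<rho> (H, U) (ind (pi_functor G) (H, U) (I, V) (pi_class I V h)) =
      ind (H0_functor G C) (H, U) (I, V) (\<rho> (I, V) (pi_class I V h))"
    using rho_morphism HU IV pi_class_closed[OF rho_rel_carrier(1)[OF r], of V]
    by (simp add: ric_morphism_def)
  moreover have "ind C H I c \<in> carrier (ob C H)"
    using hom_in_carrier[OF C_hom(2)[OF base_M(1)[OF HU] i_set_M(1)[OF HU IV]] rho_rel_carrier(2)[OF r]] .
  ultimately show ?thesis
    using r E_le[OF HU, of I V] IV pi_ind[OF HU IV, of h] H0_ind[OF HU IV, of c]
    unfolding rho_rel_def by auto
qed

lemma rho_rel_con:
  assumes HU: "(H, U) \<in> base E" and g: "g \<in> carrier G" and r: "rho_rel H U h c"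
  shows "rho_rel (conj_set G g H) (conj_set G g U) (g \<otimes>\<^bsub>G\<^esub> h \<otimes>\<^bsub>G\<^esub> inv\<^bsub>G\<^esub> g) (con C g H c)"
proof -
  have "\<rho> (conj_pair G g (H, U)) (con (pi_functor G) g (H, U) (pi_class H U h)) =
      con (H0_functor G C) g (H, U) (\<rho> (H, U) (pi_class H U h))"
    using rho_morphism HU g pi_class_closed[OF rho_rel_carrier(1)[OF r], of U]
    by (simp add: ric_morphism_def)
  moreover have "con C g H c \<in> carrier (ob C (conj_set G g H))"
    using hom_in_carrier[OF C_hom(3)[OF base_M(1)[OF HU] g] rho_rel_carrier(2)[OF r]] .
  moreover have "g \<otimes>\<^bsub>G\<^esub> h \<otimes>\<^bsub>G\<^esub> inv\<^bsub>G\<^esub> g \<in> conj_set G g H"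
    using rho_rel_carrier(1)[OF r] by (simp add: conj_set_def)
  ultimately show ?thesis
    using r pi_con[OF HU g, of h] H0_con[OF HU g, of c]
    unfolding rho_rel_def by (simp add: conj_pair_def)
qed

end

section \<open>Commutators and conjugation for normal subgroups\<close>

lemma (in normal) comm_group_Mod:
  assumes "\<And>a b. \<lbrakk>a \<in> carrier G; b \<in> carrier G\<rbrakk> \<Longrightarrow> a \<otimes> b \<otimes> inv a \<otimes> inv b \<in> H"
  shows "comm_group (G Mod H)"
proof (rule group.group_comm_groupI[OF factorgroup_is_group])
  fix X Y assume "X \<in> carrier (G Mod H)" "Y \<in> carrier (G Mod H)"
  then obtain a b where a: "a \<in> carrier G" "X = H #> a" and b: "b \<in> carrier G" "Y = H #> b"
    by (auto simp: carrier_FactGroup)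
  have "inv a \<otimes> (inv b \<otimes> (b \<otimes> a)) = \<one>"
    using a(1) b(1) by (simp add: m_assoc[symmetric])
  then have "a \<otimes> b = (a \<otimes> b \<otimes> inv a \<otimes> inv b) \<otimes> (b \<otimes> a)"
    using a(1) b(1) by (simp add: m_assoc)
  then have "a \<otimes> b \<in> H #> (b \<otimes> a)"
    using assms[OF a(1) b(1)] unfolding r_coset_def by blast
  then have "H #> (b \<otimes> a) = H #> (a \<otimes> b)"
    using repr_independence[of "a \<otimes> b" H "b \<otimes> a"] a(1) b(1) is_subgroup by simp
  then show "X \<otimes>\<^bsub>G Mod H\<^esub> Y = Y \<otimes>\<^bsub>G Mod H\<^esub> X"
    using a b by (simp add: rcos_sum)
qed

lemma (in group) conj_set_normal:
  assumes H: "subgroup H G" and N: "N \<lhd> G\<lparr>carrier := H\<rparr>" and h: "h \<in> H"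
  shows "conj_set G h N = N"
proof -
  have NH: "N \<subseteq> H" using subgroup.subset[OF normal_imp_subgroup[OF N]] by simp
  have sub: "x \<otimes> n \<otimes> inv x \<in> N" if "x \<in> H" "n \<in> N" for x n
    using normal.inv_op_closed2[OF N, of x n] that m_inv_consistent[OF H, of x] by simp
  show ?thesis
  proof
    show "conj_set G h N \<subseteq> N" using sub[OF h] by (auto simp: conj_set_def)
    show "N \<subseteq> conj_set G h N"
    proof
      fix n assume n: "n \<in> N"
      have hG: "h \<in> carrier G" and nG: "n \<in> carrier G"
        using h n NH subgroup.subset[OF H] by blast+
      have "h \<otimes> (inv h \<otimes> n \<otimes> h) \<otimes> inv h = n"
      proof -
        have "h \<otimes> (inv h \<otimes> (n \<otimes> (h \<otimes> inv h))) = n"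
          using hG nG by (simp add: m_assoc[symmetric])
        then show ?thesis using hG nG by (simp add: m_assoc)
      qed
      moreover have "inv h \<otimes> n \<otimes> h \<in> N"
        using sub[OF subgroup.m_inv_closed[OF H h] n] hG by simp
      ultimately show "n \<in> conj_set G h N" unfolding conj_set_def by (metis image_eqI)
    qed
  qed
qed

section \<open>Surjectivity of \<open>\<rho>\<close>\<close>

context class_field_data
begin

text \<open>Every class in \<open>H0_obj C (H, U)\<close> has a representative in
  \<open>C(H)\<close>, so this expresses surjectivity of \<open>\<rho> (H, U)\<close> without
  mentioning cosets.\<close>

definition surjective :: "'a set \<Rightarrow> 'a set \<Rightarrow> bool" where
  "surjective H U \<longleftrightarrow> (\<forall>c\<in>carrier (ob C H). \<exists>h. rho_rel H U h c)"

lemma order_ext_quot: "order (ext_quot G (H, U)) = card (rcosets\<^bsub>G\<lparr>carrier := H\<rparr>\<^esub> U)"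
proof -
  have "rcosets\<^bsub>G\<lparr>carrier := H\<rparr>\<^esub> U = (\<lambda>h. U #>\<^bsub>G\<^esub> h) ` H"
    by (auto simp: RCOSETS_def)
  then show ?thesis by (simp add: order_def ext_quot_simps)
qed

lemma cyclic_prime_quotI:
  assumes "(H, U) \<in> base E" "prime (card (rcosets\<^bsub>G\<lparr>carrier := H\<rparr>\<^esub> U))"
  shows "cyclic_prime_quot G H U (card (rcosets\<^bsub>G\<lparr>carrier := H\<rparr>\<^esub> U))"
  using assms group.prime_order_imp_cyclic[OF ext_quot_group[OF assms(1)]]
  by (simp add: cyclic_prime_quot_def order_ext_quot)

lemma rho_prime_iso:
  assumes HU: "(H, U) \<in> base E" and p: "prime (card (rcosets\<^bsub>G\<lparr>carrier := H\<rparr>\<^esub> U))"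
  shows "\<rho> (H, U) \<in> iso (abelianization (ext_quot G (H, U))) (H0_obj C (H, U))"
proof -
  have "tab_iso (abelianization (ext_quot G (H, U))) (H0_obj C (H, U)) (\<rho> (H, U))"
    using rho_prime HU cyclic_prime_quotI[OF HU p] unfolding prime_morphism_def
    by (auto simp: prod.case_eq_if)
  then show ?thesis
    unfolding tab_iso_def using group_isomorphisms_imp_iso by blast
qed

lemma rho_rel_one_imp_pi_class_one:
  assumes HU: "(H, U) \<in> base E" and inj: "inj_on (\<rho> (H, U)) (carrier (abelianization (ext_quot G (H, U))))"
    and r: "rho_rel H U h \<one>\<^bsub>ob C H\<^esub>"
  shows "pi_class H U h = \<one>\<^bsub>abelianization (ext_quot G (H, U))\<^esub>"
proof -
  interpret P: comm_group "abelianization (ext_quot G (H, U))" by (rule comm_group_pi[OF HU])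
  interpret H0: group "H0_obj C (H, U)" by (rule H0_group[OF HU])
  interpret A: comm_group "ob C H" by (rule C_ab(1)[OF base_M(1)[OF HU]])
  have "\<rho> (H, U) (pi_class H U h) = \<one>\<^bsub>H0_obj C (H, U)\<^esub>"
    using r hom_one[OF H0_class_hom[OF HU] A.is_group H0.is_group] by (simp add: rho_rel_def)
  also have "\<dots> = \<rho> (H, U) \<one>\<^bsub>abelianization (ext_quot G (H, U))\<^esub>"
    using hom_one[OF rho_hom[OF HU] P.is_group H0.is_group] by simp
  finally show ?thesis
    using inj_onD[OF inj] pi_class_closed[OF rho_rel_carrier(1)[OF r]] by blast
qed

text \<open>For abelian \<open>H/U\<close> the commutator subgroup is \<open>{U}\<close>, so a
  trivial class means that the coset of \<open>h\<close> is \<open>U\<close>.\<close>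

lemma pi_class_one_imp_mem:
  assumes HU: "(H, U) \<in> base E" and comm: "comm_group (ext_quot G (H, U))" and h: "h \<in> H"
    and pi_class: "pi_class H U h = \<one>\<^bsub>abelianization (ext_quot G (H, U))\<^esub>"
  shows "h \<in> U"
proof -
  have "com_t (ext_quot G (H, U)) = {U}"
    using comm_group.derived_eq_singleton[OF comm order_refl] com_t_ext_quot[OF HU]
    by (simp add: ext_quot_simps)
  then have "U #>\<^bsub>G\<^esub> h = U" using pi_class pi_class_one_iff[OF HU h] by simp
  then show ?thesis using rcos_self[OF _ base_subgroup(1)[OF HU], of h] h base_subgroup(3)[OF HU] by blast
qed

lemma prime_surjective:
  assumes HU: "(H, U) \<in> base E" and p: "prime (card (rcosets\<^bsub>G\<lparr>carrier := H\<rparr>\<^esub> U))"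
  shows "surjective H U"
  unfolding surjective_def
proof
  fix c assume c: "c \<in> carrier (ob C H)"
  have "H0_class C (H, U) c \<in> \<rho> (H, U) ` carrier (abelianization (ext_quot G (H, U)))"
    using rho_prime_iso[OF HU p] c by (simp add: iso_def bij_betw_def H0_obj_simps)
  then obtain h where "h \<in> H" "H0_class C (H, U) c = \<rho> (H, U) (pi_class H U h)"
    unfolding pi_carrier by blast
  then show "\<exists>h. rho_rel H U h c" using c unfolding rho_rel_def by metis
qed

lemma prime_injective:
  assumes HU: "(H, U) \<in> base E" and p: "prime (card (rcosets\<^bsub>G\<lparr>carrier := H\<rparr>\<^esub> U))"
    and r: "rho_rel H U h \<one>\<^bsub>ob C H\<^esub>"
  shows "h \<in> U"
proof -
  have "comm_group (ext_quot G (H, U))"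
    using cyclic_prime_quotI[OF HU p] ext_quot_group[OF HU]
    by (auto simp: cyclic_prime_quot_def intro: group.cyclic_imp_abelian_group)
  moreover have "inj_on (\<rho> (H, U)) (carrier (abelianization (ext_quot G (H, U))))"
    using rho_prime_iso[OF HU p] by (simp add: iso_def bij_betw_def)
  ultimately show ?thesis
    using pi_class_one_imp_mem[OF HU _ rho_rel_carrier(1)[OF r]] rho_rel_one_imp_pi_class_one[OF HU _ r] by blast
qed

text \<open>The degree -1 half of the class field axiom: the augmentation subgroup has only one
  coset in the kernel of \<open>ind C H U\<close>, and \<open>d\<close> lies in its own
  coset.\<close>

lemma prime_kernel_ind:
  assumes HU: "(H, U) \<in> base E" and p: "prime (card (rcosets\<^bsub>G\<lparr>carrier := H\<rparr>\<^esub> U))"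
    and d: "d \<in> carrier (ob C U)" "ind C H U d = \<one>\<^bsub>ob C H\<^esub>"
  shows "d \<in> augmentation_subgroup C H U"
proof -
  interpret B: comm_group "ob C U" by (rule C_ab(1)[OF base_M(3)[OF HU]])
  let ?I = "augmentation_subgroup C H U" and ?K = "kernel (ob C U) (ob C H) (ind C H U)"
  have "trivial_group (H_minus_1 C H U)"
    using class_field_axiom_prime[OF HU cyclic_prime_quotI[OF HU p]] by (simp add: class_field_axiom_def)
  then have "carrier (H_minus_1 C H U) = {\<one>\<^bsub>H_minus_1 C H U\<^esub>}" by (simp add: trivial_group_def)
  then have "(\<lambda>x. ?I #>\<^bsub>ob C U\<^esub> x) ` ?K = {?I}" by (simp add: H_minus_1_def)
  moreover have "d \<in> ?K" using d by (simp add: kernel_def)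
  ultimately have eq: "?I #>\<^bsub>ob C U\<^esub> d = ?I" by blast
  have "\<one>\<^bsub>ob C U\<^esub> \<in> ?I" unfolding augmentation_subgroup_def by (rule generate.one)
  then have "\<one>\<^bsub>ob C U\<^esub> \<otimes>\<^bsub>ob C U\<^esub> d \<in> ?I #>\<^bsub>ob C U\<^esub> d" unfolding r_coset_def by blast
  then show ?thesis using eq d by simp
qed

text \<open>A diagram chase. Choose \<open>h\<close> related to \<open>c\<close> at
  \<open>(H, V)\<close>, and \<open>c0\<close> related to \<open>h\<close> at \<open>(H, U)\<close>.
  Then \<open>c\<close> and \<open>c0\<close> differ by the image of some \<open>d\<close> in
  \<open>C(V)\<close>. If \<open>v\<close> is related to \<open>d\<close> at \<open>(V, U)\<close>,
  the product of \<open>v\<close> and \<open>h\<close> is related to \<open>c\<close> at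
  \<open>(H, U)\<close>.\<close>

lemma surjective_extension:
  assumes HU: "(H, U) \<in> base E" and V: "V \<lhd> G\<lparr>carrier := H\<rparr>" "U \<subseteq> V"
    and VU: "surjective V U" and HV: "surjective H V"
  shows "surjective H U"
  unfolding surjective_def
proof
  fix c assume c: "c \<in> carrier (ob C H)"
  interpret A: comm_group "ob C H" by (rule C_ab(1)[OF base_M(1)[OF HU]])
  note co = coherent_normal[OF HU V]
  have one: "\<one>\<^bsub>G\<^esub> \<in> V" by (rule subgroup.one_closed[OF base_subgroup(1)[OF co(1)]])
  obtain h where h: "rho_rel H V h c" using HV c unfolding surjective_def by blast
  obtain c0 where c0: "rho_rel H U h c0" using rho_rel_total[OF HU rho_rel_carrier(1)[OF h]] .
  have c0H: "c0 \<in> carrier (ob C H)" by (rule rho_rel_carrier(2)[OF c0])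
  have hG: "h \<in> carrier G" using rho_rel_carrier(1)[OF h] base_subgroup(3)[OF HU] by blast
  have "rho_rel H V h c0" using rho_rel_ind[OF co(1) co(4) c0] C_ind_id[OF base_M(1)[OF HU] c0H] by simp
  from rho_rel_mult[OF co(1) h rho_rel_inv[OF co(1) this]]
  have "rho_rel H V \<one>\<^bsub>G\<^esub> (c \<otimes>\<^bsub>ob C H\<^esub> inv\<^bsub>ob C H\<^esub> c0)" using hG by simp
  then have "c \<otimes>\<^bsub>ob C H\<^esub> inv\<^bsub>ob C H\<^esub> c0 \<in> norms H V" using rho_rel_one_iff[OF co(1) one] by blast
  then obtain d where d: "d \<in> carrier (ob C V)" "c \<otimes>\<^bsub>ob C H\<^esub> inv\<^bsub>ob C H\<^esub> c0 = ind C H V d" by blast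
  obtain v where "rho_rel V U v d" using VU d(1) unfolding surjective_def by blast
  then have "rho_rel H U v (c \<otimes>\<^bsub>ob C H\<^esub> inv\<^bsub>ob C H\<^esub> c0)" using rho_rel_ind[OF HU co(3)] d(2) by simp
  from rho_rel_mult[OF HU this c0] have "rho_rel H U (v \<otimes>\<^bsub>G\<^esub> h) c"
    using c c0H by (simp add: A.m_assoc)
  then show "\<exists>h. rho_rel H U h c" by blast
qed

text \<open>The element \<open>res C I H c\<close> is hit at \<open>(I, U)\<close>, and inducing it
  up to \<open>H\<close> gives the power of \<open>c\<close>, because \<open>C\<close> is
  cohomological. As \<open>I\<close> is open in \<open>H\<close>, arithmeticity of \<open>M\<close>
  provides both maps.\<close>

lemma image_power_index:
  assumes HU: "(H, U) \<in> base E" and I: "subgroup I (G\<lparr>carrier := H\<rparr>)" "U \<subseteq> I"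
    and fin: "finite (rcosets\<^bsub>G\<lparr>carrier := H\<rparr>\<^esub> I)" and IU: "surjective I U"
    and c: "c \<in> carrier (ob C H)"
  shows "\<exists>h. rho_rel H U h (c [^]\<^bsub>ob C H\<^esub> card (rcosets\<^bsub>G\<lparr>carrier := H\<rparr>\<^esub> I))"
proof -
  note co = coherent_subgroup[OF HU I]
  note H = base_M(1)[OF HU]
  have I': "I \<in> r_set M H" "I \<in> i_set M H"
    using arithmetic H I(1) co(3) unfolding arithmetic_system_def by (simp_all add: group_top_subgroup_iff)
  have "ind C H I (res C I H c) = c [^]\<^bsub>ob C H\<^esub> index G H I"
    using C_cohomological H I' fin c by (simp add: cohomological_mackey_functor_def finite_index_def)
  moreover have "res C I H c \<in> carrier (ob C I)"
    using hom_in_carrier[OF C_hom(1)[OF H I'(1)] c] .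
  then obtain i where "rho_rel I U i (res C I H c)" using IU unfolding surjective_def by blast
  ultimately show ?thesis
    using rho_rel_ind[OF HU co(2)] unfolding index_def by metis
qed

text \<open>Since \<open>ind C H H\<close> is the identity, all of \<open>C(H)\<close> consists of
  norms. This is the start of the induction.\<close>

lemma surjective_refl:
  assumes HU: "(H, H) \<in> base E"
  shows "surjective H H"
  unfolding surjective_def
proof
  fix c assume c: "c \<in> carrier (ob C H)"
  have "c \<in> norms H H" using C_ind_id[OF base_M(1)[OF HU] c] c by (metis image_eqI)
  then show "\<exists>h. rho_rel H H h c"
    using rho_rel_one_iff[OF HU subgroup.one_closed[OF baseD(1)[OF HU]]] by blast
qed

lemma index_one_imp_eq:
  assumes HU: "(H, U) \<in> base E" and one: "card (rcosets\<^bsub>G\<lparr>carrier := H\<rparr>\<^esub> U) = 1"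
  shows "H = U"
proof
  show "U \<subseteq> H" by (rule base_subgroup(2)[OF HU])
  show "H \<subseteq> U"
  proof
    fix h assume h: "h \<in> H"
    have hG: "h \<in> carrier G" using h base_subgroup(3)[OF HU] by blast
    have "U #>\<^bsub>G\<^esub> h \<in> rcosets\<^bsub>G\<lparr>carrier := H\<rparr>\<^esub> U" "U #>\<^bsub>G\<^esub> \<one>\<^bsub>G\<^esub> \<in> rcosets\<^bsub>G\<lparr>carrier := H\<rparr>\<^esub> U"
      using h subgroup.one_closed[OF baseD(1)[OF HU]] by (auto simp: RCOSETS_def)
    then have "U #>\<^bsub>G\<^esub> h = U #>\<^bsub>G\<^esub> \<one>\<^bsub>G\<^esub>" using one by (metis card_1_singletonE singletonD)
    also have "\<dots> = U" using base_subgroup(2,3)[OF HU] by simp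
    finally show "h \<in> U" using rcos_self[OF hG base_subgroup(1)[OF HU]] by simp
  qed
qed

lemma image_subgroup:
  assumes HU: "(H, U) \<in> base E"
  shows "subgroup {c. \<exists>h. rho_rel H U h c} (ob C H)"
proof -
  interpret A: comm_group "ob C H" by (rule C_ab(1)[OF base_M(1)[OF HU]])
  show ?thesis
  proof (rule A.subgroupI)
    show "{c. \<exists>h. rho_rel H U h c} \<subseteq> carrier (ob C H)" using rho_rel_carrier by blast
    show "{c. \<exists>h. rho_rel H U h c} \<noteq> {}"
      using rho_rel_total[OF HU subgroup.one_closed[OF baseD(1)[OF HU]]] by blast
  qed (use rho_rel_inv[OF HU] rho_rel_mult[OF HU] in blast)+
qed

lemma surjective_base:
  assumes "(H, U) \<in> base E"
  shows "surjective H U"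
  using assms
proof (induction "card (rcosets\<^bsub>G\<lparr>carrier := H\<rparr>\<^esub> U)" arbitrary: H U rule: less_induct)
  case less
  note HU = less.prems
  interpret N: normal U "G\<lparr>carrier := H\<rparr>" by (rule baseD(3)[OF HU])
  show ?case
  proof (cases "card (rcosets\<^bsub>G\<lparr>carrier := H\<rparr>\<^esub> U) = 1")
    case True
    then show ?thesis using index_one_imp_eq[OF HU] HU surjective_refl by simp
  next
    case ne: False
    show ?thesis
    proof (cases "\<exists>V. V \<lhd> G\<lparr>carrier := H\<rparr> \<and> U \<subseteq> V \<and> prime (card (rcosets\<^bsub>G\<lparr>carrier := H\<rparr>\<^esub> V)) \<and>
        card (rcosets\<^bsub>G\<lparr>carrier := V\<rparr>\<^esub> U) < card (rcosets\<^bsub>G\<lparr>carrier := H\<rparr>\<^esub> U)")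
      case True
      then obtain V where V: "V \<lhd> G\<lparr>carrier := H\<rparr>" "U \<subseteq> V"
        "prime (card (rcosets\<^bsub>G\<lparr>carrier := H\<rparr>\<^esub> V))"
        "card (rcosets\<^bsub>G\<lparr>carrier := V\<rparr>\<^esub> U) < card (rcosets\<^bsub>G\<lparr>carrier := H\<rparr>\<^esub> U)" by blast
      note co = coherent_normal[OF HU V(1,2)]
      show ?thesis
        by (rule surjective_extension[OF HU V(1,2) less.hyps[OF V(4) co(2)] prime_surjective[OF co(1) V(3)]])
    next
      case False
      show ?thesis
        unfolding surjective_def
      proof
        fix c assume c: "c \<in> carrier (ob C H)"
        interpret A: comm_group "ob C H" by (rule C_ab(1)[OF base_M(1)[OF HU]])
        \<comment> \<open>\<open>K\<close> represents the image of \<open>\<rho> (H, U)\<close>. It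
          remains to exclude every prime divisor of the order of \<open>c\<close> in the
          cokernel.\<close>
        define K where "K = {c. \<exists>h. rho_rel H U h c}"
        have K: "subgroup K (ob C H)" unfolding K_def by (rule image_subgroup[OF HU])
        interpret K: normal K "ob C H" using A.subgroup_imp_normal[OF K] .
        interpret Q: group "ob C H Mod K" by (rule K.factorgroup_is_group)
        let ?x = "K #>\<^bsub>ob C H\<^esub> c"
        have x: "?x \<in> carrier (ob C H Mod K)" using c by (simp add: carrier_FactGroup)
        have "Q.ord ?x = 1"
        proof (rule ccontr)
          assume "Q.ord ?x \<noteq> 1"
          \<comment> \<open>An element of infinite order has \<open>Q.ord\<close> equal to
            \<open>0\<close>, which is also different from \<open>1\<close> and divisible by a
            prime, so this case is covered.\<close>
          then obtain p where p: "prime p" "p dvd Q.ord ?x" using prime_factor_nat by blast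
          obtain I where I: "subgroup I (G\<lparr>carrier := H\<rparr>)" "U \<subseteq> I"
            "\<not> p dvd card (rcosets\<^bsub>G\<lparr>carrier := H\<rparr>\<^esub> I)"
            "card (rcosets\<^bsub>G\<lparr>carrier := I\<rparr>\<^esub> U) < card (rcosets\<^bsub>G\<lparr>carrier := H\<rparr>\<^esub> U)"
            using N.ex_normal_of_prime_index_or_coprime_index[OF finite_rcosets[OF HU] ne p(1)] False
            by auto
          let ?n = "card (rcosets\<^bsub>G\<lparr>carrier := H\<rparr>\<^esub> I)"
          \<comment> \<open>The cardinality of an infinite set is \<open>0\<close>, which
            \<open>p\<close> would divide.\<close>
          have fin: "finite (rcosets\<^bsub>G\<lparr>carrier := H\<rparr>\<^esub> I)"
            using I(3) by (metis card.infinite dvd_0_right)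
          have "surjective I U" by (rule less.hyps[OF I(4) coherent_subgroup(1)[OF HU I(1,2)]])
          then have mem: "c [^]\<^bsub>ob C H\<^esub> ?n \<in> K"
            using image_power_index[OF HU I(1,2) fin _ c] unfolding K_def by blast
          have "?x [^]\<^bsub>ob C H Mod K\<^esub> ?n = K #>\<^bsub>ob C H\<^esub> (c [^]\<^bsub>ob C H\<^esub> ?n)"
            using K.FactGroup_pow[OF c] by simp
          also have "\<dots> = K"
            using A.coset_join2[OF _ K mem] c by simp
          finally have "Q.ord ?x dvd ?n"
            using Q.pow_eq_id[OF x] by simp
          then show False using p(2) I(3) dvd_trans by blast
        qed
        then have "?x [^]\<^bsub>ob C H Mod K\<^esub> (1::nat) = \<one>\<^bsub>ob C H Mod K\<^esub>"
          using Q.pow_eq_id[OF x, of 1] by simp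
        then have "?x = K" using x Q.nat_pow_eone by simp
        then have "c \<in> K" using A.rcos_self[OF c K] by simp
        then show "\<exists>h. rho_rel H U h c" unfolding K_def by blast
      qed
    qed
  qed
qed

section \<open>Injectivity of \<open>\<rho>\<close>\<close>

text \<open>Stating commutativity of \<open>H/U\<close> by commutators makes it obvious that it
  passes from \<open>H\<close> to smaller groups.\<close>

definition abelian_pair :: "'a set \<Rightarrow> 'a set \<Rightarrow> bool" where
  "abelian_pair H U \<longleftrightarrow> (\<forall>a\<in>H. \<forall>b\<in>H. a \<otimes>\<^bsub>G\<^esub> b \<otimes>\<^bsub>G\<^esub> inv\<^bsub>G\<^esub> a \<otimes>\<^bsub>G\<^esub> inv\<^bsub>G\<^esub> b \<in> U)"

lemma abelian_pair_comm_group: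
  assumes HU: "(H, U) \<in> base E" and ab: "abelian_pair H U"
  shows "comm_group (G\<lparr>carrier := H\<rparr> Mod U)"
proof (rule normal.comm_group_Mod[OF baseD(3)[OF HU]])
  fix a b assume "a \<in> carrier (G\<lparr>carrier := H\<rparr>)" "b \<in> carrier (G\<lparr>carrier := H\<rparr>)"
  then show "a \<otimes>\<^bsub>G\<lparr>carrier := H\<rparr>\<^esub> b \<otimes>\<^bsub>G\<lparr>carrier := H\<rparr>\<^esub> inv\<^bsub>G\<lparr>carrier := H\<rparr>\<^esub> a \<otimes>\<^bsub>G\<lparr>carrier := H\<rparr>\<^esub> inv\<^bsub>G\<lparr>carrier := H\<rparr>\<^esub> b \<in> U"
    using ab m_inv_consistent[OF baseD(1)[OF HU]] by (simp add: abelian_pair_def)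
qed

text \<open>Conjugation by \<open>H\<close> acts trivially on \<open>V/U\<close> and hence, by surjectivity, on
  \<open>C(V)/ind C(U)\<close>.\<close>

lemma augmentation_subset_norms:
  assumes HU: "(H, U) \<in> base E" and V: "V \<lhd> G\<lparr>carrier := H\<rparr>" "U \<subseteq> V" and ab: "abelian_pair H U"
  shows "augmentation_subgroup C H V \<subseteq> norms V U"
proof -
  note co = coherent_normal[OF HU V]
  interpret B: comm_group "ob C V" by (rule C_ab(1)[OF base_M(1)[OF co(2)]])
  have "con C h V x \<otimes>\<^bsub>ob C V\<^esub> inv\<^bsub>ob C V\<^esub> x \<in> norms V U" if h: "h \<in> H" and x: "x \<in> carrier (ob C V)" for h x
  proof -
    have hG: "h \<in> carrier G" using h base_subgroup(3)[OF HU] by blast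
    obtain v where v: "rho_rel V U v x"
      using surjective_base[OF co(2)] x unfolding surjective_def by blast
    have vH: "v \<in> H" using rho_rel_carrier(1)[OF v] base_subgroup(2)[OF co(1)] by blast
    have "rho_rel V U (h \<otimes>\<^bsub>G\<^esub> v \<otimes>\<^bsub>G\<^esub> inv\<^bsub>G\<^esub> h) (con C h V x)"
      using rho_rel_con[OF co(2) hG v] conj_set_normal[OF baseD(1)[OF HU] V(1) h]
        conj_set_normal[OF baseD(1)[OF HU] baseD(3)[OF HU] h] by simp
    from rho_rel_mult[OF co(2) this rho_rel_inv[OF co(2) v]]
    have "rho_rel V U (h \<otimes>\<^bsub>G\<^esub> v \<otimes>\<^bsub>G\<^esub> inv\<^bsub>G\<^esub> h \<otimes>\<^bsub>G\<^esub> inv\<^bsub>G\<^esub> v) (con C h V x \<otimes>\<^bsub>ob C V\<^esub> inv\<^bsub>ob C V\<^esub> x)" .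
    moreover have "h \<otimes>\<^bsub>G\<^esub> v \<otimes>\<^bsub>G\<^esub> inv\<^bsub>G\<^esub> h \<otimes>\<^bsub>G\<^esub> inv\<^bsub>G\<^esub> v \<in> U"
      using ab h vH by (simp add: abelian_pair_def)
    ultimately show ?thesis using rho_rel_one_iff[OF co(2)] by blast
  qed
  then show ?thesis
    unfolding augmentation_subgroup_def
    by (intro B.generate_subgroup_incl[OF _ norms_subgroup(1)[OF co(2)]]) blast
qed

lemma abelian_injective:
  assumes "(H, U) \<in> base E" "abelian_pair H U" "rho_rel H U h \<one>\<^bsub>ob C H\<^esub>"
  shows "h \<in> U"
  using assms
proof (induction "card (rcosets\<^bsub>G\<lparr>carrier := H\<rparr>\<^esub> U)" arbitrary: H U h rule: less_induct)
  case less
  note HU = less.prems(1) and ab = less.prems(2) and r = less.prems(3)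
  interpret N: normal U "G\<lparr>carrier := H\<rparr>" by (rule baseD(3)[OF HU])
  show ?case
  proof (cases "card (rcosets\<^bsub>G\<lparr>carrier := H\<rparr>\<^esub> U) = 1")
    case True
    then show ?thesis using index_one_imp_eq[OF HU] rho_rel_carrier(1)[OF r] by simp
  next
    case False
    then obtain V where V: "V \<lhd> G\<lparr>carrier := H\<rparr>" "U \<subseteq> V"
      "prime (card (rcosets\<^bsub>G\<lparr>carrier := H\<rparr>\<^esub> V))"
      "card (rcosets\<^bsub>G\<lparr>carrier := V\<rparr>\<^esub> U) < card (rcosets\<^bsub>G\<lparr>carrier := H\<rparr>\<^esub> U)"
      using N.ex_normal_of_prime_index[OF finite_rcosets[OF HU] _ abelian_pair_comm_group[OF HU ab]]
      by auto
    note co = coherent_normal[OF HU V(1,2)]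
    note H = base_M(1)[OF HU]
    interpret A: comm_group "ob C H" by (rule C_ab(1)[OF H])
    interpret B: comm_group "ob C V" by (rule C_ab(1)[OF base_M(1)[OF co(2)]])
    interpret ind: group_hom "ob C V" "ob C H" "ind C H V"
      using C_hom(2)[OF H base_M(2)[OF co(1)]] by unfold_locales
    have VU: "V \<in> i_set M H" "U \<in> i_set M V"
      using base_M(2)[OF co(1)] base_M(2)[OF co(2)] .
    \<comment> \<open>In \<open>H/V\<close>, which has prime order, \<open>\<rho>\<close> is
      injective; this puts \<open>h\<close> into \<open>V\<close>, so that it can be compared with
      \<open>C(V)\<close>.\<close>
    have "rho_rel H V h \<one>\<^bsub>ob C H\<^esub>"
      using rho_rel_ind[OF co(1) co(4) r] C_ind_id[OF H] by simp
    then have hV: "h \<in> V" by (rule prime_injective[OF co(1) V(3)])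
    obtain d where d: "rho_rel V U h d" using rho_rel_total[OF co(2) hV] .
    have dV: "d \<in> carrier (ob C V)" by (rule rho_rel_carrier(2)[OF d])
    have one: "\<one>\<^bsub>G\<^esub> \<in> U" by (rule subgroup.one_closed[OF base_subgroup(1)[OF HU]])
    have hG: "h \<in> carrier G" using rho_rel_carrier(1)[OF r] base_subgroup(3)[OF HU] by blast
    \<comment> \<open>At \<open>(H, U)\<close> the element \<open>h\<close> is related both to
      \<open>1\<close> and to \<open>ind C H V d\<close>, so the latter is a norm from
      \<open>U\<close>.\<close>
    from rho_rel_mult[OF HU rho_rel_inv[OF HU r] rho_rel_ind[OF HU co(3) d]]
    have "rho_rel H U \<one>\<^bsub>G\<^esub> (ind C H V d)" using hG dV by simp
    then obtain u where u: "u \<in> carrier (ob C U)" "ind C H V d = ind C H U u"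
      using rho_rel_one_iff[OF HU one] by blast
    \<comment> \<open>Both \<open>d\<close> and \<open>w\<close> have the same image in
      \<open>C(H)\<close>. Their quotient thus lies in the kernel of \<open>ind C H V\<close>, which
      is contained in the augmentation subgroup and hence in the norms from \<open>U\<close>; as
      \<open>w\<close> is a norm from \<open>U\<close>, so is \<open>d\<close>.\<close>
    define w where "w = ind C V U u"
    have w: "w \<in> norms V U" "w \<in> carrier (ob C V)"
      using u hom_in_carrier[OF C_hom(2)[OF base_M(1)[OF co(2)] VU(2)]] by (auto simp: w_def)
    have "ind C H V w = ind C H V d"
      using C_ind_ind[OF H VU u(1)] u(2) by (simp add: w_def)
    then have "ind C H V (d \<otimes>\<^bsub>ob C V\<^esub> inv\<^bsub>ob C V\<^esub> w) = \<one>\<^bsub>ob C H\<^esub>"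
      using dV w(2) by simp
    then have "d \<otimes>\<^bsub>ob C V\<^esub> inv\<^bsub>ob C V\<^esub> w \<in> norms V U"
      using prime_kernel_ind[OF co(1) V(3)] augmentation_subset_norms[OF HU V(1,2) ab] dV w(2)
      by blast
    from subgroup.m_closed[OF norms_subgroup(1)[OF co(2)] this w(1)]
    have "d \<in> norms V U" using dV w(2) by (simp add: B.m_assoc)
    \<comment> \<open>Dividing the relation of \<open>h\<close> with \<open>d\<close> by this one
      shows that \<open>h\<close> is in the kernel at \<open>(V, U)\<close>, where the induction
      hypothesis applies.\<close>
    then have "rho_rel V U \<one>\<^bsub>G\<^esub> d" using rho_rel_one_iff[OF co(2) one] by blast
    from rho_rel_mult[OF co(2) d rho_rel_inv[OF co(2) this]]
    have "rho_rel V U h \<one>\<^bsub>ob C V\<^esub>" using hG dV by simp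
    moreover have "abelian_pair V U"
      using ab base_subgroup(2)[OF co(1)] unfolding abelian_pair_def by blast
    ultimately show ?thesis using less.hyps[OF V(4) co(2)] by blast
  qed
qed

text \<open>Let \<open>D\<close> be the preimage in \<open>H\<close> of the commutator subgroup of
  \<open>H/U\<close>. By coherence \<open>(H, D)\<close> belongs to the spectrum, and
  \<open>H/D\<close> is abelian. A kernel element at \<open>(H, U)\<close> is also one at
  \<open>(H, D)\<close>, hence lies in \<open>D\<close>, which means that its class at
  \<open>(H, U)\<close> is trivial.\<close>

lemma injective_base:
  assumes HU: "(H, U) \<in> base E" and r: "rho_rel H U h \<one>\<^bsub>ob C H\<^esub>"
  shows "pi_class H U h = \<one>\<^bsub>abelianization (ext_quot G (H, U))\<^esub>"
proof -
  interpret Q: group "ext_quot G (H, U)" by (rule ext_quot_group[OF HU])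
  interpret P: comm_group "abelianization (ext_quot G (H, U))" by (rule comm_group_pi[OF HU])
  interpret N: normal U "G\<lparr>carrier := H\<rparr>" by (rule baseD(3)[OF HU])
  define D where "D = \<Union>(com_t (ext_quot G (H, U)))"
  have comQ: "com_t (ext_quot G (H, U)) \<lhd> ext_quot G (H, U)"
    unfolding com_t_ext_quot[OF HU] by (rule Q.derived_self_is_normal)
  then have comN: "com_t (ext_quot G (H, U)) \<lhd> G\<lparr>carrier := H\<rparr> Mod U"
    using group_struct_cong(5)[of "ext_quot G (H, U)" "G\<lparr>carrier := H\<rparr> Mod U"]
    by (simp add: ext_quot_simps carrier_FactGroup set_mult_def fun_eq_iff)
  have D: "D \<lhd> G\<lparr>carrier := H\<rparr>" "U \<subseteq> D"
    unfolding D_def using N.factgroup_subgroup_union_normal[OF comN]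
      N.subset_Union_subgroup[OF normal_imp_subgroup[OF comN]] by auto
  have D_iff: "h \<in> D \<longleftrightarrow> pi_class H U h = \<one>\<^bsub>abelianization (ext_quot G (H, U))\<^esub>" if "h \<in> H" for h
    using N.factgroup_subgroup_union_char[OF normal_imp_subgroup[OF comN]] pi_class_one_iff[OF HU that] that
    by (simp add: D_def)
  have "abelian_pair H D"
    unfolding abelian_pair_def
  proof (intro ballI)
    fix a b assume ab: "a \<in> H" "b \<in> H"
    define z where "z = a \<otimes>\<^bsub>G\<^esub> b \<otimes>\<^bsub>G\<^esub> inv\<^bsub>G\<^esub> a \<otimes>\<^bsub>G\<^esub> inv\<^bsub>G\<^esub> b"
    have G: "a \<in> carrier G" "b \<in> carrier G" using ab base_subgroup(3)[OF HU] by blast+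
    note m = subgroup.m_closed[OF baseD(1)[OF HU]] and i = subgroup.m_inv_closed[OF baseD(1)[OF HU]]
    have zH: "z \<in> H" unfolding z_def by (intro m i ab)
    have "inv\<^bsub>G\<^esub> a \<otimes>\<^bsub>G\<^esub> (inv\<^bsub>G\<^esub> b \<otimes>\<^bsub>G\<^esub> (b \<otimes>\<^bsub>G\<^esub> a)) = \<one>\<^bsub>G\<^esub>"
      using G by (simp add: m_assoc[symmetric])
    then have "z \<otimes>\<^bsub>G\<^esub> (b \<otimes>\<^bsub>G\<^esub> a) = a \<otimes>\<^bsub>G\<^esub> b" using G by (simp add: z_def m_assoc)
    \<comment> \<open>The class of the commutator \<open>z\<close> is trivial because the products
      in both orders have the same class in an abelian group.\<close>
    then have "pi_class H U z \<otimes>\<^bsub>abelianization (ext_quot G (H, U))\<^esub> pi_class H U (b \<otimes>\<^bsub>G\<^esub> a) = pi_class H U (a \<otimes>\<^bsub>G\<^esub> b)"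
      using pi_class_mult[OF HU zH m[OF ab(2,1)]] by simp
    also have "\<dots> = pi_class H U (b \<otimes>\<^bsub>G\<^esub> a)"
      using pi_class_mult[OF HU ab] pi_class_mult[OF HU ab(2,1)] pi_class_closed ab P.m_comm by simp
    finally have "pi_class H U z = \<one>\<^bsub>abelianization (ext_quot G (H, U))\<^esub>"
      using P.l_cancel_one[of "pi_class H U (b \<otimes>\<^bsub>G\<^esub> a)" "pi_class H U z"] P.r_cancel_one[of "pi_class H U (b \<otimes>\<^bsub>G\<^esub> a)" "pi_class H U z"]
        pi_class_closed[OF zH] pi_class_closed[OF m[OF ab(2,1)]] by simp
    then show "a \<otimes>\<^bsub>G\<^esub> b \<otimes>\<^bsub>G\<^esub> inv\<^bsub>G\<^esub> a \<otimes>\<^bsub>G\<^esub> inv\<^bsub>G\<^esub> b \<in> D"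
      using D_iff[OF zH] by (simp add: z_def)
  qed
  moreover note co = coherent_normal[OF HU D]
  moreover have "rho_rel H D h \<one>\<^bsub>ob C H\<^esub>"
  proof -
    interpret A: comm_group "ob C H" by (rule C_ab(1)[OF base_M(1)[OF HU]])
    show ?thesis using rho_rel_ind[OF co(1) co(4) r] C_ind_id[OF base_M(1)[OF HU]] by simp
  qed
  ultimately have "h \<in> D" using abelian_injective by blast
  then show ?thesis using D_iff rho_rel_carrier(1)[OF r] by blast
qed

section \<open>From bijectivity to an isomorphism of RIC-functors\<close>

lemma rho_iso:
  assumes HU: "(H, U) \<in> base E"
  shows "\<rho> (H, U) \<in> iso (abelianization (ext_quot G (H, U))) (H0_obj C (H, U))"
proof -
  interpret P: comm_group "abelianization (ext_quot G (H, U))" by (rule comm_group_pi[OF HU])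
  interpret H0: group "H0_obj C (H, U)" by (rule H0_group[OF HU])
  interpret A: comm_group "ob C H" by (rule C_ab(1)[OF base_M(1)[OF HU]])
  interpret group_hom "abelianization (ext_quot G (H, U))" "H0_obj C (H, U)" "\<rho> (H, U)"
    using rho_hom[OF HU] by unfold_locales
  have "carrier (H0_obj C (H, U)) \<subseteq> \<rho> (H, U) ` carrier (abelianization (ext_quot G (H, U)))"
  proof
    fix X assume "X \<in> carrier (H0_obj C (H, U))"
    then obtain c where c: "c \<in> carrier (ob C H)" "X = H0_class C (H, U) c"
      by (auto simp: H0_obj_simps)
    then obtain h where "rho_rel H U h c"
      using surjective_base[OF HU] unfolding surjective_def by blast
    then have "X = \<rho> (H, U) (pi_class H U h)" "h \<in> H" using c by (simp_all add: rho_rel_def)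
    then show "X \<in> \<rho> (H, U) ` carrier (abelianization (ext_quot G (H, U)))"
      using pi_class_closed by blast
  qed
  moreover have "X = \<one>\<^bsub>abelianization (ext_quot G (H, U))\<^esub>"
    if X: "X \<in> carrier (abelianization (ext_quot G (H, U)))" and one: "\<rho> (H, U) X = \<one>\<^bsub>H0_obj C (H, U)\<^esub>" for X
  proof -
    obtain h where h: "h \<in> H" "X = pi_class H U h" using X by (auto simp: pi_carrier)
    have "rho_rel H U h \<one>\<^bsub>ob C H\<^esub>"
      using h one Group.hom_one[OF H0_class_hom[OF HU] A.is_group H0.is_group] by (simp add: rho_rel_def)
    then show ?thesis using injective_base[OF HU] h by simp
  qed
  ultimately show ?thesis unfolding iso_iff by blast
qed

lemma H0_discrete:
  assumes "(H, U) \<in> base E"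
  shows "topo (H0_obj C (H, U)) = discrete_topology (carrier (H0_obj C (H, U)))"
  unfolding H0_obj_def prod.case by (rule topo_top_quot_discrete[OF C_ab(2)[OF base_M(1)[OF assms]]])

lemma pi_discrete:
  assumes "(H, U) \<in> base E"
  shows "topo (abelianization (ext_quot G (H, U))) = discrete_topology (carrier (abelianization (ext_quot G (H, U))))"
  unfolding abelianization_def by (rule topo_top_quot_discrete[OF ext_quot_discrete[OF assms]])

text \<open>The inverse of \<open>\<rho>\<close> cancels \<open>\<rho>\<close> only on carriers, so
  the values of the structure maps must be known to lie there. For \<open>ind\<close> and
  \<open>con\<close> this is read off from representatives.\<close>

lemma pi_maps_closed:
  assumes x: "x \<in> base E"
  shows "\<lbrakk>y \<in> r_set E x; X \<in> carrier (abelianization (ext_quot G x))\<rbrakk>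
      \<Longrightarrow> res (pi_functor G) y x X \<in> carrier (abelianization (ext_quot G y))"
    and "\<lbrakk>y \<in> i_set E x; X \<in> carrier (abelianization (ext_quot G y))\<rbrakk>
      \<Longrightarrow> ind (pi_functor G) x y X \<in> carrier (abelianization (ext_quot G x))"
    and "\<lbrakk>g \<in> carrier G; X \<in> carrier (abelianization (ext_quot G x))\<rbrakk>
      \<Longrightarrow> con (pi_functor G) g x X \<in> carrier (abelianization (ext_quot G (conj_pair G g x)))"
proof -
  obtain H U where [simp]: "x = (H, U)" by fastforce
  obtain I V where [simp]: "y = (I, V)" by fastforce
  have HU: "(H, U) \<in> base E" using x by simp
  show "\<lbrakk>y \<in> r_set E x; X \<in> carrier (abelianization (ext_quot G x))\<rbrakk>
      \<Longrightarrow> res (pi_functor G) y x X \<in> carrier (abelianization (ext_quot G y))"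
    using pi_res_closed[OF HU] by simp
  show "ind (pi_functor G) x y X \<in> carrier (abelianization (ext_quot G x))"
    if y: "y \<in> i_set E x" and X: "X \<in> carrier (abelianization (ext_quot G y))"
  proof -
    obtain h where h: "h \<in> I" "X = pi_class I V h" using X by (auto simp: pi_carrier)
    moreover have "h \<in> H" using h E_le[OF HU, of I V] y by auto
    ultimately show ?thesis using pi_ind[OF HU, of I V h] y pi_class_closed by simp
  qed
  show "con (pi_functor G) g x X \<in> carrier (abelianization (ext_quot G (conj_pair G g x)))"
    if g: "g \<in> carrier G" and X: "X \<in> carrier (abelianization (ext_quot G x))"
  proof -
    obtain h where h: "h \<in> H" "X = pi_class H U h" using X by (auto simp: pi_carrier)
    have "g \<otimes>\<^bsub>G\<^esub> h \<otimes>\<^bsub>G\<^esub> inv\<^bsub>G\<^esub> g \<in> conj_set G g H" using h by (simp add: conj_set_def)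
    then show ?thesis using pi_con[OF HU g h(1)] pi_class_closed h(2) by (simp add: conj_pair_def)
  qed
qed

text \<open>The inverse is taken object by object. It commutes with the structure maps because
  \<open>\<rho>\<close> does: apply \<open>\<rho>\<close> to preimages and cancel.\<close>

lemma rho_ric_isomorphism: "ric_isomorphism G (conj_pair G) E (pi_functor G) (H0_functor G C) \<rho>"
proof -
  let ?P = "\<lambda>x. abelianization (ext_quot G x)"
  define \<psi> where "\<psi> x = inv_into (carrier (?P x)) (\<rho> x)" for x
  have iso: "\<rho> x \<in> iso (?P x) (H0_obj C x)" if "x \<in> base E" for x
    using rho_iso[of "fst x" "snd x"] that by simp
  have bij: "bij_betw (\<rho> x) (carrier (?P x)) (carrier (H0_obj C x))" if "x \<in> base E" for x
    using iso[OF that] by (simp add: iso_def)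
  have left: "\<psi> x (\<rho> x a) = a" if "x \<in> base E" "a \<in> carrier (?P x)" for x a
    unfolding \<psi>_def using bij_betw_inv_into_left[OF bij[OF that(1)] that(2)] .
  have right: "\<rho> x (\<psi> x b) = b" if "x \<in> base E" "b \<in> carrier (H0_obj C x)" for x b
    unfolding \<psi>_def using bij_betw_inv_into_right[OF bij[OF that(1)] that(2)] .
  have psi_hom: "\<psi> x \<in> hom (H0_obj C x) (?P x)" if "x \<in> base E" for x
  proof -
    obtain H U where [simp]: "x = (H, U)" by fastforce
    interpret P: comm_group "?P x" using comm_group_pi that by simp
    show ?thesis unfolding \<psi>_def using P.iso_set_sym[OF iso[OF that]] by (simp add: iso_def)
  qed
  have psi_closed: "\<psi> x b \<in> carrier (?P x)" if "x \<in> base E" "b \<in> carrier (H0_obj C x)" for x b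
    using hom_in_carrier[OF psi_hom] that by blast
  \<comment> \<open>The source is discrete, so continuity only requires that values lie in the
    target space.\<close>
  have psi_cont: "continuous_map (topo (H0_obj C x)) (topo (?P x)) (\<psi> x)" if x: "x \<in> base E" for x
  proof -
    obtain H U where [simp]: "x = (H, U)" by fastforce
    show ?thesis using H0_discrete[of H U] pi_discrete[of H U] psi_closed[OF x] x by auto
  qed
  have "ric_morphism G (conj_pair G) E (H0_functor G C) (pi_functor G) \<psi>"
    unfolding ric_morphism_def pi_ob H0_ob
  proof (intro conjI ballI)
    fix x assume x: "x \<in> base E"
    show "\<psi> x \<in> tab_hom (H0_obj C x) (?P x)"
      using psi_hom[OF x] psi_cont[OF x] by (simp add: tab_hom_def)
  next
    fix x y b assume x: "x \<in> base E" and y: "y \<in> r_set E x" and b: "b \<in> carrier (H0_obj C x)"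
    have "res (H0_functor G C) y x b = \<rho> y (res (pi_functor G) y x (\<psi> x b))"
      using rho_morphism x y psi_closed[OF x b] right[OF x b] by (simp add: ric_morphism_def)
    then show "\<psi> y (res (H0_functor G C) y x b) = res (pi_functor G) y x (\<psi> x b)"
      using left[OF r_set_base[OF x y] pi_maps_closed(1)[OF x y psi_closed[OF x b]]] by simp
  next
    fix x y b assume x: "x \<in> base E" and y: "y \<in> i_set E x" and b: "b \<in> carrier (H0_obj C y)"
    have y': "y \<in> base E" by (rule i_set_base[OF x y])
    have "ind (H0_functor G C) x y b = \<rho> x (ind (pi_functor G) x y (\<psi> y b))"
      using rho_morphism x y psi_closed[OF y' b] right[OF y' b] by (simp add: ric_morphism_def)
    then show "\<psi> x (ind (H0_functor G C) x y b) = ind (pi_functor G) x y (\<psi> y b)"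
      using left[OF x pi_maps_closed(2)[OF x y psi_closed[OF y' b]]] by simp
  next
    fix x g b assume x: "x \<in> base E" and g: "g \<in> carrier G" and b: "b \<in> carrier (H0_obj C x)"
    have "con (H0_functor G C) g x b = \<rho> (conj_pair G g x) (con (pi_functor G) g x (\<psi> x b))"
      using rho_morphism x g psi_closed[OF x b] right[OF x b] by (simp add: ric_morphism_def)
    then show "\<psi> (conj_pair G g x) (con (H0_functor G C) g x b) = con (pi_functor G) g x (\<psi> x b)"
      using left[OF base_act[OF x g] pi_maps_closed(3)[OF x g psi_closed[OF x b]]] by simp
  qed
  then show ?thesis
    unfolding ric_isomorphism_def using rho_morphism left right by auto
qed

section \<open>Norm subgroups and lattices of extensions\<close>

text \<open>The relation passes from \<open>(H, W)\<close> to \<open>(H, U)\<close>, where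
  \<open>\<rho>\<close> is injective with abelian quotient. With \<open>W\<close> below several
  \<open>U\<close>, one and the same pair \<open>h\<close>, \<open>c\<close> tests membership in all
  of their norm subgroups.\<close>

lemma mem_norms_iff:
  assumes HW: "(H, W) \<in> base E" and HU: "(H, U) \<in> base E" and WU: "W \<subseteq> U"
    and ab: "abelian_pair H U" and r: "rho_rel H W h c"
  shows "c \<in> norms H U \<longleftrightarrow> h \<in> U"
proof -
  interpret A: comm_group "ob C H" by (rule C_ab(1)[OF base_M(1)[OF HU]])
  have i: "(H, W) \<in> i_set E (H, U)" using coherent_normal(4)[OF HW baseD(3)[OF HU] WU] .
  have c: "c \<in> carrier (ob C H)" by (rule rho_rel_carrier(2)[OF r])
  have hG: "h \<in> carrier G" using rho_rel_carrier(1)[OF r] base_subgroup(3)[OF HU] by blast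
  have r': "rho_rel H U h c" using rho_rel_ind[OF HU i r] C_ind_id[OF base_M(1)[OF HU] c] by simp
  show ?thesis
  proof
    assume "h \<in> U"
    then show "c \<in> norms H U" using rho_rel_one_iff[OF HU] r' by blast
  next
    assume "c \<in> norms H U"
    then have "rho_rel H U \<one>\<^bsub>G\<^esub> c"
      using rho_rel_one_iff[OF HU subgroup.one_closed[OF base_subgroup(1)[OF HU]]] by blast
    from rho_rel_mult[OF HU r' rho_rel_inv[OF HU this]]
    have "rho_rel H U h \<one>\<^bsub>ob C H\<^esub>" using hG c by simp
    then show "h \<in> U" by (rule abelian_injective[OF HU ab])
  qed
qed

lemma com_t_imp_abelian_pair:
  assumes HU: "(H, U) \<in> base E" and com: "com_t (top_subgroup G H) \<subseteq> U"
  shows "abelian_pair H U"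
  unfolding abelian_pair_def
proof (intro ballI)
  fix a b assume ab: "a \<in> H" "b \<in> H"
  have inv: "inv\<^bsub>top_subgroup G H\<^esub> x = inv\<^bsub>G\<^esub> x" if "x \<in> H" for x
    using m_inv_consistent[OF baseD(1)[OF HU] that] by (simp add: group_top_subgroup_iff)
  interpret T: group "top_subgroup G H"
    using subgroup_imp_group[OF baseD(1)[OF HU]] by (simp add: group_top_subgroup_iff)
  have "derived (top_subgroup G H) H \<subseteq> H"
    using T.derived_in_carrier[of H] by simp
  moreover have "topspace (subtopology (topo G) H) = H"
    using G_topspace base_subgroup(3)[OF HU] by auto
  ultimately have "derived (top_subgroup G H) H \<subseteq> com_t (top_subgroup G H)"
    unfolding com_t_def by (simp add: closure_of_subset)
  moreover have "a \<otimes>\<^bsub>G\<^esub> b \<otimes>\<^bsub>G\<^esub> inv\<^bsub>G\<^esub> a \<otimes>\<^bsub>G\<^esub> inv\<^bsub>G\<^esub> b \<in> derived (top_subgroup G H) H"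
    unfolding derived_def
    by (intro generate.incl UN_I[OF ab(1)] UN_I[OF ab(2)]) (simp add: inv[OF ab(1)] inv[OF ab(2)])
  ultimately show "a \<otimes>\<^bsub>G\<^esub> b \<otimes>\<^bsub>G\<^esub> inv\<^bsub>G\<^esub> a \<otimes>\<^bsub>G\<^esub> inv\<^bsub>G\<^esub> b \<in> U" using com by blast
qed

text \<open>With \<open>U \<inter> V\<close> as common reference, \<open>lift\<close> supplies for
  each norm \<open>c\<close> a related \<open>h\<close>, and \<open>iff\<close> translates
  statements on norm subgroups into statements on \<open>U\<close>, \<open>V\<close> and their
  product.\<close>

lemma norms_lattice_morphism:
  assumes L: "admissible_family G E L" and H: "H \<in> base (flat E)"
  shows "injective_lattice_morphism G (L H) (ob C H) (norms H)"
proof -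
  have LH: "(H, U) \<in> base E" "abelian_pair H U" if "U \<in> L H" for U
    using L H that com_t_imp_abelian_pair unfolding admissible_family_def base_Ext[symmetric] by blast+
  have closed: "U <#>\<^bsub>G\<^esub> V \<in> L H" "U \<inter> V \<in> L H" if "U \<in> L H" "V \<in> L H" for U V
    using L H that unfolding admissible_family_def by blast+
  have iff: "c \<in> norms H U \<longleftrightarrow> h \<in> U" if "W \<in> L H" "U \<in> L H" "W \<subseteq> U" "rho_rel H W h c" for U W h c
    using mem_norms_iff[OF LH(1)[OF that(1)] LH(1)[OF that(2)] that(3) LH(2)[OF that(2)] that(4)] .
  have lift: "\<exists>h. rho_rel H W h c" if "W \<in> L H" "U \<in> L H" "c \<in> norms H U" for U W c
    using surjective_base[OF LH(1)[OF that(1)]] that(3)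
      subgroup.mem_carrier[OF norms_subgroup(1)[OF LH(1)[OF that(2)]]]
    unfolding surjective_def by blast
  show ?thesis
    unfolding injective_lattice_morphism_def
  proof (intro conjI ballI)
    fix U assume "U \<in> L H"
    then show "subgroup (norms H U) (ob C H)" using norms_subgroup(1) LH(1) by blast
  next
    show "inj_on (norms H) (L H)"
    proof -
      have "U \<subseteq> V" if U: "U \<in> L H" and V: "V \<in> L H" and eq: "norms H U = norms H V" for U V
      proof
        fix u assume u: "u \<in> U"
        have W: "U \<inter> V \<in> L H" using closed(2)[OF U V] .
        have "u \<in> H" using u base_subgroup(2)[OF LH(1)[OF U]] by blast
        then obtain c where c: "rho_rel H (U \<inter> V) u c" using rho_rel_total[OF LH(1)[OF W]] by blast
        then show "u \<in> V" using iff[OF W U _ c] iff[OF W V _ c] u eq by blast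
      qed
      then show ?thesis by (intro inj_onI equalityI) auto
    qed
  next
    fix U V assume U: "U \<in> L H" and V: "V \<in> L H"
    note W = closed(2)[OF U V] and UV = closed(1)[OF U V]
    note HW = LH(1)[OF W]
    note sub = base_subgroup(1)[OF LH(1)[OF U]] base_subgroup(1)[OF LH(1)[OF V]]
    interpret A: comm_group "ob C H" by (rule C_ab(1)[OF base_M(1)[OF HW]])
    show "norms H (U \<inter> V) = norms H U \<inter> norms H V"
    proof (intro equalityI subsetI)
      fix c assume c: "c \<in> norms H (U \<inter> V)"
      then obtain h where h: "rho_rel H (U \<inter> V) h c" using lift[OF W W] by blast
      then show "c \<in> norms H U \<inter> norms H V"
        using iff[OF W U _ h] iff[OF W V _ h] iff[OF W W _ h] c by blast
    next
      fix c assume c: "c \<in> norms H U \<inter> norms H V"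
      then obtain h where h: "rho_rel H (U \<inter> V) h c" using lift[OF W U] by blast
      then show "c \<in> norms H (U \<inter> V)"
        using iff[OF W U _ h] iff[OF W V _ h] iff[OF W W _ h] c by blast
    qed
    have le: "U \<subseteq> U <#>\<^bsub>G\<^esub> V" "V \<subseteq> U <#>\<^bsub>G\<^esub> V"
      using subgroup.one_closed[OF sub(1)] subgroup.one_closed[OF sub(2)]
        subgroup.mem_carrier[OF sub(1)] subgroup.mem_carrier[OF sub(2)]
      by (force simp: set_mult_def)+
    show "norms H (U <#>\<^bsub>G\<^esub> V) = generate (ob C H) (norms H U \<union> norms H V)"
    proof
      have "norms H U \<subseteq> norms H (U <#>\<^bsub>G\<^esub> V)"
      proof
        fix c assume c: "c \<in> norms H U"
        then obtain h where h: "rho_rel H (U \<inter> V) h c" using lift[OF W U] by blast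
        then show "c \<in> norms H (U <#>\<^bsub>G\<^esub> V)"
          using iff[OF W U _ h] iff[OF W UV _ h] c le by blast
      qed
      moreover have "norms H V \<subseteq> norms H (U <#>\<^bsub>G\<^esub> V)"
      proof
        fix c assume c: "c \<in> norms H V"
        then obtain h where h: "rho_rel H (U \<inter> V) h c" using lift[OF W V] by blast
        then show "c \<in> norms H (U <#>\<^bsub>G\<^esub> V)"
          using iff[OF W V _ h] iff[OF W UV _ h] c le by blast
      qed
      ultimately show "generate (ob C H) (norms H U \<union> norms H V) \<subseteq> norms H (U <#>\<^bsub>G\<^esub> V)"
        using A.generate_subgroup_incl[OF _ norms_subgroup(1)[OF LH(1)[OF UV]]] by simp
    next
      show "norms H (U <#>\<^bsub>G\<^esub> V) \<subseteq> generate (ob C H) (norms H U \<union> norms H V)"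
      proof
        fix c assume c: "c \<in> norms H (U <#>\<^bsub>G\<^esub> V)"
        then obtain h where h: "rho_rel H (U \<inter> V) h c" using lift[OF W UV] by blast
        then have "h \<in> U <#>\<^bsub>G\<^esub> V" using iff[OF W UV _ h] c le by blast
        \<comment> \<open>The splitting of \<open>h\<close> is lifted to \<open>c\<close>: if
          \<open>d\<close> is related to \<open>u\<close>, then \<open>d\<close> is a norm from
          \<open>U\<close>, and the quotient of \<open>c\<close> by \<open>d\<close> is related to
          \<open>v\<close>, hence a norm from \<open>V\<close>.\<close>
        then obtain u v where uv: "u \<in> U" "v \<in> V" "h = u \<otimes>\<^bsub>G\<^esub> v" by (auto simp: set_mult_def)
        have uG: "u \<in> carrier G" "v \<in> carrier G" using uv subgroup.mem_carrier sub by metis+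
        have "u \<in> H" using uv base_subgroup(2)[OF LH(1)[OF U]] by blast
        then obtain d where d: "rho_rel H (U \<inter> V) u d" using rho_rel_total[OF HW] by blast
        have cd: "c \<in> carrier (ob C H)" "d \<in> carrier (ob C H)" using h d rho_rel_carrier(2) by blast+
        have dU: "d \<in> norms H U" using iff[OF W U _ d] uv by blast
        from rho_rel_mult[OF HW rho_rel_inv[OF HW d] h]
        have e: "rho_rel H (U \<inter> V) v (inv\<^bsub>ob C H\<^esub> d \<otimes>\<^bsub>ob C H\<^esub> c)"
          using uv(3) uG by (simp add: m_assoc[symmetric])
        then have eV: "inv\<^bsub>ob C H\<^esub> d \<otimes>\<^bsub>ob C H\<^esub> c \<in> norms H V" using iff[OF W V _ e] uv by blast
        have "c = d \<otimes>\<^bsub>ob C H\<^esub> (inv\<^bsub>ob C H\<^esub> d \<otimes>\<^bsub>ob C H\<^esub> c)"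
          using cd by (simp add: A.m_assoc[symmetric])
        moreover have "d \<otimes>\<^bsub>ob C H\<^esub> (inv\<^bsub>ob C H\<^esub> d \<otimes>\<^bsub>ob C H\<^esub> c) \<in> generate (ob C H) (norms H U \<union> norms H V)"
          using dU eV by (intro generate.eng generate.incl) auto
        ultimately show "c \<in> generate (ob C H) (norms H U \<union> norms H V)" by simp
      qed
    qed
  qed
qed

lemma class_field_theory_rho: "class_field_theory G E C \<rho>"
  unfolding class_field_theory_def using rho_ric_isomorphism norms_lattice_morphism by blast

end

theorem corollary3p5p11:
  fixes G :: "'a top_monoid"
    and E :: "('a set \<times> 'a set) ric_domain"
    and M :: "'a set ric_domain"
    and C :: "('a, 'a set, 'c) ric_functor"
    and \<rho> :: "'a set \<times> 'a set \<Rightarrow> 'a set set \<Rightarrow> 'c set"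
  assumes "topological_group G"
    and "compact_space (topo G)"
    and "Hausdorff_space (topo G)"
    and "spectrum G E"
    and "coherent G E"
    and "mackey_cover G E M"
    and "arithmetic_system G M"
    and "cohomological_mackey_functor G M C"
    and "\<And>l H U. \<lbrakk>(H, U) \<in> base E; cyclic_prime_quot G H U l\<rbrakk> \<Longrightarrow> class_field_axiom G C H U"
    and "prime_morphism G E (pi_functor G) (H0_functor G C) \<rho>"
  shows "class_field_theory G E C \<rho>"
proof -
  interpret class_field_data G E M C \<rho>
    using assms by unfold_locales
  show ?thesis by (rule class_field_theory_rho)
qed

end
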